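(* Let $m$ be a positive integer, let $\lambda$ be a partition with $\ell(\lambda)\le m$, and let $\kappa(\lambda)=\sum_i(i-1)\lambda_i$. Let $$f_{sp}^\lambda(q)=\prod_{(i,j)\in[\lambda]}\frac{[2m+r_\lambda(i,j)]}{[h(i,j)]}.$$ Then $$f_{sp}^\lambda(q)=q^{-\kappa(\lambda)}\sum_{T\in SP(\lambda,2m)}q^{\mathrm{pwr}(T)}.$$
   Context: Partitions: $\lambda=(\lambda_1\ge\cdots\ge\lambda_k>0)$ has length $\ell(\lambda)=k$, Young diagram $[\lambda]$ (left-justified rows, $(i,j)$ = row $i$, column $j$), conjugate $\lambda^t$ ($\lambda^t_j$ = length of column $j$); set $\lambda_i=0$ for $i>\ell(\lambda)$ and $\lambda^t_j=0$ beyond its length. $q$-notation: $[k]=1-q^k$ for a positive integer $k$; $h(i,j)=\lambda_i+\lambda^t_j-i-j+1$ is the hook length; $r_\lambda(i,j)=\lambda_i+\lambda_j-i-j+2$ if $i>j$ and $r_\lambda(i,j)=i+j-\lambda^t_i-\lambda^t_j$ if $i\le j$. Kashiwara–Nakashima (KN) tableaux: let $\mathcal M=\{1<2<\cdots<m<\overline m<\cdots<\overline2<\overline1\}$. $SP(\lambda,2m)$ is the set of fillings $T$ of the Young diagram of $\lambda$ with letters of $\mathcal M$ such that: (1) entries weakly increase along rows (left to right) and strictly increase down columns; (2) whenever a column contains both $i$ and $\overline i$, with $i$ in the $p$-th box from the top of the column and $\overline i$ in the $q$-th box from the bottom, then $p+q\le i$; (3) for any two adjacent columns, any $i\le j$ in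 $\{1,\dots,m\}$, and rows (counted from the top) $p\le q<r\le s$: if either [the left column has $i$ in row $p$ and the right column has $j$ in row $q$, $\overline j$ in row $r$, $\overline i$ in row $s$] or [the left column has $i$ in row $p$, $j$ in row $q$, $\overline j$ in row $r$ and the right column has $\overline i$ in row $s$], then $(q-p)+(s-r)<j-i$. For $T\in SP(\lambda,2m)$, let $a_i$ (resp. $a_{\overline i}$) be the number of entries equal to $i$ (resp. $\overline i$); then $\mathrm{pwr}(T)=\sum_{i=1}^m\big((i-1)a_i+(2m-i)a_{\overline i}\big)$. *)

theory Defs
  imports
    "HOL-Library.FuncSet"
    "HOL-Computational_Algebra.Computational_Algebra"
begin

definition is_partition :: "nat list \<Rightarrow> bool" where
  "is_partition lam \<longleftrightarrow> sorted_wrt (\<ge>) lam \<and> (\<forall>x\<in>set lam. 0 < x)"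

text \<open>Rows and columns are numbered from 1; parts beyond the length are 0.\<close>

definition part :: "nat list \<Rightarrow> nat \<Rightarrow> nat" where
  "part lam i = (if 1 \<le> i \<and> i \<le> length lam then lam ! (i - 1) else 0)"

definition diagram :: "nat list \<Rightarrow> (nat \<times> nat) set" where
  "diagram lam = {(i, j). 1 \<le> i \<and> i \<le> length lam \<and> 1 \<le> j \<and> j \<le> part lam i}"

text \<open>The part \<open>\<lambda>\<^sup>t\<^sub>j\<close> of the conjugate partition, i.e. the length of column \<open>j\<close>.\<close>

definition conj_part :: "nat list \<Rightarrow> nat \<Rightarrow> nat" where
  "conj_part lam j = card {i. (i, j) \<in> diagram lam}"

definition kappa :: "nat list \<Rightarrow> nat" where
  "kappa lam = (\<Sum>i = 1..length lam. (i - 1) * part lam i)"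

definition hook :: "nat list \<Rightarrow> nat \<Rightarrow> nat \<Rightarrow> int" where
  "hook lam i j = int (part lam i) + int (conj_part lam j) - int i - int j + 1"

definition r_sp :: "nat list \<Rightarrow> nat \<Rightarrow> nat \<Rightarrow> int" where
  "r_sp lam i j =
     (if i > j then int (part lam i) + int (part lam j) - int i - int j + 2
      else int i + int j - int (conj_part lam i) - int (conj_part lam j))"

definition q_bracket :: "'a::field \<Rightarrow> int \<Rightarrow> 'a" where
  "q_bracket q k = 1 - q powi k"

definition f_sp :: "'a::field \<Rightarrow> nat \<Rightarrow> nat list \<Rightarrow> 'a" where
  "f_sp q m lam =
     (\<Prod>(i, j)\<in>diagram lam.
        q_bracket q (2 * int m + r_sp lam i j) / q_bracket q (hook lam i j))"

text \<open>The indeterminate \<open>q\<close> of the field of rational functions over the rationals.\<close>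

definition qvar :: "rat poly fract" where
  "qvar = Fract [:0, 1:] 1"

datatype letter = Pos nat | Bar nat

instantiation letter :: linorder
begin

fun less_letter :: "letter \<Rightarrow> letter \<Rightarrow> bool" where
  "Pos i < Pos j \<longleftrightarrow> i < j"
| "Pos i < Bar j \<longleftrightarrow> True"
| "Bar i < Pos j \<longleftrightarrow> False"
| "Bar i < Bar j \<longleftrightarrow> j < i"

definition less_eq_letter :: "letter \<Rightarrow> letter \<Rightarrow> bool" where
  "x \<le> y \<longleftrightarrow> x < y \<or> x = (y :: letter)"

instance
proof
  fix x y z :: letter
  show "x < y \<longleftrightarrow> x \<le> y \<and> \<not> y \<le> x"
    by (cases x; cases y) (auto simp: less_eq_letter_def)
  show "x \<le> x"
    by (simp add: less_eq_letter_def)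
  show "x \<le> z" if "x \<le> y" "y \<le> z"
    using that by (cases x; cases y; cases z) (auto simp: less_eq_letter_def)
  show "x = y" if "x \<le> y" "y \<le> x"
    using that by (cases x; cases y) (auto simp: less_eq_letter_def)
  show "x \<le> y \<or> y \<le> x"
    by (cases x; cases y) (auto simp: less_eq_letter_def)
qed

end

definition letters :: "nat \<Rightarrow> letter set" where
  "letters m = Pos ` {1..m} \<union> Bar ` {1..m}"

type_synonym filling = "nat \<times> nat \<Rightarrow> letter"

definition entry_at :: "nat list \<Rightarrow> filling \<Rightarrow> nat \<Rightarrow> nat \<Rightarrow> letter \<Rightarrow> bool" where
  "entry_at lam T i j x \<longleftrightarrow> (i, j) \<in> diagram lam \<and> T (i, j) = x"

definition semistandard :: "nat list \<Rightarrow> filling \<Rightarrow> bool" where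
  "semistandard lam T \<longleftrightarrow>
     (\<forall>i j j'. (i, j) \<in> diagram lam \<and> (i, j') \<in> diagram lam \<and> j < j' \<longrightarrow> T (i, j) \<le> T (i, j')) \<and>
     (\<forall>i i' j. (i, j) \<in> diagram lam \<and> (i', j) \<in> diagram lam \<and> i < i' \<longrightarrow> T (i, j) < T (i', j))"

text \<open>Row \<open>b\<close> of column \<open>c\<close> is box number \<open>\<lambda>\<^sup>t\<^sub>c + 1 - b\<close> counted from the bottom.\<close>

definition column_condition :: "nat list \<Rightarrow> filling \<Rightarrow> bool" where
  "column_condition lam T \<longleftrightarrow>
     (\<forall>c i p b. entry_at lam T p c (Pos i) \<and> entry_at lam T b c (Bar i) \<longrightarrow>
        p + (conj_part lam c + 1 - b) \<le> i)"

definition adjacent_condition :: "nat \<Rightarrow> nat list \<Rightarrow> filling \<Rightarrow> bool" where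
  "adjacent_condition m lam T \<longleftrightarrow>
     (\<forall>c i j p q r s.
        1 \<le> i \<and> i \<le> j \<and> j \<le> m \<and> p \<le> q \<and> q < r \<and> r \<le> s \<and>
        (entry_at lam T p c (Pos i) \<and> entry_at lam T q (c + 1) (Pos j) \<and>
           entry_at lam T r (c + 1) (Bar j) \<and> entry_at lam T s (c + 1) (Bar i) \<or>
         entry_at lam T p c (Pos i) \<and> entry_at lam T q c (Pos j) \<and>
           entry_at lam T r c (Bar j) \<and> entry_at lam T s (c + 1) (Bar i)) \<longrightarrow>
        (q - p) + (s - r) < j - i)"

text \<open>\<open>SP m lam\<close> is \<open>SP(\<lambda>, 2m)\<close>. Fillings are extensional (\<open>undefined\<close> outside the
  diagram), so that distinct elements are distinct fillings.\<close>

definition SP :: "nat \<Rightarrow> nat list \<Rightarrow> filling set" where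
  "SP m lam = {T \<in> diagram lam \<rightarrow>\<^sub>E letters m.
     semistandard lam T \<and> column_condition lam T \<and> adjacent_condition m lam T}"

definition num_entries :: "nat list \<Rightarrow> filling \<Rightarrow> letter \<Rightarrow> nat" where
  "num_entries lam T x = card {b \<in> diagram lam. T b = x}"

definition pwr :: "nat \<Rightarrow> nat list \<Rightarrow> filling \<Rightarrow> nat" where
  "pwr m lam T =
     (\<Sum>i = 1..m. (i - 1) * num_entries lam T (Pos i) + (2 * m - i) * num_entries lam T (Bar i))"

lemma finite_diagram: "finite (diagram lam)"
proof -
  have "diagram lam \<subseteq> (SIGMA i:{1..length lam}. {1..part lam i})"
    by (auto simp: diagram_def)
  then show ?thesis
    by (rule finite_subset) auto
qed

lemma finite_SP: "finite (SP m lam)"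
proof -
  have "finite (diagram lam \<rightarrow>\<^sub>E letters m)"
    by (intro finite_PiE finite_diagram) (auto simp: letters_def)
  then show ?thesis
    by (rule finite_subset[rotated]) (auto simp: SP_def)
qed

end

theory Submission
  imports Defs "HOL-Combinatorics.Permutations" "Jordan_Normal_Form.Determinant"
begin

text \<open>With \<open>x\<^sub>i = q\<^bsup>i - m - 1/2\<^esup>\<close> and \<open>x\<close> of a barred letter the inverse of \<open>x\<close> of the unbarred one, the power of \<open>q\<close>
  attached to a letter is its \<open>x\<close>, up to a factor common to all letters. So the sum over tableaux is, up to a power of
  \<open>q\<close>, a specialization of the generating function \<open>F\<close> of the weights of KN tableaux. The proof has two halves: \<open>F\<close> is
  the symplectic Weyl character, that is \<open>A(\<rho>) F = A(\<rho> + \<lambda>)\<close> for the alternating sum \<open>A\<close> over the hyperoctahedral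
  group, and the two alternants, which factor at this point, have the stated hook-content product as their quotient.

  \<^bold>\<open>The character.\<close> Read a tableau column by column, from the right to the left and downwards. For a simple root
  \<open>\<alpha>\<^sub>k\<close> every letter \<open>x\<close> has a sign \<open>eps k x\<close> in \<open>{-1, 0, 1}\<close>, its pairing with the coroot. The Kashiwara operators
  change one letter of a word, called a pivot here: no sum of signs over a stretch of letters ending just before it is
  positive, and none over a stretch starting just after it is negative. If a set of words is closed under flipping
  pivots, then the words fall into strings on which the simple reflection acts by reversal
  (\<open>weights_reflect\<close>). Hence the weights of these words are invariant under the Weyl group, which turns
  \<open>A(\<rho>) F\<close> into the sum of \<open>A(\<rho> + wt w)\<close> over all words \<open>w\<close>. A word that leaves the dominant chamber does so for the
  first time across the wall of a unique \<open>\<alpha>\<^sub>k\<close>, where \<open>\<rho>\<close> plus the weight of the prefix read so far is fixed by the reflection;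
  reversing the strings of the remaining suffix changes the sign of \<open>A\<close>, so these words cancel
  (\<open>sum_over_highest\<close>). What remains are the words that stay dominant, and among the KN tableaux only the one whose
  \<open>i\<close>-th row consists of \<open>i\<close> does (\<open>highest_unique\<close>).

  \<^bold>\<open>Closure.\<close> Let \<open>P\<^sub>C(i)\<close> and \<open>M\<^sub>C(i)\<close> count the entries of a column \<open>C\<close> that are at most \<open>i\<close>, respectively at
  least \<open>i\<close> barred, and let \<open>N = P + M\<close>. All conditions on a tableau with strict columns become linear: \<open>N\<^sub>C(j) \<le> j\<close>, and
  for adjacent columns \<open>C, D\<close> whose heights differ by \<open>\<delta>\<close>, all \<open>i \<le> j\<close> satisfy
  \<open>N\<^sub>D(j) - j \<le> P\<^sub>C(i) + M\<^sub>D(i) - i\<close> and \<open>N\<^sub>C(j) - j - \<delta> \<le> P\<^sub>C(i) + M\<^sub>D(i) - i\<close> (\<open>SP_iff_counts\<close>). A flip changes the counts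
  of one column at one index only. If it destroyed one of the inequalities, that one would be an equality before; then
  the inequalities at the two neighbouring indices determine which letters occur near the pivot, and these letters
  contradict the pivot condition or a further inequality (\<open>pair_counts_flip_left\<close>, \<open>pair_counts_flip_right\<close>).

  \<^bold>\<open>The product.\<close> At this point an alternant is a Vandermonde determinant, and \<open>A(\<rho> + \<lambda>)\<close> becomes a product over the
  numbers \<open>l\<^sub>i = \<lambda>\<^sub>i + m + 1 - i\<close>, namely of all \<open>[l\<^sub>i]\<close> and all \<open>[l\<^sub>i - l\<^sub>j] [l\<^sub>i + l\<^sub>j]\<close>
  (\<open>alternant_eq_weyl_product\<close>). Removing the first row and column of the diagram keeps the hook lengths and the numbers
  \<open>r\<^sub>\<lambda>\<close> of the other boxes and replaces \<open>l\<^sub>1\<close> by \<open>m + 1 - \<ell>(\<lambda>)\<close>, so the hook-content product follows by induction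
  (\<open>hook_product\<close>). To avoid half-integral exponents the computation is made at \<open>q = t\<^sup>2\<close>; the identity of rational
  functions follows because it holds at infinitely many rational \<open>q\<close>.

  Components of weights and simple roots are numbered from \<open>0\<close>: component \<open>j\<close> belongs to the letter \<open>j + 1\<close>.\<close>

section \<open>Words and their strings\<close>

definition letter_wt :: "letter \<Rightarrow> nat \<Rightarrow> int" where
  "letter_wt x j = (case x of Pos i \<Rightarrow> of_bool (i = Suc j) | Bar i \<Rightarrow> - of_bool (i = Suc j))"

definition wt :: "letter list \<Rightarrow> nat \<Rightarrow> int" where
  "wt w j = (\<Sum>x\<leftarrow>w. letter_wt x j)"

definition eps :: "nat \<Rightarrow> letter \<Rightarrow> int" where
  "eps k x = letter_wt x k - letter_wt x (Suc k)"

definition height :: "nat \<Rightarrow> letter list \<Rightarrow> int" where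
  "height k w = (\<Sum>x\<leftarrow>w. eps k x)"

text \<open>The simple roots of type \<open>C\<^sub>m\<close>; the last one is the long root.\<close>

definition simple_root :: "nat \<Rightarrow> nat \<Rightarrow> nat \<Rightarrow> int" where
  "simple_root m k j = (if Suc k < m then of_bool (j = k) - of_bool (j = Suc k) else 2 * of_bool (j = k))"

text \<open>For the last index \<open>k = m - 1\<close> this is the reflection in the long root.\<close>

definition reflect :: "nat \<Rightarrow> nat \<Rightarrow> (nat \<Rightarrow> int) \<Rightarrow> nat \<Rightarrow> int" where
  "reflect m k \<mu> = (if Suc k < m then \<mu> \<circ> transpose k (Suc k) else \<mu>(k := - \<mu> k))"

text \<open>The letter reflected in the \<open>k\<close>-th simple root; for \<open>k = m - 1\<close> the letter \<open>m\<close> is exchanged with its barred copy.\<close>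

definition flip :: "nat \<Rightarrow> nat \<Rightarrow> letter \<Rightarrow> letter" where
  "flip m k x =
     (if Suc k < m
      then (case x of Pos i \<Rightarrow> Pos (transpose (Suc k) (Suc (Suc k)) i)
                    | Bar i \<Rightarrow> Bar (transpose (Suc k) (Suc (Suc k)) i))
      else (case x of Pos i \<Rightarrow> if i = m then Bar i else x | Bar i \<Rightarrow> if i = m then Pos i else x))"

text \<open>The letter between \<open>u\<close> and \<open>v\<close> is the one on which a Kashiwara operator acts: if a letter of sign \<open>1\<close> is bracketed
  with a later letter of sign \<open>-1\<close>, the unbracketed signs read \<open>-1, \<dots>, -1, 1, \<dots>, 1\<close>, and the two inequalities single
  out the last \<open>-1\<close> and the first \<open>1\<close> of this sequence.\<close>

definition pivot :: "nat \<Rightarrow> letter list \<Rightarrow> letter list \<Rightarrow> bool" where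
  "pivot k u v \<longleftrightarrow>
     (\<forall>u1 u2. u = u1 @ u2 \<longrightarrow> height k u2 \<le> 0) \<and> (\<forall>v1 v2. v = v1 @ v2 \<longrightarrow> 0 \<le> height k v1)"

definition flips :: "nat \<Rightarrow> nat \<Rightarrow> int \<Rightarrow> letter list \<Rightarrow> letter list \<Rightarrow> bool" where
  "flips m k e w w' \<longleftrightarrow>
     (\<exists>u x v. w = u @ x # v \<and> w' = u @ flip m k x # v \<and> pivot k u v \<and> eps k x = e)"

definition step :: "nat \<Rightarrow> nat \<Rightarrow> int \<Rightarrow> letter list \<Rightarrow> letter list" where
  "step m k e w = (THE w'. flips m k e w w')"

definition flip_closed :: "nat \<Rightarrow> nat \<Rightarrow> letter list set \<Rightarrow> bool" where
  "flip_closed m k L \<longleftrightarrow>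
     (\<forall>u x v. u @ x # v \<in> L \<longrightarrow> pivot k u v \<longrightarrow> eps k x \<noteq> 0 \<longrightarrow> u @ flip m k x # v \<in> L)"

lemma wt_simps [simp]: "wt [] j = 0" "wt (x # w) j = letter_wt x j + wt w j" "wt (u @ v) j = wt u j + wt v j"
  by (simp_all add: wt_def)

lemma height_simps [simp]:
  "height k [] = 0" "height k (x # w) = eps k x + height k w" "height k (u @ v) = height k u + height k v"
  by (simp_all add: height_def)

text \<open>For the last simple root, component \<open>m\<close> of the weight is \<open>0\<close>, so the formula is right for the long root as well.\<close>

lemma height_eq_wt: "height k w = wt w k - wt w (Suc k)"
  by (induction w) (auto simp: eps_def)

lemma eps_cases: "x \<in> letters m \<Longrightarrow> eps k x = -1 \<or> eps k x = 0 \<or> eps k x = 1"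
  by (auto simp: eps_def letter_wt_def letters_def)

lemma flip_flip: "k < m \<Longrightarrow> flip m k (flip m k x) = x"
  by (cases x) (auto simp: flip_def)

lemma flip_letters: "k < m \<Longrightarrow> x \<in> letters m \<Longrightarrow> flip m k x \<in> letters m"
  by (auto simp: flip_def letters_def transpose_def)

lemma letter_wt_flip:
  assumes "k < m" "x \<in> letters m"
  shows "letter_wt (flip m k x) j = letter_wt x j - eps k x * simple_root m k j"
  using assms by (auto simp: flip_def letters_def letter_wt_def eps_def simple_root_def transpose_def)

lemma eps_flip: "k < m \<Longrightarrow> x \<in> letters m \<Longrightarrow> eps k (flip m k x) = - eps k x"
  by (auto simp: flip_def letters_def letter_wt_def eps_def transpose_def)

lemma wt_outside: "set w \<subseteq> letters m \<Longrightarrow> wt w m = 0"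
  by (induction w) (auto simp: letters_def letter_wt_def)

lemma reflect_eq_minus_root:
  assumes "k < m" "Suc k < m \<or> \<mu> (Suc k) = 0"
  shows "reflect m k \<mu> j = \<mu> j - (\<mu> k - \<mu> (Suc k)) * simple_root m k j"
  using assms by (auto simp: reflect_def simple_root_def transpose_def)

lemma pivotD1: "pivot k (u1 @ u2) v \<Longrightarrow> height k u2 \<le> 0"
  by (simp add: pivot_def)

lemma pivotD2: "pivot k u (v1 @ v2) \<Longrightarrow> 0 \<le> height k v1"
  by (simp add: pivot_def)

text \<open>Of two pivots of the same sign \<open>e\<close>, consider the stretch \<open>s\<close> of letters strictly between them: the left pivot forces
  both \<open>s\<close> and \<open>s\<close> extended by the right pivot to have nonnegative height, the right pivot forces both \<open>s\<close> and \<open>s\<close>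
  extended by the left pivot to have nonpositive height, so \<open>e = 0\<close>.\<close>

lemma pivot_unique:
  assumes "u @ x # v = u' @ x' # v'" "pivot k u v" "pivot k u' v'"
    "eps k x = e" "eps k x' = e" "e \<noteq> 0"
  shows "u = u' \<and> x = x' \<and> v = v'"
proof -
  have False
    if eq: "u' = u @ x # s" "v = s @ x' # v'" and p: "pivot k u v" "pivot k u' v'"
      and "eps k x = e" "eps k x' = e"
    for s u x v u' x' v'
  proof -
    have "0 \<le> height k s" "0 \<le> height k (s @ [x'])"
      using p(1) eq pivotD2[of k u s "x' # v'"] pivotD2[of k u "s @ [x']" v'] by auto
    moreover have "height k s \<le> 0" "height k (x # s) \<le> 0"
      using p(2) eq pivotD1[of k "u @ [x]" s v'] pivotD1[of k u "x # s" v'] by auto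
    ultimately show False using that \<open>e \<noteq> 0\<close> by auto
  qed
  note no = this
  from assms(1) consider s where "u = u' @ s" "s @ x # v = x' # v'"
    | s where "u' = u @ s" "x # v = s @ x' # v'"
    by (auto simp: append_eq_append_conv2)
  then show ?thesis
  proof cases
    case 1
    show ?thesis
    proof (cases s)
      case Nil
      then show ?thesis using 1 by auto
    next
      case (Cons y t)
      then have "u = u' @ x' # t" "v' = t @ x # v" using 1 by auto
      then show ?thesis using no[of u u' x' t v' x v] assms by blast
    qed
  next
    case 2
    show ?thesis
    proof (cases s)
      case Nil
      then show ?thesis using 2 by auto
    next
      case (Cons y t)
      then have "u' = u @ x # t" "v = t @ x' # v'" using 2 by auto
      then show ?thesis using no[of u' u x t v x' v'] assms by blast
    qed
  qed
qed

lemma flips_unique: "flips m k e w w' \<Longrightarrow> flips m k e w w'' \<Longrightarrow> e \<noteq> 0 \<Longrightarrow> w' = w''"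
  unfolding flips_def using pivot_unique by blast

lemma step_eq: "flips m k e w w' \<Longrightarrow> e \<noteq> 0 \<Longrightarrow> step m k e w = w'"
  unfolding step_def using flips_unique by blast

text \<open>The pivot condition does not mention the pivot itself, so a flipped pivot is a pivot of the opposite sign.\<close>

lemma flips_sym:
  assumes "flips m k e w w'" "k < m" "set w \<subseteq> letters m"
  shows "flips m k (- e) w' w"
  using assms unfolding flips_def by (force simp: flip_flip eps_flip)

text \<open>The pivot sits at the last place where the partial sums of the signs attain their minimum. The height of a suffix counts how
  often the step can be repeated, and the flip lowers it by one only.\<close>

lemma plus_pivot_exists:
  assumes "set w \<subseteq> letters m" "w = w1 @ w2" "height k w2 \<ge> int n + 1"
  shows "\<exists>w'. flips m k 1 w w' \<and> (\<exists>w1' w2'. w' = w1' @ w2' \<and> height k w2' \<ge> int n) "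
proof -
  define g where "g i = height k (take i w)" for i
  define S where "S = {i. i \<le> length w \<and> (\<forall>j\<le>length w. g i \<le> g j)}"
  have "finite S" by (simp add: S_def)
  have "Min (g ` {..length w}) \<in> g ` {..length w}" by (intro Min_in) auto
  then obtain i where i: "Min (g ` {..length w}) = g i" "i \<le> length w" by (elim imageE) simp
  have "g i \<le> g j" if "j \<le> length w" for j
    unfolding i(1)[symmetric] using that by (intro Min_le) auto
  then have "i \<in> S" using i(2) unfolding S_def by auto
  then have "S \<noteq> {}" by auto
  \<comment> \<open>the last minimum of the partial sums\<close>
  define p where "p = Max S"
  have "p \<in> S" using \<open>finite S\<close> \<open>S \<noteq> {}\<close> by (simp add: p_def)
  have after: "g p < g j" if "p < j" "j \<le> length w" for j
  proof (rule ccontr)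
    assume "\<not> g p < g j"
    then have "j \<in> S" using \<open>p \<in> S\<close> that by (force simp: S_def)
    then have "j \<le> p" using \<open>finite S\<close> by (simp add: p_def)
    then show False using that by simp
  qed
  have tot: "height k (drop i w) = height k w - g i" for i
    using arg_cong[OF append_take_drop_id[of i w], of "height k"] unfolding g_def height_simps by simp
  have "height k w - g p \<ge> int n + 1"
  proof -
    have "w2 = drop (length w1) w" using assms(2) by simp
    then have "height k w - g (length w1) \<ge> int n + 1" using assms(3) tot by metis
    moreover have "g p \<le> g (length w1)" using \<open>p \<in> S\<close> assms(2) by (auto simp: S_def)
    ultimately show ?thesis by simp
  qed
  then have "p \<noteq> length w" by (auto simp: g_def)
  then have p: "p < length w" using \<open>p \<in> S\<close> by (simp add: S_def)
  define u x v where "u = take p w" and "x = w ! p" and "v = drop (Suc p) w"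
  have w: "w = u @ x # v" unfolding u_def x_def v_def using p by (simp add: id_take_nth_drop)
  have x: "x \<in> letters m" using assms(1) w by auto
  have "g (Suc p) = g p + eps k x" using p by (simp add: g_def x_def take_Suc_conv_app_nth)
  then have ex: "eps k x = 1" using after[of "Suc p"] p eps_cases[OF x, of k] by auto
  have lu: "length u = p" using p by (simp add: u_def)
  have "pivot k u v" unfolding pivot_def
  proof (intro conjI allI impI)
    fix u1 u2 assume "u = u1 @ u2"
    then have "g (length u1) = height k u1" "g p = height k u1 + height k u2" "length u1 \<le> length w"
      using w lu by (auto simp: g_def)
    moreover have "g p \<le> g (length u1)" using \<open>p \<in> S\<close> \<open>length u1 \<le> length w\<close> by (auto simp: S_def)
    ultimately show "height k u2 \<le> 0" by simp
  next
    fix v1 v2 assume "v = v1 @ v2"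
    then have eq: "w = (u @ x # v1) @ v2" using w by simp
    have "g (length (u @ x # v1)) = height k (u @ x # v1)" unfolding g_def by (subst eq) simp
    moreover have "g p = height k u" using lu w by (simp add: g_def)
    moreover have "g p < g (length (u @ x # v1))" using lu eq
      by (intro after) (auto simp: w \<open>v = v1 @ v2\<close>)
    ultimately show "0 \<le> height k v1" using ex by simp
  qed
  moreover have "height k v \<ge> int n"
    using \<open>height k w - g p \<ge> int n + 1\<close> ex lu w by (simp add: g_def)
  ultimately have "flips m k 1 w (u @ flip m k x # v)" "int n \<le> height k v"
    using w ex unfolding flips_def by blast+
  moreover have "u @ flip m k x # v = (u @ [flip m k x]) @ v" by simp
  ultimately show ?thesis by metis
qed

definition bar :: "letter \<Rightarrow> letter" where
  "bar x = (case x of Pos i \<Rightarrow> Bar i | Bar i \<Rightarrow> Pos i)"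

text \<open>Reversing a word and barring its letters exchanges the two halves of the pivot condition and the two signs, so every fact
  on pivots of sign \<open>1\<close> gives one on pivots of sign \<open>-1\<close>.\<close>

definition dual :: "letter list \<Rightarrow> letter list" where
  "dual w = rev (map bar w)"

lemma bar_bar [simp]: "bar (bar x) = x"
  by (cases x) (auto simp: bar_def)

lemma eps_bar [simp]: "eps k (bar x) = - eps k x"
  by (cases x) (auto simp: bar_def eps_def letter_wt_def)

lemma flip_bar: "flip m k (bar x) = bar (flip m k x)"
  by (cases x) (auto simp: bar_def flip_def)

lemma dual_simps: "dual (dual w) = w" "dual (u @ v) = dual v @ dual u" "dual (x # w) = dual w @ [bar x]"
  "height k (dual w) = - height k w"
  by (induction w) (auto simp: dual_def rev_map o_def)

lemma dual_letters: "set w \<subseteq> letters m \<Longrightarrow> set (dual w) \<subseteq> letters m"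
  by (force simp: dual_def bar_def letters_def)

lemma pivot_dual:
  assumes "pivot k u v"
  shows "pivot k (dual v) (dual u)"
  unfolding pivot_def
proof (intro conjI allI impI)
  fix a b assume "dual v = a @ b"
  then have "v = dual b @ dual a" by (metis dual_simps(1,2))
  then show "height k b \<le> 0" using pivotD2[of k u "dual b" "dual a"] assms by (simp add: dual_simps)
next
  fix a b assume "dual u = a @ b"
  then have "u = dual b @ dual a" by (metis dual_simps(1,2))
  then show "0 \<le> height k a" using pivotD1[of k "dual b" "dual a"] assms by (simp add: dual_simps)
qed

lemma flips_dual:
  assumes "flips m k e w w'"
  shows "flips m k (- e) (dual w) (dual w')"
proof -
  obtain u x v where "w = u @ x # v" "w' = u @ flip m k x # v" "pivot k u v" "eps k x = e"
    using assms by (auto simp: flips_def)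
  then show ?thesis unfolding flips_def
    by (intro exI[of _ "dual v"] exI[of _ "bar x"] exI[of _ "dual u"])
      (simp add: dual_simps flip_bar pivot_dual)
qed

lemma minus_pivot_exists:
  assumes "set w \<subseteq> letters m" "w = w1 @ w2" "height k w1 \<le> - int n - 1"
  shows "\<exists>w'. flips m k (-1) w w' \<and> (\<exists>w1' w2'. w' = w1' @ w2' \<and> height k w1' \<le> - int n)"
proof -
  have "\<exists>w'. flips m k 1 (dual w) w' \<and> (\<exists>w1' w2'. w' = w1' @ w2' \<and> height k w2' \<ge> int n)"
    using assms by (intro plus_pivot_exists[of _ _ "dual w2" "dual w1"]) (auto simp: dual_simps dual_letters)
  then obtain w1' w2' where "flips m k 1 (dual w) (w1' @ w2')" "height k w2' \<ge> int n" by blast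
  then have "flips m k (-1) w (dual w2' @ dual w1')" "height k (dual w2') \<le> - int n"
    using flips_dual[of m k 1 "dual w" "w1' @ w2'"] by (auto simp: dual_simps)
  then show ?thesis by blast
qed

lemma flips_wt:
  assumes "flips m k e w w'" "k < m" "set w \<subseteq> letters m"
  shows "wt w' j = wt w j - e * simple_root m k j"
  using assms by (auto simp: flips_def letter_wt_flip)

lemma flips_closed: "flips m k e w w' \<Longrightarrow> flip_closed m k X \<Longrightarrow> w \<in> X \<Longrightarrow> e \<noteq> 0 \<Longrightarrow> w' \<in> X"
  by (auto simp: flips_def flip_closed_def)

definition steppable :: "nat \<Rightarrow> int \<Rightarrow> nat \<Rightarrow> letter list \<Rightarrow> bool" where
  "steppable k e n w \<longleftrightarrow>
     (\<exists>w1 w2. w = w1 @ w2 \<and> (if e = 1 then height k w2 \<ge> int n else height k w1 \<le> - int n))"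

lemma steppable_Suc:
  assumes "set w \<subseteq> letters m" "steppable k e (Suc n) w" "e = 1 \<or> e = -1"
  shows "flips m k e w (step m k e w)" "steppable k e n (step m k e w)"
proof -
  have "\<exists>w'. flips m k e w w' \<and> steppable k e n w'"
  proof (cases "e = 1")
    case True
    then show ?thesis using assms plus_pivot_exists[of w m _ _ n k] unfolding steppable_def by fastforce
  next
    case False
    then show ?thesis using assms minus_pivot_exists[of w m _ _ k n] unfolding steppable_def by fastforce
  qed
  then show "flips m k e w (step m k e w)" "steppable k e n (step m k e w)"
    using step_eq assms(3) by force+
qed

lemma step_iter:
  assumes "k < m" "flip_closed m k X" "\<forall>w\<in>X. set w \<subseteq> letters m" "e = 1 \<or> e = -1"
    "w \<in> X" "steppable k e n w"
  shows "(step m k e ^^ n) w \<in> X \<and> (step m k (- e) ^^ n) ((step m k e ^^ n) w) = w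
    \<and> (\<forall>j. wt ((step m k e ^^ n) w) j = wt w j - int n * e * simple_root m k j)"
  using assms(5,6)
proof (induction n arbitrary: w)
  case (Suc n)
  let ?w' = "step m k e w"
  have sub: "set w \<subseteq> letters m" using Suc.prems assms(3) by blast
  have f: "flips m k e w ?w'" and st: "steppable k e n ?w'"
    using steppable_Suc[OF sub Suc.prems(2) assms(4)] by auto
  have "?w' \<in> X" using flips_closed[OF f assms(2) Suc.prems(1)] assms(4) by auto
  note IH = Suc.IH[OF this st]
  have bk: "step m k (- e) ?w' = w"
    using step_eq[OF flips_sym[OF f assms(1) sub]] assms(4) by auto
  have s: "(step m k e ^^ Suc n) w = (step m k e ^^ n) ?w'"
    by (simp add: funpow_Suc_right del: funpow.simps)
  have "(step m k (- e) ^^ Suc n) ((step m k e ^^ n) ?w') = w"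
    using IH bk by simp
  then show ?case
    unfolding s using IH flips_wt[OF f assms(1) sub] by (simp add: algebra_simps)
qed simp

text \<open>The height of a word is the difference of the number of steps possible in the two directions, so that many steps lead to
  its mirror image in its string.\<close>

definition string_refl :: "nat \<Rightarrow> nat \<Rightarrow> letter list \<Rightarrow> letter list" where
  "string_refl m k w =
     (if height k w \<ge> 0 then (step m k 1 ^^ nat (height k w)) w
      else (step m k (-1) ^^ nat (- height k w)) w)"

lemma reflect_wt: "k < m \<Longrightarrow> set w \<subseteq> letters m \<Longrightarrow> reflect m k (wt w) j = wt w j - height k w * simple_root m k j"
  using reflect_eq_minus_root[of k m "wt w" j] wt_outside[of w m]
  by (cases "Suc k < m") (auto simp: height_eq_wt dest: Suc_lessI)

lemma simple_root_pair: "k < m \<Longrightarrow> simple_root m k k - simple_root m k (Suc k) = 2"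
  by (auto simp: simple_root_def)

lemma string_refl:
  assumes "k < m" "flip_closed m k X" "\<forall>w\<in>X. set w \<subseteq> letters m" "w \<in> X"
  shows "string_refl m k w \<in> X" "string_refl m k (string_refl m k w) = w"
    "wt (string_refl m k w) = reflect m k (wt w)"
proof -
  have sub: "set w \<subseteq> letters m" using assms by blast
  define e where "e = (if height k w \<ge> 0 then 1 else -1 :: int)"
  define n where "n = nat \<bar>height k w\<bar>"
  have e: "e = 1 \<or> e = -1" by (simp add: e_def)
  have ne: "int n * e = height k w" by (simp add: n_def e_def)
  have r: "string_refl m k w = (step m k e ^^ n) w" by (simp add: string_refl_def e_def n_def)
  have "steppable k e n w" unfolding steppable_def e_def n_def
    by (cases "height k w \<ge> 0") (force intro: exI[of _ "[]"])+
  note it = step_iter[OF assms(1-3) e assms(4) this, folded r]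
  show "string_refl m k w \<in> X" using it by blast
  show wt: "wt (string_refl m k w) = reflect m k (wt w)"
    using it ne by (intro ext) (simp add: reflect_wt[OF assms(1) sub])
  have "height k (string_refl m k w) = height k w - height k w * (simple_root m k k - simple_root m k (Suc k))"
    using it ne by (simp add: height_eq_wt right_diff_distrib)
  then have "height k (string_refl m k w) = - height k w"
    using simple_root_pair[OF assms(1)] by simp
  then have "string_refl m k (string_refl m k w) = (if n = 0 then string_refl m k w
      else (step m k (- e) ^^ n) (string_refl m k w))"
    by (auto simp: string_refl_def[of m k "string_refl m k w"] e_def n_def)
  then show "string_refl m k (string_refl m k w) = w" using it r by auto
qed

text \<open>A multiset, so that invariance under the Weyl group can be stated without reference to what is summed over the weights.\<close>

definition weights :: "letter list set \<Rightarrow> (nat \<Rightarrow> int) multiset" where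
  "weights X = image_mset wt (mset_set X)"

lemma sum_weights: "(\<Sum>w\<in>X. g (wt w)) = (\<Sum>\<mu>\<in>#weights X. g \<mu>)"
  by (simp add: weights_def sum_unfold_sum_mset image_mset.compositionality o_def)

lemma weights_reflect:
  assumes "k < m" "flip_closed m k X" "\<forall>w\<in>X. set w \<subseteq> letters m"
  shows "image_mset (reflect m k) (weights X) = weights X"
proof -
  have inj: "inj_on (string_refl m k) X"
    by (rule inj_on_inverseI[of _ "string_refl m k"]) (rule string_refl(2)[OF assms])
  have img: "string_refl m k ` X = X"
    using string_refl(1,2)[OF assms] by (force simp: image_iff)
  have "image_mset (reflect m k) (weights X) = image_mset wt (image_mset (string_refl m k) (mset_set X))"
  proof (cases "finite X")
    case True
    then show ?thesis
      unfolding weights_def image_mset.compositionality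
      by (intro image_mset_cong) (simp add: string_refl(3)[OF assms])
  qed (simp add: weights_def)
  then show ?thesis by (simp add: image_mset_mset_set[OF inj] img weights_def)
qed

section \<open>Cancellation of the words that leave the dominant chamber\<close>

definition highest :: "nat \<Rightarrow> letter list \<Rightarrow> bool" where
  "highest m w \<longleftrightarrow> (\<forall>u v. w = u @ v \<longrightarrow> (\<forall>k<m. 0 \<le> height k u))"

definition rho :: "nat \<Rightarrow> nat \<Rightarrow> int" where
  "rho m j = int m - int j"

definition first_exit :: "nat \<Rightarrow> letter list \<Rightarrow> bool" where
  "first_exit m u \<longleftrightarrow> (\<exists>k<m. height k u < 0) \<and> (\<forall>u1 u2. u = u1 @ u2 \<longrightarrow> u2 \<noteq> [] \<longrightarrow> (\<forall>k<m. 0 \<le> height k u1))"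

lemma first_exit_exists:
  assumes "\<not> highest m w"
  shows "\<exists>u v. w = u @ v \<and> first_exit m u"
proof -
  let ?P = "\<lambda>j. j \<le> length w \<and> (\<exists>k<m. height k (take j w) < 0)"
  define j where "j = (LEAST j. ?P j)"
  from assms obtain u v k where "w = u @ v" "k < m" "height k u < 0"
    by (auto simp: highest_def not_le)
  then have "?P (length u)" by auto
  then have j: "?P j" unfolding j_def by (rule LeastI)
  have "first_exit m (take j w)" unfolding first_exit_def
  proof (intro conjI allI impI)
    show "\<exists>k<m. height k (take j w) < 0" using j by blast
    fix u1 u2 k assume u: "take j w = u1 @ u2" "u2 \<noteq> []" "k < m"
    have "j = length u1 + length u2" using j arg_cong[OF u(1), of length] by simp
    then have "length u1 < j" using u(2) by simp
    then have "\<not> ?P (length u1)" unfolding j_def by (rule not_less_Least)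
    moreover have "take (length u1) w = u1"
      using u \<open>length u1 < j\<close> by (metis append_eq_conv_conj less_imp_le min.absorb1 take_take)
    ultimately have "\<not> (\<exists>k<m. height k u1 < 0)"
      using \<open>length u1 < j\<close> j by (metis less_imp_le order_trans)
    then show "0 \<le> height k u1" using u(3) by (meson not_le)
  qed
  then show ?thesis by (metis append_take_drop_id)
qed

lemma first_exit_unique:
  assumes "u @ v = u' @ v'" "first_exit m u" "first_exit m u'"
  shows "u = u' \<and> v = v'"
proof -
  have False if "u' = u @ s" "s \<noteq> []" "first_exit m u" "first_exit m u'" for u u' s
  proof -
    have "\<exists>k<m. height k u < 0" using that(3) unfolding first_exit_def by blast
    moreover have "\<forall>k<m. 0 \<le> height k u" using that(1,2,4) unfolding first_exit_def by blast
    ultimately show False by force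
  qed
  note no = this
  obtain s where "u = u' @ s \<or> u' = u @ s"
    using assms(1) by (auto simp: append_eq_append_conv2)
  moreover have "s = []" using calculation no[of u' u s] no[of u u' s] assms(2,3) by blast
  ultimately show ?thesis using assms(1) by auto
qed

text \<open>A letter changes a height by at most one, so the wall is reached and not crossed.\<close>

lemma first_exit_height:
  assumes "first_exit m u" "set u \<subseteq> letters m"
  obtains k where "k < m" "height k u = -1"
proof -
  obtain k where k: "k < m" "height k u < 0" using assms by (auto simp: first_exit_def)
  then have "u \<noteq> []" by auto
  then obtain u' x where u: "u = u' @ [x]" by (metis rev_exhaust)
  then have "0 \<le> height k u'" using assms(1) k unfolding first_exit_def by blast
  moreover have "eps k x \<ge> -1" using assms(2) u eps_cases[of x m k] by auto
  ultimately show ?thesis using k u that[of k] by auto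
qed

text \<open>A pivot of the suffix is a pivot of the whole word: the prefix ends at its strict minimum \<open>-1\<close>, so every stretch of
  letters ending with it has nonpositive height.\<close>

lemma flip_closed_after_exit:
  assumes "first_exit m u" "height k u = -1" "k < m" "flip_closed m k L"
  shows "flip_closed m k {v. u @ v \<in> L}"
  unfolding flip_closed_def
proof (intro allI impI, unfold mem_Collect_eq)
  fix a x b assume *: "u @ a @ x # b \<in> L" "pivot k a b" "eps k x \<noteq> 0"
  have "height k d \<le> 0" if eq: "u @ a = c @ d" for c d
  proof -
    consider s where "u = c @ s" "d = s @ a" | s where "c = u @ s" "a = s @ d"
      using eq by (auto simp: append_eq_append_conv2)
    then show ?thesis
    proof cases
      case 1
      have "height k a \<le> 0" using pivotD1[of k "[]" a b] * by simp
      moreover have "height k s \<le> 0"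
      proof (cases "s = []")
        case False
        then have "0 \<le> height k c" using assms(1,3) 1 unfolding first_exit_def by blast
        then show ?thesis using assms(2) 1 by auto
      qed simp
      ultimately show ?thesis using 1 by simp
    next
      case 2
      then show ?thesis using pivotD1[of k s d b] * by simp
    qed
  qed
  then have "pivot k (u @ a) b" using *(2) by (simp add: pivot_def)
  then show "u @ a @ flip m k x # b \<in> L"
    using assms(4) * unfolding flip_closed_def by (metis append.assoc)
qed

text \<open>The prefix brings \<open>\<rho>\<close> to the wall, so reflecting the weight of the suffix reflects the argument of \<open>A\<close>.\<close>

lemma sum_after_exit:
  fixes A :: "(nat \<Rightarrow> int) \<Rightarrow> 'a :: field_char_0"
  assumes "first_exit m u" "\<forall>w\<in>L. set w \<subseteq> letters m" "\<forall>k<m. flip_closed m k L"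
    and A: "\<forall>k<m. \<forall>\<mu>. A (reflect m k \<mu>) = - A \<mu>"
  shows "(\<Sum>v | u @ v \<in> L. A (\<lambda>j. rho m j + wt (u @ v) j)) = 0"
proof (cases "{v. u @ v \<in> L} = {}")
  case False
  then have sub: "set u \<subseteq> letters m" using assms(2) by force
  obtain k where k: "k < m" "height k u = -1" using first_exit_height[OF assms(1) sub] .
  define \<nu> where "\<nu> j = rho m j + wt u j" for j
  have "\<nu> k = \<nu> (Suc k)" using k by (simp add: \<nu>_def height_eq_wt rho_def)
  moreover have "\<nu> m = 0" using wt_outside[OF sub] by (simp add: \<nu>_def rho_def)
  ultimately have fixed: "reflect m k (\<lambda>j. \<nu> j + \<mu> j) = (\<lambda>j. \<nu> j + reflect m k \<mu> j)" for \<mu>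
    using k(1) by (cases "Suc k = m") (auto simp: reflect_def transpose_def)
  have sub': "\<forall>v\<in>{v. u @ v \<in> L}. set v \<subseteq> letters m" using assms(2) by force
  let ?S = "\<Sum>v | u @ v \<in> L. A (\<lambda>j. \<nu> j + wt v j)"
  have "?S = (\<Sum>v | u @ v \<in> L. A (\<lambda>j. \<nu> j + reflect m k (wt v) j))"
  proof -
    let ?X = "{v. u @ v \<in> L}" and ?g = "\<lambda>\<mu>. A (\<lambda>j. \<nu> j + \<mu> j)"
    have "image_mset (reflect m k) (weights ?X) = weights ?X"
      using assms(3) k flip_closed_after_exit[OF assms(1) k(2,1)] by (intro weights_reflect sub') auto
    then have "(\<Sum>v\<in>?X. ?g (wt v)) = (\<Sum>\<mu>\<in>#image_mset (reflect m k) (weights ?X). ?g \<mu>)"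
      using sum_weights[of ?g ?X] by simp
    also have "\<dots> = (\<Sum>\<mu>\<in>#weights ?X. ?g (reflect m k \<mu>))"
      by (simp add: image_mset.compositionality o_def)
    also have "\<dots> = (\<Sum>v\<in>?X. ?g (reflect m k (wt v)))"
      by (rule sum_weights[of "\<lambda>\<mu>. ?g (reflect m k \<mu>)", symmetric])
    finally show ?thesis .
  qed
  also have "\<dots> = - ?S"
    using A k by (simp add: fixed[symmetric] sum_negf)
  finally have "?S = 0" by (simp add: eq_neg_iff_add_eq_0 flip: mult_2)
  then show ?thesis by (simp add: \<nu>_def add.assoc)
qed simp

text \<open>Words are grouped by their shortest prefix of negative height; each group sums to zero.\<close>

theorem sum_over_highest:
  fixes A :: "(nat \<Rightarrow> int) \<Rightarrow> 'a :: field_char_0"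
  assumes "finite L" "\<forall>w\<in>L. set w \<subseteq> letters m" "\<forall>k<m. flip_closed m k L"
    and A: "\<forall>k<m. \<forall>\<mu>. A (reflect m k \<mu>) = - A \<mu>"
  shows "(\<Sum>w\<in>L. A (\<lambda>j. rho m j + wt w j)) = (\<Sum>w | w \<in> L \<and> highest m w. A (\<lambda>j. rho m j + wt w j))"
proof -
  let ?f = "\<lambda>w. A (\<lambda>j. rho m j + wt w j)"
  define U where "U = {u. first_exit m u \<and> (\<exists>v. u @ v \<in> L)}"
  have "U \<subseteq> (\<Union>w\<in>L. (\<lambda>n. take n w) ` {..length w})"
  proof
    fix u assume "u \<in> U"
    then obtain v where "u @ v \<in> L" by (auto simp: U_def)
    then show "u \<in> (\<Union>w\<in>L. (\<lambda>n. take n w) ` {..length w})"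
      by (intro UN_I[of "u @ v"] image_eqI[of _ _ "length u"]) auto
  qed
  then have "finite U" using assms(1) by (auto intro: finite_subset)
  have fin: "finite {v. u @ v \<in> L}" for u
    using finite_vimageI[OF assms(1), of "(@) u"] by (auto simp: vimage_def inj_on_def)
  have "{w \<in> L. \<not> highest m w} = (\<Union>u\<in>U. (@) u ` {v. u @ v \<in> L})"
  proof (intro equalityI subsetI)
    fix w assume "w \<in> {w \<in> L. \<not> highest m w}"
    then have "w \<in> L" "\<not> highest m w" by auto
    then obtain u v where "w = u @ v" "first_exit m u" using first_exit_exists by blast
    then have "u \<in> U" "v \<in> {v. u @ v \<in> L}" using \<open>w \<in> L\<close> unfolding U_def by blast+
    then show "w \<in> (\<Union>u\<in>U. (@) u ` {v. u @ v \<in> L})"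
      using \<open>w = u @ v\<close> by (intro UN_I[of u] image_eqI[of _ _ v])
  next
    fix w assume "w \<in> (\<Union>u\<in>U. (@) u ` {v. u @ v \<in> L})"
    then show "w \<in> {w \<in> L. \<not> highest m w}"
      unfolding U_def first_exit_def highest_def using not_le by blast
  qed
  then have "sum ?f {w \<in> L. \<not> highest m w} = (\<Sum>u\<in>U. sum ?f ((@) u ` {v. u @ v \<in> L}))"
    using \<open>finite U\<close> fin
    by (simp only:) (rule sum.UNION_disjoint, auto simp: U_def dest: first_exit_unique)
  also have "\<dots> = (\<Sum>u\<in>U. \<Sum>v | u @ v \<in> L. ?f (u @ v))"
    by (rule sum.cong[OF HOL.refl], subst sum.reindex) (auto simp: inj_on_def o_def)
  also have "\<dots> = 0"
    using sum_after_exit[OF _ assms(2,3) A] by (intro sum.neutral) (simp add: U_def del: wt_simps)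
  finally have "sum ?f {w \<in> L. \<not> highest m w} = 0" .
  moreover have "sum ?f L = sum ?f {w \<in> L. highest m w} + sum ?f {w \<in> L. \<not> highest m w}"
    using assms(1) by (subst sum.union_disjoint[symmetric]) (auto intro: sum.cong)
  ultimately show ?thesis by simp
qed

section \<open>Alternants\<close>

text \<open>The polynomial in \<open>y\<^sup>2 + y\<^bsup>-2\<^esup>\<close> that equals \<open>(y\<^bsup>2n+1\<^esup> - y\<^bsup>-(2n+1)\<^esup>) / (y - y\<^bsup>-1\<^esup>)\<close>.\<close>

fun odd_quotient :: "nat \<Rightarrow> 'a :: comm_ring_1 poly" where
  "odd_quotient 0 = 1"
| "odd_quotient (Suc 0) = [:1, 1:]"
| "odd_quotient (Suc (Suc n)) = [:0, 1:] * odd_quotient (Suc n) - odd_quotient n"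

lemma odd_quotient_monic:
  "degree (odd_quotient n :: 'a :: idom poly) \<le> n \<and> coeff (odd_quotient n :: 'a poly) n = 1"
proof (induction n rule: odd_quotient.induct)
  case (3 n)
  have "degree ([:0, 1:] * odd_quotient (Suc n) :: 'a poly) \<le> Suc (Suc n)"
    using 3 by (intro order.trans[OF degree_mult_le]) auto
  moreover have "degree (odd_quotient n :: 'a poly) \<le> Suc (Suc n)" using 3 by auto
  moreover have "coeff (odd_quotient n :: 'a poly) (Suc (Suc n)) = 0" using 3 by (intro coeff_eq_0) auto
  ultimately show ?case using 3 by (auto intro!: degree_diff_le)
qed auto

lemma three_term_step:
  fixes x y a b :: "'a :: comm_ring_1"
  assumes "x * y = 1"
  shows "(x * x + y * y) * (x * x * a - y * y * b) - (a - b) = x * x * (x * x * a) - y * y * (y * y * b)"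
proof -
  have "(x * x + y * y) * (x * x * a - y * y * b)
      = x * x * (x * x * a) - y * y * (y * y * b) + (x * y) * (x * y) * (a - b)"
    by (simp add: algebra_simps)
  then show ?thesis by (simp add: assms)
qed

lemma poly_odd_quotient:
  fixes y :: "'a :: field"
  assumes "y \<noteq> 0"
  shows "(y - inverse y) * poly (odd_quotient i) (y ^ 2 + inverse y ^ 2) = y ^ (2 * i + 1) - inverse y ^ (2 * i + 1)"
proof (induction i rule: odd_quotient.induct)
  case 2
  show ?case using three_term_step[of y "inverse y" y "inverse y"] assms
    by (simp add: numeral_3_eq_3 power2_eq_square algebra_simps)
next
  case (3 n)
  have "(y - inverse y) * poly (odd_quotient (Suc (Suc n))) (y ^ 2 + inverse y ^ 2)
      = (y ^ 2 + inverse y ^ 2) * ((y - inverse y) * poly (odd_quotient (Suc n)) (y ^ 2 + inverse y ^ 2))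
        - (y - inverse y) * poly (odd_quotient n) (y ^ 2 + inverse y ^ 2)"
    by (simp add: algebra_simps)
  also have "\<dots> = (y ^ 2 + inverse y ^ 2) * (y ^ (2 * n + 3) - inverse y ^ (2 * n + 3))
      - (y ^ (2 * n + 1) - inverse y ^ (2 * n + 1))"
    by (simp only: 3) (simp add: numeral_3_eq_3)
  also have "\<dots> = y ^ (2 * n + 5) - inverse y ^ (2 * n + 5)"
  proof -
    have split: "a ^ (2 * n + 3) = a * a * a ^ (2 * n + 1)" "a ^ (2 * n + 5) = a * a * (a * a * a ^ (2 * n + 1))"
      for a :: 'a
      by (simp_all add: eval_nat_numeral)
    show ?thesis unfolding split power2_eq_square using assms by (intro three_term_step) auto
  qed
  finally show ?case by (simp add: eval_nat_numeral)
qed simp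

text \<open>The Vandermonde determinant for monic polynomials in place of powers. As a function of the last node it is a polynomial of
  degree \<open>n\<close> that vanishes at the other nodes and whose leading coefficient is the smaller determinant.\<close>

lemma det_monic_polys:
  fixes z :: "nat \<Rightarrow> 'a :: field" and p :: "nat \<Rightarrow> 'a poly"
  assumes p: "\<And>i. degree (p i) \<le> i" "\<And>i. coeff (p i) i = 1"
  shows "det (mat n n (\<lambda>(i, j). poly (p i) (z j))) = (\<Prod>j<n. \<Prod>i<j. z j - z i)"
proof (induction n)
  case (Suc n)
  define B where "B z n = mat n n (\<lambda>(i, j). poly (p i) (z j))" for z :: "nat \<Rightarrow> 'a" and n
  show ?case
  proof (cases "inj_on z {..n}")
    case False
    then obtain i j where "i \<le> n" "j \<le> n" "i \<noteq> j" "z i = z j"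
      by (auto simp: inj_on_def)
    then have "\<exists>i j. i \<le> n \<and> j < i \<and> z i = z j"
      by (cases "j < i") (auto intro: exI[of _ i] exI[of _ j], metis linorder_neqE_nat)
    then obtain i j where ij: "i \<le> n" "j < i" "z i = z j" by blast
    have "det (B z (Suc n)) = 0"
      by (rule det_identical_columns[of _ "Suc n" i j])
        (use ij in \<open>auto simp: B_def col_def\<close>)
    moreover have "(\<Prod>j<Suc n. \<Prod>i<j. z j - z i) = 0"
    proof (rule prod_zero)
      have "(\<Prod>l<i. z i - z l) = 0" using ij by (intro prod_zero bexI[of _ j]) auto
      then show "\<exists>j\<in>{..<Suc n}. (\<Prod>i<j. z j - z i) = 0" using ij by (intro bexI[of _ i]) auto
    qed simp
    ultimately show ?thesis by (simp add: B_def)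
  next
    case True
    \<comment> \<open>the determinant as a polynomial in the last node\<close>
    define Q where "Q = (\<Sum>i<Suc n. Polynomial.smult (cofactor (B z (Suc n)) i n) (p i))"
    define R where "R = Polynomial.smult (det (B z n)) (\<Prod>i<n. [:- z i, 1:])"
    have Q: "poly Q w = det (B (z(n := w)) (Suc n))" for w
    proof -
      have cof: "cofactor (B (z(n := w)) (Suc n)) i n = cofactor (B z (Suc n)) i n" for i
      proof -
        have "mat_delete (B (z(n := w)) (Suc n)) i n = mat_delete (B z (Suc n)) i n"
          by (rule eq_matI) (auto simp: mat_delete_def B_def)
        then show ?thesis by (simp add: Determinant.cofactor_def)
      qed
      have "det (B (z(n := w)) (Suc n)) = (\<Sum>i<Suc n. B (z(n := w)) (Suc n) $$ (i, n) * cofactor (B (z(n := w)) (Suc n)) i n)"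
        by (rule laplace_expansion_column) (auto simp: B_def)
      also have "\<dots> = poly Q w"
        unfolding Q_def poly_sum by (intro sum.cong) (auto simp: cof, simp add: B_def)
      finally show ?thesis by simp
    qed
    have coQ: "coeff Q n = det (B z n)"
    proof -
      have "coeff Q n = (\<Sum>i<Suc n. cofactor (B z (Suc n)) i n * coeff (p i) n)"
        by (simp add: Q_def coeff_sum)
      also have "\<dots> = cofactor (B z (Suc n)) n n"
        by (simp add: p(2) coeff_eq_0 order.strict_trans1[OF p(1)])
      also have "mat_delete (B z (Suc n)) n n = B z n"
        by (rule eq_matI) (auto simp: mat_delete_def B_def)
      then have "cofactor (B z (Suc n)) n n = det (B z n)"
        by (simp add: Determinant.cofactor_def)
      finally show ?thesis .
    qed
    have degP: "degree (\<Prod>i<n. [:- z i, 1:]) = n" 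
      by (subst degree_prod_eq_sum_degree) auto
    have leadP: "coeff (\<Prod>i<n. [:- z i, 1:]) n = 1" 
      using lead_coeff_prod[of "\<lambda>i. [:- z i, 1:]" "{..<n}"] degP by simp
    have "degree Q \<le> n" unfolding Q_def
    proof (rule degree_sum_le)
      show "degree (Polynomial.smult c (p i)) \<le> n" if "i \<in> {..<Suc n}" for c i
        using degree_smult_le[of c "p i"] p(1)[of i] that by simp
    qed simp
    moreover have "degree R \<le> n" unfolding R_def using degP degree_smult_le order_trans by metis
    ultimately have "degree (Q - R) \<le> n" by (rule degree_diff_le)
    moreover have "coeff (Q - R) n = 0" using coQ leadP by (simp add: R_def)
    ultimately have small: "Q - R = 0 \<or> degree (Q - R) < n"
      using leading_coeff_0_iff[of "Q - R"] by (cases "degree (Q - R) = n") auto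
    have roots: "poly (Q - R) (z i) = 0" if "i < n" for i
    proof -
      have "det (B (z(n := z i)) (Suc n)) = 0"
        by (rule det_identical_columns[of _ "Suc n" i n])
          (use that in \<open>auto simp: B_def col_def\<close>)
      moreover have "poly R (z i) = 0" using that by (auto simp: R_def poly_prod)
      ultimately show ?thesis by (simp add: Q)
    qed
    have "Q - R = 0"
    proof (rule ccontr)
      assume nz: "Q - R \<noteq> 0"
      have "z ` {..<n} \<subseteq> {w. poly (Q - R) w = 0}" using roots by auto
      then have "card (z ` {..<n}) \<le> degree (Q - R)"
        by (rule order_trans[OF card_mono[OF poly_roots_finite[OF nz]] card_poly_roots_bound[OF nz]])
      moreover have "inj_on z {..<n}" by (rule inj_on_subset[OF True]) auto
      then have "card (z ` {..<n}) = n" by (simp add: card_image)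
      ultimately show False using small nz by simp
    qed
    then have "det (B z (Suc n)) = poly R (z n)" using Q[of "z n"] by simp
    also have "\<dots> = det (B z n) * (\<Prod>i<n. z n - z i)" by (simp add: R_def poly_prod)
    finally show ?thesis using Suc.IH by (simp add: B_def)
  qed
qed simp

text \<open>The alternating sum over the hyperoctahedral group of \<open>x\<^bsup>w \<mu>\<^esup>\<close>, evaluated where the variables are the odd powers
  \<open>t, t\<^sup>3, \<dots>, t\<^bsup>2m-1\<^esup>\<close>.\<close>

definition alternant :: "'a :: field \<Rightarrow> nat \<Rightarrow> (nat \<Rightarrow> int) \<Rightarrow> 'a" where
  "alternant t m \<mu> =
     det (mat m m (\<lambda>(i, j). t powi (int (2 * i + 1) * \<mu> j) - t powi (- (int (2 * i + 1) * \<mu> j))))"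

lemma power_int_odd_power:
  fixes t :: "'a :: field"
  shows "t powi (int (2 * i + 1) * a) = (t powi a) ^ (2 * i + 1)"
    "t powi (- (int (2 * i + 1) * a)) = inverse (t powi a) ^ (2 * i + 1)"
  by (simp_all only: power_int_minus power_int_mult mult.commute[of "int (2 * i + 1)"] power_int_of_nat power_inverse)

lemma alternant_product:
  fixes t :: "'a :: field"
  assumes "t \<noteq> 0"
  shows "alternant t m \<mu> =
     (\<Prod>j<m. t powi \<mu> j - t powi (- \<mu> j)) *
     (\<Prod>j<m. \<Prod>i<j. (t powi (2 * \<mu> j) + t powi (- 2 * \<mu> j)) - (t powi (2 * \<mu> i) + t powi (- 2 * \<mu> i)))"
proof -
  let ?y = "\<lambda>j. t powi \<mu> j"
  let ?z = "\<lambda>j. ?y j ^ 2 + inverse (?y j) ^ 2"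
  let ?M = "mat m m (\<lambda>(i, j). poly (odd_quotient i) (?z j))"
  have nz: "?y j \<noteq> 0" for j using assms by simp
  have "alternant t m \<mu> = det (mat m m (\<lambda>(i, j). (?y j - inverse (?y j)) * poly (odd_quotient i) (?z j)))"
    unfolding alternant_def by (rule arg_cong[of _ _ det], rule eq_matI)
      (simp_all only: index_mat dim_row_mat dim_col_mat split power_int_odd_power poly_odd_quotient[OF nz])
  also have "\<dots> = (\<Prod>j<m. ?y j - inverse (?y j)) * det ?M"
  proof -
    have "(\<Prod>i = 0..<m. (?y (p i) - inverse (?y (p i))) * poly (odd_quotient i) (?z (p i)))
        = (\<Prod>j<m. ?y j - inverse (?y j)) * (\<Prod>i = 0..<m. poly (odd_quotient i) (?z (p i)))"
      if "p permutes {0..<m}" for p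
      using prod.permute[OF that, of "\<lambda>j. ?y j - inverse (?y j)"]
      by (simp add: prod.distrib o_def atLeast0LessThan)
    moreover have "p i < m" if "p permutes {0..<m}" "i < m" for p i
      using permutes_in_image[OF that(1), of i] that(2) by simp
    ultimately show ?thesis
      by (subst (1 2) det_def'[of _ m]) (auto simp: sum_distrib_left mult_ac intro!: sum.cong)
  qed
  also have "det ?M = (\<Prod>j<m. \<Prod>i<j. ?z j - ?z i)"
    by (rule det_monic_polys) (use odd_quotient_monic in blast)+
  finally show ?thesis
    by (simp add: power_int_minus power_int_mult mult.commute[of 2] power_inverse)
qed

lemma alternant_leibniz:
  fixes t :: "'a :: field"
  shows "alternant t m \<mu> = (\<Sum>p | p permutes {0..<m}. signof p *
    (\<Prod>i<m. t powi (int (2 * i + 1) * \<mu> (p i)) - t powi (- (int (2 * i + 1) * \<mu> (p i)))))"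
  unfolding alternant_def
  by (subst det_def') (auto intro!: sum.cong prod.cong simp: atLeast0LessThan)

lemma alternant_reflect:
  fixes t :: "'a :: field"
  assumes "t \<noteq> 0" "k < m"
  shows "alternant t m (reflect m k \<mu>) = - alternant t m \<mu>"
proof (cases "Suc k < m")
  case True
  let ?M = "mat m m (\<lambda>(i, j). t powi (int (2 * i + 1) * \<mu> j) - t powi (- (int (2 * i + 1) * \<mu> j)))"
  have "alternant t m (reflect m k \<mu>) = det (swapcols k (Suc k) ?M)"
    unfolding alternant_def
    by (rule arg_cong[of _ _ det], rule eq_matI)
      (use True in \<open>auto simp: mat_swapcols_def reflect_def transpose_def\<close>)
  also have "\<dots> = - det ?M" by (rule det_swapcols[of _ m]) (use True in auto)
  finally show ?thesis by (simp add: alternant_def)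
next
  case False
  then have k: "m = Suc k" using assms(2) by simp
  show ?thesis
    unfolding alternant_product[OF assms(1)] k
    by (simp add: reflect_def, simp add: algebra_simps cong: prod.cong)
qed

section \<open>The Weyl character formula for sets of words\<close>

definition sign_on :: "nat set \<Rightarrow> nat \<Rightarrow> int" where
  "sign_on X i = (if i \<in> X then 1 else - 1)"

text \<open>The sign changes of the hyperoctahedral group: \<open>X\<close> is the set of components whose sign is kept.\<close>

lemma prod_diff_signed_expansion:
  fixes t :: "'a :: field"
  shows "(\<Prod>i<m. t powi (c i * \<nu> i) - t powi (- (c i * \<nu> i)))
    = (\<Sum>X\<in>Pow {..<m}. (- 1) ^ card ({..<m} - X) * (\<Prod>i<m. t powi (c i * (sign_on X i * \<nu> i))))"
proof -
  let ?a = "\<lambda>i. t powi (c i * \<nu> i)" and ?b = "\<lambda>i. t powi (- (c i * \<nu> i))"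
  have "(\<Prod>i\<in>X. ?a i) * (\<Prod>i\<in>{..<m} - X. - ?b i)
      = (- 1) ^ card ({..<m} - X) * (\<Prod>i<m. t powi (c i * (sign_on X i * \<nu> i)))" if "X \<subseteq> {..<m}" for X
  proof -
    have "(\<Prod>i<m. t powi (c i * (sign_on X i * \<nu> i)))
        = (\<Prod>i\<in>{..<m} - X. t powi (c i * (sign_on X i * \<nu> i))) * (\<Prod>i\<in>X. t powi (c i * (sign_on X i * \<nu> i)))"
      using that by (intro prod.subset_diff) auto
    also have "\<dots> = (\<Prod>i\<in>{..<m} - X. ?b i) * (\<Prod>i\<in>X. ?a i)"
      by (intro arg_cong2[of _ _ _ _ "(*)"] prod.cong) (auto simp: sign_on_def)
    finally show ?thesis by (simp add: prod_uminus)
  qed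
  then show ?thesis
    using prod_add[of "{..<m}" ?a "\<lambda>i. - ?b i"] by simp
qed

text \<open>A transposition is a conjugate of a shorter one by an adjacent one.\<close>

lemma weights_transpose:
  assumes "finite L" "\<forall>w\<in>L. set w \<subseteq> letters m" "\<forall>k<m. flip_closed m k L" "a < b" "b < m"
  shows "image_mset (\<lambda>\<mu>. \<mu> \<circ> transpose a b) (weights L) = weights L"
  using assms(4,5)
proof (induction b)
  case (Suc b)
  have adj: "image_mset (\<lambda>\<mu>. \<mu> \<circ> transpose b (Suc b)) (weights L) = weights L"
    using weights_reflect[of b m L] Suc.prems assms by (simp add: reflect_def[abs_def])
  show ?case
  proof (cases "a = b")
    case False
    then have "a < b" "b < m" using Suc.prems by auto
    note IH = Suc.IH[OF this]
    have "\<mu> \<circ> transpose a (Suc b)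
        = ((\<mu> \<circ> transpose b (Suc b)) \<circ> transpose a b) \<circ> transpose b (Suc b)" for \<mu> :: "nat \<Rightarrow> int"
      using False \<open>a < b\<close> transpose_comp_triple[of "Suc b" a b]
      by (simp add: comp_assoc transpose_commute)
    then have "image_mset (\<lambda>\<mu>. \<mu> \<circ> transpose a (Suc b)) (weights L)
      = image_mset (\<lambda>\<mu>. \<mu> \<circ> transpose b (Suc b)) (image_mset (\<lambda>\<mu>. \<mu> \<circ> transpose a b)
          (image_mset (\<lambda>\<mu>. \<mu> \<circ> transpose b (Suc b)) (weights L)))"
      unfolding image_mset.compositionality by (intro image_mset_cong) simp
    then show ?thesis unfolding adj IH .
  next
    case True
    show ?thesis unfolding True by (rule adj)
  qed
qed simp

lemma weights_signed_permutation:
  assumes "finite L" "\<forall>w\<in>L. set w \<subseteq> letters m" "\<forall>k<m. flip_closed m k L"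
    and "p permutes {0..<m}" "Y \<subseteq> {..<m}"
  shows "image_mset (\<lambda>\<mu> i. (if i \<in> Y then - \<mu> (p i) else \<mu> (p i))) (weights L) = weights L"
proof -
  have transp: "image_mset (\<lambda>\<mu>. \<mu> \<circ> transpose a b) (weights L) = weights L" if "a < m" "b < m" "a \<noteq> b" for a b
    using weights_transpose[OF assms(1-3)] that by (metis linorder_neqE_nat transpose_commute)
  have perm: "image_mset (\<lambda>\<mu>. \<mu> \<circ> p) (weights L) = weights L"
    using assms(4) finite_atLeastLessThan
  proof (induction rule: permutes_induct)
    case (swap a b p)
    have tr: "image_mset (\<lambda>\<mu>. \<mu> \<circ> transpose a b) (weights L) = weights L"
      using swap by (intro transp) auto
    have "image_mset (\<lambda>\<mu>. \<mu> \<circ> (transpose a b \<circ> p)) (weights L)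
        = image_mset (\<lambda>\<mu>. \<mu> \<circ> p) (image_mset (\<lambda>\<mu>. \<mu> \<circ> transpose a b) (weights L))"
      unfolding image_mset.compositionality by (intro image_mset_cong) (simp add: comp_assoc)
    also have "\<dots> = weights L" unfolding tr by (rule swap)
    finally show ?case .
  qed simp
  have neg: "image_mset (\<lambda>\<mu>. \<mu>(a := - \<mu> a)) (weights L) = weights L" if "a < m" for a
  proof -
    have last: "image_mset (\<lambda>\<mu>. \<mu>(m - 1 := - \<mu> (m - 1))) (weights L) = weights L"
      using weights_reflect[of "m - 1" m L] that assms by (simp add: reflect_def[abs_def])
    show ?thesis
    proof (cases "a = m - 1")
      case False
      have "\<mu>(a := - \<mu> a) = ((\<mu> \<circ> transpose a (m - 1))(m - 1 := - (\<mu> \<circ> transpose a (m - 1)) (m - 1))) \<circ> transpose a (m - 1)"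
        for \<mu> :: "nat \<Rightarrow> int"
        by (auto simp: transpose_def)
      then have "image_mset (\<lambda>\<mu>. \<mu>(a := - \<mu> a)) (weights L)
        = image_mset (\<lambda>\<mu>. \<mu> \<circ> transpose a (m - 1)) (image_mset (\<lambda>\<mu>. \<mu>(m - 1 := - \<mu> (m - 1)))
            (image_mset (\<lambda>\<mu>. \<mu> \<circ> transpose a (m - 1)) (weights L)))"
        unfolding image_mset.compositionality by (intro image_mset_cong) simp
      moreover have "m - 1 < m" using that by simp
      ultimately show ?thesis by (simp only: last transp[OF that _ False])
    next
      case True
      show ?thesis unfolding True by (rule last)
    qed
  qed
  have "finite Y" using assms(5) finite_subset by blast
  then have "image_mset (\<lambda>\<mu> i. if i \<in> Y then - \<mu> i else \<mu> i) (weights L) = weights L"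
    using assms(5)
  proof (induction Y rule: finite_induct)
    case (insert a Y)
    have "(\<lambda>i. if i \<in> insert a Y then - \<mu> i else \<mu> i)
        = (\<lambda>\<mu> i. if i \<in> Y then - \<mu> i else \<mu> i) (\<mu>(a := - \<mu> a))" for \<mu> :: "nat \<Rightarrow> int"
      using insert.hyps by auto
    then have "image_mset (\<lambda>\<mu> i. if i \<in> insert a Y then - \<mu> i else \<mu> i) (weights L)
      = image_mset (\<lambda>\<mu> i. if i \<in> Y then - \<mu> i else \<mu> i) (image_mset (\<lambda>\<mu>. \<mu>(a := - \<mu> a)) (weights L))"
      unfolding image_mset.compositionality by (intro image_mset_cong) simp
    moreover have "a < m" "Y \<subseteq> {..<m}" using insert.prems by auto
    ultimately show ?case by (simp only: insert.IH neg)
  qed simp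
  moreover have "image_mset (\<lambda>\<mu> i. (if i \<in> Y then - \<mu> (p i) else \<mu> (p i))) (weights L)
    = image_mset (\<lambda>\<mu> i. if i \<in> Y then - \<mu> i else \<mu> i) (image_mset (\<lambda>\<mu>. \<mu> \<circ> p) (weights L))"
    unfolding image_mset.compositionality by (intro image_mset_cong) auto
  ultimately show ?thesis by (simp only: perm)
qed

text \<open>The alternant is expanded over signed permutations; as the weights are invariant, the second factor may be
  transformed by the signed permutation of each term, and then the exponents add.\<close>

lemma alternant_times_sum:
  fixes t :: "'a :: field"
  assumes "finite L" "\<forall>w\<in>L. set w \<subseteq> letters m" "\<forall>k<m. flip_closed m k L" "t \<noteq> 0"
  shows "alternant t m (rho m) * (\<Sum>w\<in>L. \<Prod>i<m. t powi (int (2 * i + 1) * wt w i))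
    = (\<Sum>w\<in>L. alternant t m (\<lambda>j. rho m j + wt w j))"
proof -
  let ?c = "\<lambda>i. int (2 * i + 1)"
  let ?F = "\<Sum>w\<in>L. \<Prod>i<m. t powi (?c i * wt w i)"
  have F: "(\<Sum>w\<in>L. \<Prod>i<m. t powi (?c i * (sign_on X i * wt w (p i)))) = ?F"
    if "p permutes {0..<m}" "X \<subseteq> {..<m}" for p X
  proof -
    let ?g = "\<lambda>\<mu>. \<Prod>i<m. t powi (?c i * \<mu> i)"
    have "(\<Sum>w\<in>L. \<Prod>i<m. t powi (?c i * (sign_on X i * wt w (p i))))
        = (\<Sum>w\<in>L. ?g (\<lambda>i. if i \<in> {..<m} - X then - wt w (p i) else wt w (p i)))"
      by (intro sum.cong prod.cong) (auto simp: sign_on_def)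
    also have "\<dots> = (\<Sum>\<mu>\<in>#image_mset (\<lambda>\<mu> i. if i \<in> {..<m} - X then - \<mu> (p i) else \<mu> (p i)) (weights L). ?g \<mu>)"
      unfolding sum_weights[of "\<lambda>\<mu>. ?g (\<lambda>i. if i \<in> {..<m} - X then - \<mu> (p i) else \<mu> (p i))"]
        image_mset.compositionality comp_def ..
    also have "\<dots> = (\<Sum>\<mu>\<in>#weights L. ?g \<mu>)"
      by (subst weights_signed_permutation[OF assms(1-3) that(1)]) auto
    also have "\<dots> = ?F" by (rule sum_weights[symmetric])
    finally show ?thesis .
  qed
  have expand: "alternant t m \<mu> = (\<Sum>p | p permutes {0..<m}. \<Sum>X\<in>Pow {..<m}.
      signof p * ((- 1) ^ card ({..<m} - X) * (\<Prod>i<m. t powi (?c i * (sign_on X i * \<mu> (p i))))))" for \<mu>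
    unfolding alternant_leibniz prod_diff_signed_expansion sum_distrib_left ..
  have "alternant t m (rho m) * ?F
      = (\<Sum>p | p permutes {0..<m}. \<Sum>X\<in>Pow {..<m}. signof p * ((- 1) ^ card ({..<m} - X)
          * (\<Prod>i<m. t powi (?c i * (sign_on X i * rho m (p i))))) * ?F)"
    by (simp only: expand sum_distrib_right)
  also have "\<dots> = (\<Sum>p | p permutes {0..<m}. \<Sum>X\<in>Pow {..<m}. \<Sum>w\<in>L. signof p * ((- 1) ^ card ({..<m} - X)
          * (\<Prod>i<m. t powi (?c i * (sign_on X i * (rho m (p i) + wt w (p i)))))))"
  proof (intro sum.cong HOL.refl)
    fix p X assume pX: "p \<in> {p. p permutes {0..<m}}" "X \<in> Pow {..<m}"
    then have "?F = (\<Sum>w\<in>L. \<Prod>i<m. t powi (?c i * (sign_on X i * wt w (p i))))" using F by auto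
    moreover have "(\<Prod>i<m. t powi (?c i * (sign_on X i * rho m (p i)))) * (\<Prod>i<m. t powi (?c i * (sign_on X i * wt w (p i))))
      = (\<Prod>i<m. t powi (?c i * (sign_on X i * (rho m (p i) + wt w (p i)))))" for w
      using assms(4) by (simp only: prod.distrib[symmetric] distrib_left power_int_add[OF disjI1[OF assms(4)]])
    ultimately show "signof p * ((- 1) ^ card ({..<m} - X) * (\<Prod>i<m. t powi (?c i * (sign_on X i * rho m (p i))))) * ?F
      = (\<Sum>w\<in>L. signof p * ((- 1) ^ card ({..<m} - X) * (\<Prod>i<m. t powi (?c i * (sign_on X i * (rho m (p i) + wt w (p i)))))))"
      by (simp add: sum_distrib_left mult.assoc)
  qed
  also have "\<dots> = (\<Sum>w\<in>L. alternant t m (\<lambda>j. rho m j + wt w j))"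
    unfolding expand by (subst (3) sum.swap, rule sum.cong[OF HOL.refl], rule sum.swap)
  finally show ?thesis .
qed

theorem alternant_times_sum_highest:
  fixes t :: "'a :: field_char_0"
  assumes "finite L" "\<forall>w\<in>L. set w \<subseteq> letters m" "\<forall>k<m. flip_closed m k L" "t \<noteq> 0"
  shows "alternant t m (rho m) * (\<Sum>w\<in>L. \<Prod>i<m. t powi (int (2 * i + 1) * wt w i))
    = (\<Sum>w | w \<in> L \<and> highest m w. alternant t m (\<lambda>j. rho m j + wt w j))"
  unfolding alternant_times_sum[OF assms]
  using assms(4) by (intro sum_over_highest[OF assms(1-3)]) (simp add: alternant_reflect)

section \<open>Columns and pairs of columns as inequalities between counts\<close>

text \<open>\<open>P\<^sub>C(j)\<close>, followed by \<open>M\<^sub>C(j)\<close>; integers, because differences of these counts are compared.\<close>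

definition low :: "nat \<Rightarrow> (nat \<Rightarrow> letter) \<Rightarrow> nat \<Rightarrow> int" where
  "low h C j = int (card {i \<in> {1..h}. C i \<le> Pos j})"

definition high :: "nat \<Rightarrow> (nat \<Rightarrow> letter) \<Rightarrow> nat \<Rightarrow> int" where
  "high h C j = int (card {i \<in> {1..h}. Bar j \<le> C i})"

definition occ :: "nat \<Rightarrow> (nat \<Rightarrow> letter) \<Rightarrow> letter \<Rightarrow> int" where
  "occ h C x = int (card {i \<in> {1..h}. C i = x})"

definition column :: "nat \<Rightarrow> nat \<Rightarrow> (nat \<Rightarrow> letter) \<Rightarrow> bool" where
  "column m h C \<longleftrightarrow> (\<forall>i\<in>{1..h}. C i \<in> letters m) \<and> (\<forall>i\<in>{1..h}. \<forall>i'\<in>{1..h}. i < i' \<longrightarrow> C i < C i')"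

lemma letter_le_simps [simp]:
  "Pos i \<le> Pos j \<longleftrightarrow> i \<le> j" "Pos i \<le> Bar j" "\<not> Bar i \<le> Pos j" "Bar i \<le> Bar j \<longleftrightarrow> j \<le> i"
  by (auto simp: less_eq_letter_def)

lemma column_letters: "column m h C \<Longrightarrow> i \<in> {1..h} \<Longrightarrow> C i \<in> letters m"
  by (simp add: column_def)

lemma column_less_iff:
  assumes "column m h C" "i \<in> {1..h}" "i' \<in> {1..h}"
  shows "C i < C i' \<longleftrightarrow> i < i'"
proof -
  have "i < i' \<Longrightarrow> C i < C i'" "i' < i \<Longrightarrow> C i' < C i" using assms unfolding column_def by auto
  then show ?thesis by (cases i i' rule: linorder_cases) auto
qed

lemma column_le_iff:
  assumes "column m h C" "i \<in> {1..h}" "i' \<in> {1..h}"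
  shows "C i \<le> C i' \<longleftrightarrow> i \<le> i'"
  using column_less_iff[OF assms(1,3,2)] by (simp add: not_less[symmetric])

lemma le_Pos_Suc: "x \<le> Pos (Suc j) \<longleftrightarrow> x \<le> Pos j \<or> x = Pos (Suc j)"
  by (cases x) auto

lemma Bar_Suc_le: "Bar (Suc j) \<le> x \<longleftrightarrow> Bar j \<le> x \<or> x = Bar (Suc j)"
  by (cases x) auto

lemma card_filter_disjoint:
  assumes "finite A" "\<And>i. P i \<Longrightarrow> \<not> Q i"
  shows "card {i \<in> A. P i \<or> Q i} = card {i \<in> A. P i} + card {i \<in> A. Q i}"
proof -
  have "{i \<in> A. P i \<or> Q i} = {i \<in> A. P i} \<union> {i \<in> A. Q i}" by blast
  moreover have "{i \<in> A. P i} \<inter> {i \<in> A. Q i} = {}" using assms(2) by blast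
  moreover have "finite {i \<in> A. P i}" "finite {i \<in> A. Q i}" using assms(1) by simp_all
  ultimately show ?thesis by (simp only: card_Un_disjoint)
qed

lemma low_Suc: "low h C (Suc j) = low h C j + occ h C (Pos (Suc j))"
  unfolding low_def occ_def le_Pos_Suc by (subst card_filter_disjoint) auto

lemma high_Suc: "high h C (Suc j) = high h C j + occ h C (Bar (Suc j))"
  unfolding high_def occ_def Bar_Suc_le by (subst card_filter_disjoint) auto

lemma low_0:
  assumes "column m h C"
  shows "low h C 0 = 0"
proof -
  have "\<not> C i \<le> Pos 0" if "i \<in> {1..h}" for i
    using column_letters[OF assms that] by (cases "C i") (auto simp: letters_def)
  then have "{i \<in> {1..h}. C i \<le> Pos 0} = {}" by blast
  then show ?thesis unfolding low_def by (simp only: card.empty of_nat_0)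
qed

lemma high_0:
  assumes "column m h C"
  shows "high h C 0 = 0"
proof -
  have "\<not> Bar 0 \<le> C i" if "i \<in> {1..h}" for i
    using column_letters[OF assms that] by (cases "C i") (auto simp: letters_def)
  then have "{i \<in> {1..h}. Bar 0 \<le> C i} = {}" by blast
  then show ?thesis unfolding high_def by (simp only: card.empty of_nat_0)
qed

lemma low_plus_high:
  assumes "column m h C"
  shows "low h C m + high h C m = int h"
proof -
  have "C i \<le> Pos m \<longleftrightarrow> \<not> Bar m \<le> C i" if "i \<in> {1..h}" for i
    using column_letters[OF assms that] by (cases "C i") (auto simp: letters_def)
  then have un: "{i \<in> {1..h}. C i \<le> Pos m} \<union> {i \<in> {1..h}. Bar m \<le> C i} = {1..h}"
    and int: "{i \<in> {1..h}. C i \<le> Pos m} \<inter> {i \<in> {1..h}. Bar m \<le> C i} = {}" by blast+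
  have "card ({i \<in> {1..h}. C i \<le> Pos m} \<union> {i \<in> {1..h}. Bar m \<le> C i})
      = card {i \<in> {1..h}. C i \<le> Pos m} + card {i \<in> {1..h}. Bar m \<le> C i}"
    by (rule card_Un_disjoint[OF _ _ int]) simp_all
  then show ?thesis unfolding un by (simp add: low_def high_def)
qed

lemma occ_cases:
  assumes "column m h C"
  shows "occ h C x = 0 \<and> (\<forall>i\<in>{1..h}. C i \<noteq> x) \<or> occ h C x = 1 \<and> (\<exists>i\<in>{1..h}. C i = x)"
proof (cases "\<exists>i\<in>{1..h}. C i = x")
  case True
  then obtain i where i: "i \<in> {1..h}" "C i = x" by blast
  have "{i' \<in> {1..h}. C i' = x} = {i}"
  proof (intro equalityI subsetI)
    fix i' assume "i' \<in> {i' \<in> {1..h}. C i' = x}"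
    then have "i' \<in> {1..h}" "C i' = C i" using i by auto
    then show "i' \<in> {i}" using column_le_iff[OF assms, of i i'] column_le_iff[OF assms, of i' i] i by auto
  qed (use i in auto)
  then show ?thesis using i unfolding occ_def by auto
next
  case False
  then have "{i' \<in> {1..h}. C i' = x} = {}" by auto
  then show ?thesis using False unfolding occ_def by simp
qed

lemma occ_0_1: "column m h C \<Longrightarrow> occ h C x = 0 \<or> occ h C x = 1"
  using occ_cases by metis

text \<open>Entries increase strictly, so the row of an entry is the number of entries that do not exceed it.\<close>

lemma low_at:
  assumes "column m h C" "i \<in> {1..h}" "C i = Pos j"
  shows "low h C j = int i"
proof -
  have "{i' \<in> {1..h}. C i' \<le> Pos j} = {1..i}"
    using assms column_le_iff[OF assms(1) _ assms(2)] by (auto simp flip: assms(3))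
  then show ?thesis by (simp add: low_def)
qed

lemma high_at:
  assumes "column m h C" "i \<in> {1..h}" "C i = Bar j"
  shows "high h C j = int h - int i + 1"
proof -
  have "{i' \<in> {1..h}. Bar j \<le> C i'} = {i..h}"
    using assms column_le_iff[OF assms(1,2)] by (auto simp flip: assms(3))
  then show ?thesis using assms(2) by (simp add: high_def)
qed

definition admissible :: "nat \<Rightarrow> (nat \<Rightarrow> letter) \<Rightarrow> bool" where
  "admissible h C \<longleftrightarrow> (\<forall>i p b. p \<in> {1..h} \<and> b \<in> {1..h} \<and> C p = Pos i \<and> C b = Bar i \<longrightarrow> p + (h + 1 - b) \<le> i)"

text \<open>If the inequality fails at \<open>j\<close> but not at \<open>j - 1\<close>, both \<open>j\<close> and its barred copy occur, and the column condition for this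
  pair is the inequality at \<open>j\<close>.\<close>

lemma admissible_iff:
  assumes "column m h C"
  shows "admissible h C \<longleftrightarrow> (\<forall>j\<le>m. low h C j + high h C j \<le> int j)"
proof
  assume adm: "admissible h C"
  have "low h C j + high h C j \<le> int j" for j
  proof (induction j)
    case (Suc j)
    consider "occ h C (Pos (Suc j)) = 0" | "occ h C (Bar (Suc j)) = 0"
      | "occ h C (Pos (Suc j)) = 1" "occ h C (Bar (Suc j)) = 1"
      using occ_0_1[OF assms] by blast
    then show ?case
    proof cases
      case 3
      then obtain p b where pb: "p \<in> {1..h}" "C p = Pos (Suc j)" "b \<in> {1..h}" "C b = Bar (Suc j)"
        using occ_cases[OF assms] by (metis zero_neq_one)
      then have "p + (h + 1 - b) \<le> Suc j" using adm unfolding admissible_def by blast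
      then show ?thesis using low_at[OF assms pb(1,2)] high_at[OF assms pb(3,4)] pb by auto
    qed (use Suc occ_0_1[OF assms, of "Pos (Suc j)"] occ_0_1[OF assms, of "Bar (Suc j)"] in
        \<open>auto simp: low_Suc high_Suc\<close>)
  qed (simp add: low_0[OF assms] high_0[OF assms])
  then show "\<forall>j\<le>m. low h C j + high h C j \<le> int j" by blast
next
  assume le: "\<forall>j\<le>m. low h C j + high h C j \<le> int j"
  show "admissible h C" unfolding admissible_def
  proof (intro allI impI, elim conjE)
    fix i p b assume *: "p \<in> {1..h}" "b \<in> {1..h}" "C p = Pos i" "C b = Bar i"
    then have "i \<le> m" using column_letters[OF assms] by (force simp: letters_def)
    then have "low h C i + high h C i \<le> int i" using le by blast
    then show "p + (h + 1 - b) \<le> i" using low_at[OF assms *(1,3)] high_at[OF assms *(2,4)] * by auto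
  qed
qed

definition rows_increase :: "nat \<Rightarrow> (nat \<Rightarrow> letter) \<Rightarrow> (nat \<Rightarrow> letter) \<Rightarrow> bool" where
  "rows_increase h' C D \<longleftrightarrow> (\<forall>i\<in>{1..h'}. C i \<le> D i)"

text \<open>A column with strictly increasing entries dominates another one row by row if and only if it has, for every letter, at most as
  many entries that do not exceed it. For barred letters these numbers are complements of counts from the bottom, whence
  the difference of the heights.\<close>

lemma rows_increase_iff:
  assumes C: "column m h C" and D: "column m h' D" and "h' \<le> h"
  shows "rows_increase h' C D \<longleftrightarrow>
    (\<forall>j\<le>m. low h' D j \<le> low h C j \<and> high h C j - (int h - int h') \<le> high h' D j)"
proof
  assume r: "rows_increase h' C D"
  have "low h' D j \<le> low h C j \<and> high h C j - (int h - int h') \<le> high h' D j" for j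
  proof
    have "{i \<in> {1..h'}. D i \<le> Pos j} \<subseteq> {i \<in> {1..h}. C i \<le> Pos j}"
      using r assms(3) unfolding rows_increase_def by (auto intro: order_trans)
    then show "low h' D j \<le> low h C j" unfolding low_def by (simp add: card_mono)
    have "{i \<in> {1..h}. Bar j \<le> C i} \<subseteq> {i \<in> {1..h'}. Bar j \<le> D i} \<union> {h'<..h}"
      using r order_trans[of "Bar j" "C _" "D _"] by (auto simp: rows_increase_def not_less)
    then have "card {i \<in> {1..h}. Bar j \<le> C i} \<le> card ({i \<in> {1..h'}. Bar j \<le> D i} \<union> {h'<..h})"
      by (intro card_mono) auto
    also have "\<dots> \<le> card {i \<in> {1..h'}. Bar j \<le> D i} + (h - h')"
      using card_Un_le[of "{i \<in> {1..h'}. Bar j \<le> D i}" "{h'<..h}"] by simp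
    finally show "high h C j - (int h - int h') \<le> high h' D j" unfolding high_def using assms(3) by linarith
  qed
  then show "\<forall>j\<le>m. low h' D j \<le> low h C j \<and> high h C j - (int h - int h') \<le> high h' D j" by blast
next
  assume le: "\<forall>j\<le>m. low h' D j \<le> low h C j \<and> high h C j - (int h - int h') \<le> high h' D j"
  show "rows_increase h' C D" unfolding rows_increase_def
  proof
    fix i assume i: "i \<in> {1..h'}"
    then have i': "i \<in> {1..h}" using assms(3) by auto
    show "C i \<le> D i"
    proof (rule ccontr)
      assume "\<not> C i \<le> D i"
      then have gt: "D i < C i" by simp
      show False
      proof (cases "D i")
        case (Pos j)
        have "j \<le> m" using column_letters[OF D i] unfolding Pos by (auto simp: letters_def)
        have "i' < i" if "i' \<in> {1..h}" "C i' \<le> Pos j" for i'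
        proof -
          have "C i' < C i" using that gt Pos by simp
          then show ?thesis using column_less_iff[OF C that(1) i'] by simp
        qed
        then have "{i' \<in> {1..h}. C i' \<le> Pos j} \<subseteq> {1..<i}" by auto
        from card_mono[OF _ this] have "low h C j < int i" using i unfolding low_def by auto
        moreover have "low h' D j \<le> low h C j" using le \<open>j \<le> m\<close> by blast
        ultimately show False using low_at[OF D i Pos] by simp
      next
        case (Bar j)
        then obtain j' where j': "C i = Bar j'" "j' < j" using gt by (cases "C i") auto
        have "j \<le> m" using column_letters[OF D i] unfolding Bar by (auto simp: letters_def)
        have "{i..h} \<subseteq> {i' \<in> {1..h}. Bar (j - 1) \<le> C i'}"
        proof
          fix l assume "l \<in> {i..h}"
          then have "C i \<le> C l" "l \<in> {1..h}" using column_le_iff[OF C i'] i by auto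
          moreover have "Bar (j - 1) \<le> C i" using j' by simp
          ultimately show "l \<in> {i' \<in> {1..h}. Bar (j - 1) \<le> C i'}" using order_trans by blast
        qed
        from card_mono[OF _ this] have "high h C (j - 1) \<ge> int h - int i + 1"
          using i' unfolding high_def by auto
        moreover have "high h' D (j - 1) = int h' - int i"
        proof -
          have "occ h' D (Bar j) = 1" using occ_cases[OF D, of "Bar j"] i Bar by blast
          then show ?thesis using high_Suc[of h' D "j - 1"] high_at[OF D i Bar] j' by simp
        qed
        moreover have "j - 1 \<le> m" using \<open>j \<le> m\<close> by simp
        then have "high h C (j - 1) - (int h - int h') \<le> high h' D (j - 1)" using le by blast
        ultimately show False by simp
      qed
    qed
  qed
qed

definition pair_admissible :: "nat \<Rightarrow> nat \<Rightarrow> (nat \<Rightarrow> letter) \<Rightarrow> nat \<Rightarrow> (nat \<Rightarrow> letter) \<Rightarrow> bool" where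
  "pair_admissible m h C h' D \<longleftrightarrow>
     (\<forall>i j p q r s. 1 \<le> i \<and> i \<le> j \<and> j \<le> m \<and> p \<le> q \<and> q < r \<and> r \<le> s \<and>
        (p \<in> {1..h} \<and> C p = Pos i \<and> q \<in> {1..h'} \<and> D q = Pos j \<and>
           r \<in> {1..h'} \<and> D r = Bar j \<and> s \<in> {1..h'} \<and> D s = Bar i \<or>
         p \<in> {1..h} \<and> C p = Pos i \<and> q \<in> {1..h} \<and> C q = Pos j \<and>
           r \<in> {1..h} \<and> C r = Bar j \<and> s \<in> {1..h'} \<and> D s = Bar i) \<longrightarrow>
        (q - p) + (s - r) < j - i)"

text \<open>Row monotonicity is the case \<open>i = j\<close>.\<close>

definition pair_counts :: "nat \<Rightarrow> nat \<Rightarrow> (nat \<Rightarrow> letter) \<Rightarrow> nat \<Rightarrow> (nat \<Rightarrow> letter) \<Rightarrow> bool" where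
  "pair_counts m h C h' D \<longleftrightarrow> (\<forall>i j. i \<le> j \<longrightarrow> j \<le> m \<longrightarrow>
     low h' D j + high h' D j - int j \<le> low h C i + high h' D i - int i \<and>
     low h C j + high h C j - int j - (int h - int h') \<le> low h C i + high h' D i - int i)"

lemma low_increment:
  assumes "column m h C" "i \<le> j"
  shows "low h C i \<le> low h C j \<and> low h C j \<le> low h C i + (int j - int i)"
  using assms(2)
proof (induction j rule: dec_induct)
  case (step j)
  then show ?case using occ_0_1[OF assms(1), of "Pos (Suc j)"] by (auto simp: low_Suc)
qed simp

lemma high_increment:
  assumes "column m h C" "i \<le> j"
  shows "high h C i \<le> high h C j \<and> high h C j \<le> high h C i + (int j - int i)"
  using assms(2)
proof (induction j rule: dec_induct)
  case (step j)
  then show ?case using occ_0_1[OF assms(1), of "Bar (Suc j)"] by (auto simp: high_Suc)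
qed simp

text \<open>At an index \<open>i\<close> that occurs in the left column and barred in the right one, the inequalities are strict. Passing
  from \<open>j\<close> to \<open>j + 1\<close>, the left side grows only if \<open>j + 1\<close> occurs together with its barred copy, and then the strict inequality is the
  condition on \<open>i\<close> and \<open>j + 1\<close>; it holds trivially when the rows are not in the order which that condition assumes.\<close>

lemma pair_strict:
  assumes C: "column m h C" and D: "column m h' D" and "h' \<le> h"
    and rows: "rows_increase h' C D" and adm: "pair_admissible m h C h' D"
    and p: "p \<in> {1..h}" "C p = Pos i" and s: "s \<in> {1..h'}" "D s = Bar i"
    and "i \<le> j" "j \<le> m"
  shows "low h' D j + high h' D j - int j < low h C i + high h' D i - int i"
    and "low h C j + high h C j - int j - (int h - int h') < low h C i + high h' D i - int i"
proof -
  have i: "1 \<le> i" "i \<le> m" using column_letters[OF C p(1)] unfolding p(2) by (auto simp: letters_def)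
  have le: "low h' D j \<le> low h C j" "high h C j - (int h - int h') \<le> high h' D j" if "j \<le> m" for j
    using rows that unfolding rows_increase_iff[OF C D assms(3)] by blast+
  note lp = low_at[OF C p] and hs = high_at[OF D s]
  \<comment> \<open>for equality at \<open>j = i\<close> the comparison at \<open>i - 1\<close> puts \<open>i\<close> in the same row of both columns\<close>
  obtain i' where i': "i = Suc i'" using i by (cases i) auto
  have mp: "occ h C (Pos i) = 1" using occ_cases[OF C, of "Pos i"] p by blast
  have ms: "occ h' D (Bar i) = 1" using occ_cases[OF D, of "Bar i"] s by blast
  from \<open>i \<le> j\<close> \<open>j \<le> m\<close>
  have "low h' D j + high h' D j - int j < low h C i + high h' D i - int i"
  proof (induction j rule: dec_induct)
    case base
    have "low h' D i \<noteq> low h C i"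
    proof
      assume eq: "low h' D i = low h C i"
      have "low h' D i' \<le> low h C i'" using le i i' by simp
      then have "occ h' D (Pos i) \<noteq> 0" using eq mp by (auto simp: i' low_Suc)
      then obtain q where q: "q \<in> {1..h'}" "D q = Pos i" using occ_cases[OF D, of "Pos i"] by auto
      then have "q = p" using low_at[OF D q] lp eq by simp
      have "q < s" using column_less_iff[OF D q(1) s(1)] q s by simp
      then have "(q - p) + (s - s) < i - i"
        using adm i p q s \<open>q = p\<close> unfolding pair_admissible_def by blast
      then show False by simp
    qed
    then show ?case using le[OF i(2)] by simp
  next
    case (step j)
    consider "occ h' D (Pos (Suc j)) = 0" | "occ h' D (Bar (Suc j)) = 0"
      | "occ h' D (Pos (Suc j)) = 1" "occ h' D (Bar (Suc j)) = 1"
      using occ_0_1[OF D] by blast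
    then show ?case
    proof cases
      case 3
      then obtain q r where q: "q \<in> {1..h'}" "D q = Pos (Suc j)" and r: "r \<in> {1..h'}" "D r = Bar (Suc j)"
        using occ_cases[OF D] by (metis zero_neq_one)
      note lq = low_at[OF D q] and hr = high_at[OF D r]
      have "q < r" using column_less_iff[OF D q(1) r(1)] q r by simp
      have "r < s" using column_less_iff[OF D r(1) s(1)] r s step.hyps by simp
      show ?thesis
      proof (cases "p \<le> q")
        case True
        have "(q - p) + (s - r) < Suc j - i"
          using adm i p q r s True \<open>q < r\<close> \<open>r < s\<close> step unfolding pair_admissible_def
          by (metis less_imp_le le_SucI)
        then show ?thesis using lq hr lp hs True \<open>r < s\<close> step.hyps by linarith
      next
        case False
        then show ?thesis using high_increment[OF D, of i "Suc j"] lq lp step.hyps by linarith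
      qed
    qed (use step occ_0_1[OF D, of "Pos (Suc j)"] occ_0_1[OF D, of "Bar (Suc j)"] in
        \<open>auto simp: low_Suc high_Suc\<close>)
  qed
  then show "low h' D j + high h' D j - int j < low h C i + high h' D i - int i" .
  from \<open>i \<le> j\<close> \<open>j \<le> m\<close>
  show "low h C j + high h C j - int j - (int h - int h') < low h C i + high h' D i - int i"
  proof (induction j rule: dec_induct)
    case base
    have "high h C i - (int h - int h') \<noteq> high h' D i"
    proof
      assume eq: "high h C i - (int h - int h') = high h' D i"
      have "high h C i' - (int h - int h') \<le> high h' D i'" using le i i' by simp
      then have "occ h C (Bar i) \<noteq> 0" using eq ms by (auto simp: i' high_Suc)
      then obtain r where r: "r \<in> {1..h}" "C r = Bar i" using occ_cases[OF C, of "Bar i"] by auto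
      then have "r = s" using high_at[OF C r] hs eq by simp
      have "p < r" using column_less_iff[OF C p(1) r(1)] p r by simp
      then have "(p - p) + (s - r) < i - i"
        using adm i p r s \<open>r = s\<close> unfolding pair_admissible_def by blast
      then show False by simp
    qed
    then show ?case using le[OF i(2)] by simp
  next
    case (step j)
    consider "occ h C (Pos (Suc j)) = 0" | "occ h C (Bar (Suc j)) = 0"
      | "occ h C (Pos (Suc j)) = 1" "occ h C (Bar (Suc j)) = 1"
      using occ_0_1[OF C] by blast
    then show ?case
    proof cases
      case 3
      then obtain q r where q: "q \<in> {1..h}" "C q = Pos (Suc j)" and r: "r \<in> {1..h}" "C r = Bar (Suc j)"
        using occ_cases[OF C] by (metis zero_neq_one)
      note lq = low_at[OF C q] and hr = high_at[OF C r]
      have "q < r" using column_less_iff[OF C q(1) r(1)] q r by simp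
      have "p < q" using column_less_iff[OF C p(1) q(1)] q p step.hyps by simp
      show ?thesis
      proof (cases "r \<le> s")
        case True
        have "(q - p) + (s - r) < Suc j - i"
          using adm i p q r s True \<open>q < r\<close> \<open>p < q\<close> step unfolding pair_admissible_def
          by (metis less_imp_le le_SucI)
        then show ?thesis using lq hr lp hs True \<open>p < q\<close> step.hyps by linarith
      next
        case False
        then show ?thesis using low_increment[OF C, of i "Suc j"] lq lp hr hs step.hyps by linarith
      qed
    qed (use step occ_0_1[OF C, of "Pos (Suc j)"] occ_0_1[OF C, of "Bar (Suc j)"] in
        \<open>auto simp: low_Suc high_Suc\<close>)
  qed
qed

text \<open>Going down from \<open>i + 1\<close> to \<open>i\<close>, the right side \<open>P\<^sub>C(i) + M\<^sub>D(i) - i\<close> drops only if \<open>i + 1\<close> occurs in the left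
  column and barred in the right one, which is where the inequality is strict. Conversely, the inequality at \<open>i - 1\<close> gives
  back the strict one at \<open>i\<close>.\<close>

lemma pair_counts_iff:
  assumes C: "column m h C" and D: "column m h' D" and "h' \<le> h"
  shows "rows_increase h' C D \<and> pair_admissible m h C h' D \<longleftrightarrow> pair_counts m h C h' D"
proof (intro iffI, elim conjE)
  assume rows: "rows_increase h' C D" and adm: "pair_admissible m h C h' D"
  show "pair_counts m h C h' D" unfolding pair_counts_def
  proof (intro allI impI)
    fix i j :: nat assume "i \<le> j" "j \<le> m"
    then show "low h' D j + high h' D j - int j \<le> low h C i + high h' D i - int i \<and>
     low h C j + high h C j - int j - (int h - int h') \<le> low h C i + high h' D i - int i"
    proof (induction i rule: inc_induct)
      case base
      then have "low h' D j \<le> low h C j \<and> high h C j - (int h - int h') \<le> high h' D j"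
        using rows unfolding rows_increase_iff[OF C D assms(3)] by blast
      then show ?case by linarith
    next
      case (step i)
      show ?case
      proof (cases "occ h C (Pos (Suc i)) = 1 \<and> occ h' D (Bar (Suc i)) = 1")
        case True
        then obtain p s where "p \<in> {1..h}" "C p = Pos (Suc i)" "s \<in> {1..h'}" "D s = Bar (Suc i)"
          using occ_cases[OF C] occ_cases[OF D] by (metis zero_neq_one)
        note pair_strict[OF C D assms(3) rows adm this, of j]
        then show ?thesis using step.hyps step.prems True by (auto simp: low_Suc high_Suc)
      next
        case False
        then show ?thesis
          using step occ_0_1[OF C, of "Pos (Suc i)"] occ_0_1[OF D, of "Bar (Suc i)"]
          by (auto simp: low_Suc high_Suc)
      qed
    qed
  qed
next
  assume pc: "pair_counts m h C h' D"
  show "rows_increase h' C D \<and> pair_admissible m h C h' D"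
  proof
    show "rows_increase h' C D" unfolding rows_increase_iff[OF C D assms(3)]
      using pc unfolding pair_counts_def by force
    show "pair_admissible m h C h' D" unfolding pair_admissible_def
    proof (intro allI impI, elim conjE)
      fix i j p q r s :: nat
      assume *: "1 \<le> i" "i \<le> j" "j \<le> m" "p \<le> q" "q < r" "r \<le> s"
        and cases: "p \<in> {1..h} \<and> C p = Pos i \<and> q \<in> {1..h'} \<and> D q = Pos j \<and>
           r \<in> {1..h'} \<and> D r = Bar j \<and> s \<in> {1..h'} \<and> D s = Bar i \<or>
         p \<in> {1..h} \<and> C p = Pos i \<and> q \<in> {1..h} \<and> C q = Pos j \<and>
           r \<in> {1..h} \<and> C r = Bar j \<and> s \<in> {1..h'} \<and> D s = Bar i"
      then have p: "p \<in> {1..h}" "C p = Pos i" and s: "s \<in> {1..h'}" "D s = Bar i" by auto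
      obtain i' where i': "i = Suc i'" using * by (cases i) auto
      have "occ h C (Pos i) = 1" using occ_cases[OF C, of "Pos i"] p by blast
      moreover have "occ h' D (Bar i) = 1" using occ_cases[OF D, of "Bar i"] s by blast
      moreover have "low h' D j + high h' D j - int j \<le> low h C i' + high h' D i' - int i' \<and>
        low h C j + high h C j - int j - (int h - int h') \<le> low h C i' + high h' D i' - int i'"
        using pc * i' unfolding pair_counts_def by auto
      ultimately have lt: "low h' D j + high h' D j - int j < low h C i + high h' D i - int i"
        "low h C j + high h C j - int j - (int h - int h') < low h C i + high h' D i - int i"
        by (auto simp: i' low_Suc high_Suc)
      from cases show "(q - p) + (s - r) < j - i"
      proof (elim disjE conjE)
        assume q: "q \<in> {1..h'}" "D q = Pos j" and r: "r \<in> {1..h'}" "D r = Bar j"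
        show ?thesis
          using lt(1) * low_at[OF C p] low_at[OF D q] high_at[OF D r] high_at[OF D s] by linarith
      next
        assume q: "q \<in> {1..h}" "C q = Pos j" and r: "r \<in> {1..h}" "C r = Bar j"
        show ?thesis
          using lt(2) * low_at[OF C p] low_at[OF C q] high_at[OF C r] high_at[OF D s] by linarith
      qed
    qed
  qed
qed

section \<open>Flipping a pivot inside a pair of columns\<close>

definition signature_sum :: "nat \<Rightarrow> nat \<Rightarrow> (nat \<Rightarrow> letter) \<Rightarrow> (letter \<Rightarrow> bool) \<Rightarrow> int" where
  "signature_sum k h C Q = (\<Sum>i | i \<in> {1..h} \<and> Q (C i). eps k (C i))"

lemma eps_eq:
  "i \<noteq> 0 \<Longrightarrow> eps k (Pos i) = of_bool (i = Suc k) - of_bool (i = Suc (Suc k))"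
  "i \<noteq> 0 \<Longrightarrow> eps k (Bar i) = of_bool (i = Suc (Suc k)) - of_bool (i = Suc k)"
  by (auto simp: eps_def letter_wt_def)

text \<open>At most four letters have a nonzero sign.\<close>

lemma signature_sum_eq:
  assumes "column m h C"
  shows "signature_sum k h C Q =
    of_bool (Q (Pos (Suc k))) * occ h C (Pos (Suc k)) - of_bool (Q (Pos (Suc (Suc k)))) * occ h C (Pos (Suc (Suc k)))
    + of_bool (Q (Bar (Suc (Suc k)))) * occ h C (Bar (Suc (Suc k))) - of_bool (Q (Bar (Suc k))) * occ h C (Bar (Suc k))"
proof -
  have sum_occ: "of_bool (Q x) * occ h C x = (\<Sum>i\<in>{1..h}. of_bool (Q (C i)) * of_bool (C i = x))" for x
  proof -
    have "occ h C x = (\<Sum>i\<in>{1..h}. of_bool (C i = x))"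
      unfolding occ_def by (simp add: sum.If_cases of_bool_def Int_def)
    then have "of_bool (Q x) * occ h C x = (\<Sum>i\<in>{1..h}. of_bool (Q x) * of_bool (C i = x))"
      by (simp only: sum_distrib_left)
    also have "\<dots> = (\<Sum>i\<in>{1..h}. of_bool (Q (C i)) * of_bool (C i = x))"
      by (rule sum.cong) auto
    finally show ?thesis .
  qed
  have "signature_sum k h C Q = (\<Sum>i\<in>{1..h}. of_bool (Q (C i)) * eps k (C i))"
    unfolding signature_sum_def unfolding sum.inter_filter[OF finite_atLeastAtMost] by (rule sum.cong) auto
  also have "\<dots> = (\<Sum>i\<in>{1..h}. of_bool (Q (C i)) * (of_bool (C i = Pos (Suc k)) - of_bool (C i = Pos (Suc (Suc k)))
      + of_bool (C i = Bar (Suc (Suc k))) - of_bool (C i = Bar (Suc k))))"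
  proof (intro sum.cong HOL.refl arg_cong2[of _ _ _ _ "(*)"])
    fix i assume "i \<in> {1..h}"
    then have "C i \<in> letters m" by (rule column_letters[OF assms])
    then show "eps k (C i) = of_bool (C i = Pos (Suc k)) - of_bool (C i = Pos (Suc (Suc k)))
      + of_bool (C i = Bar (Suc (Suc k))) - of_bool (C i = Bar (Suc k))"
      by (cases "C i") (auto simp: letters_def eps_eq)
  qed
  finally show ?thesis unfolding sum_occ by (simp add: sum.distrib sum_subtractf algebra_simps)
qed

lemma occ_nonletter: "column m h C \<Longrightarrow> x \<notin> letters m \<Longrightarrow> occ h C x = 0"
  using occ_cases[of m h C x] column_letters[of m h C] by blast

lemma low_upd:
  assumes "a \<in> {1..h}"
  shows "low h (C(a := y)) j = low h C j - of_bool (C a \<le> Pos j) + of_bool (y \<le> Pos j)"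
proof -
  have *: "low h D j = of_bool (D a \<le> Pos j) + int (card {i \<in> {1..h} - {a}. D i \<le> Pos j})" for D
  proof -
    have "{i \<in> {1..h}. D i \<le> Pos j} = (if D a \<le> Pos j then insert a else id) {i \<in> {1..h} - {a}. D i \<le> Pos j}"
      using assms by auto
    then show ?thesis unfolding low_def by auto
  qed
  have "{i \<in> {1..h} - {a}. (C(a := y)) i \<le> Pos j} = {i \<in> {1..h} - {a}. C i \<le> Pos j}" by auto
  then show ?thesis unfolding *[of "C(a := y)"] *[of C] by simp
qed

lemma high_upd:
  assumes "a \<in> {1..h}"
  shows "high h (C(a := y)) j = high h C j - of_bool (Bar j \<le> C a) + of_bool (Bar j \<le> y)"
proof -
  have *: "high h D j = of_bool (Bar j \<le> D a) + int (card {i \<in> {1..h} - {a}. Bar j \<le> D i})" for D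
  proof -
    have "{i \<in> {1..h}. Bar j \<le> D i} = (if Bar j \<le> D a then insert a else id) {i \<in> {1..h} - {a}. Bar j \<le> D i}"
      using assms by auto
    then show ?thesis unfolding high_def by auto
  qed
  have "{i \<in> {1..h} - {a}. Bar j \<le> (C(a := y)) i} = {i \<in> {1..h} - {a}. Bar j \<le> C i}" by auto
  then show ?thesis unfolding *[of "C(a := y)"] *[of C] by simp
qed

text \<open>The part of the pivot condition visible inside the column of the pivot.\<close>

definition column_pivot :: "nat \<Rightarrow> nat \<Rightarrow> (nat \<Rightarrow> letter) \<Rightarrow> letter \<Rightarrow> bool" where
  "column_pivot k h C x \<longleftrightarrow>
     (\<forall>y. signature_sum k h C (\<lambda>z. y \<le> z \<and> z < x) \<le> 0 \<and> 0 \<le> signature_sum k h C (\<lambda>z. x < z \<and> z \<le> y))"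

text \<open>The column \<open>D\<close> to the right of the pivot is read immediately before the column \<open>C\<close> of the pivot.\<close>

definition pivot_after :: "nat \<Rightarrow> nat \<Rightarrow> (nat \<Rightarrow> letter) \<Rightarrow> letter \<Rightarrow> nat \<Rightarrow> (nat \<Rightarrow> letter) \<Rightarrow> bool" where
  "pivot_after k h C x h' D \<longleftrightarrow>
     (\<forall>y. signature_sum k h' D (\<lambda>z. y \<le> z) + signature_sum k h C (\<lambda>z. z < x) \<le> 0)"

text \<open>The column \<open>B\<close> to the left of the pivot is read immediately after the column \<open>C\<close> of the pivot.\<close>

definition pivot_before :: "nat \<Rightarrow> nat \<Rightarrow> (nat \<Rightarrow> letter) \<Rightarrow> letter \<Rightarrow> nat \<Rightarrow> (nat \<Rightarrow> letter) \<Rightarrow> bool" where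
  "pivot_before k h C x h' B \<longleftrightarrow>
     (\<forall>y. 0 \<le> signature_sum k h C (\<lambda>z. x < z) + signature_sum k h' B (\<lambda>z. z \<le> y))"

lemma flip_cases:
  assumes "x \<in> letters m" "eps k x \<noteq> 0" "k < m"
  obtains "x = Pos (Suc k)" "Suc k < m" "flip m k x = Pos (Suc (Suc k))"
  | "x = Pos (Suc (Suc k))" "Suc k < m" "flip m k x = Pos (Suc k)"
  | "x = Bar (Suc (Suc k))" "Suc k < m" "flip m k x = Bar (Suc k)"
  | "x = Bar (Suc k)" "Suc k < m" "flip m k x = Bar (Suc (Suc k))"
  | "x = Pos (Suc k)" "m = Suc k" "flip m k x = Bar (Suc k)"
  | "x = Bar (Suc k)" "m = Suc k" "flip m k x = Pos (Suc k)"
proof (cases x)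
  case (Pos i)
  then have "i \<noteq> 0" "i \<le> m" using assms(1) by (auto simp: letters_def)
  then have "i = Suc k \<or> i = Suc (Suc k)" using assms(2) Pos by (auto simp: eps_eq)
  then show ?thesis using that(1,2,5) Pos assms(3) \<open>i \<le> m\<close> by (cases "Suc k < m") (auto simp: flip_def)
next
  case (Bar i)
  then have "i \<noteq> 0" "i \<le> m" using assms(1) by (auto simp: letters_def)
  then have "i = Suc k \<or> i = Suc (Suc k)" using assms(2) Bar by (auto simp: eps_eq)
  then show ?thesis using that(3,4,6) Bar assms(3) \<open>i \<le> m\<close> by (cases "Suc k < m") (auto simp: flip_def)
qed

text \<open>A letter of nonzero sign and its flip are consecutive in the alphabet, so a flip keeps the order relative to all other letters.\<close>

lemma flip_adjacent:
  assumes "x \<in> letters m" "eps k x \<noteq> 0" "k < m" "z \<in> letters m" "z \<noteq> x" "z \<noteq> flip m k x"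
  shows "z < x \<longleftrightarrow> z < flip m k x"
proof -
  have "z = Pos i \<Longrightarrow> i \<le> m" "z = Bar i \<Longrightarrow> i \<le> m" for i using assms(4) by (auto simp: letters_def)
  note z = this assms(5,6)
  from assms(1-3) show ?thesis
    by (rule flip_cases; cases z; use z in \<open>(simp; fail) | (simp, presburger)\<close>)
qed

lemma occ_flip:
  assumes C: "column m h C" and "x \<in> letters m" "eps k x \<noteq> 0" "k < m" and pv: "column_pivot k h C x"
  shows "occ h C (flip m k x) = 0"
proof -
  have "signature_sum k h C (\<lambda>z. flip m k x \<le> z \<and> z < x) \<le> 0" "0 \<le> signature_sum k h C (\<lambda>z. x < z \<and> z \<le> flip m k x)"
    using pv unfolding column_pivot_def by blast+
  note pvs = this[unfolded signature_sum_eq[OF C]]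
  have none: "m = Suc k \<Longrightarrow> occ h C (Pos (Suc (Suc k))) = 0" "m = Suc k \<Longrightarrow> occ h C (Bar (Suc (Suc k))) = 0"
    by (auto intro!: occ_nonletter[OF C] simp: letters_def)
  from assms(2-4) show ?thesis
    by (rule flip_cases) (use pvs none occ_0_1[OF C, of "flip m k x"] in simp_all)
qed

lemma flip_column:
  assumes C: "column m h C" and a: "a \<in> {1..h}" and "eps k (C a) \<noteq> 0" "k < m"
    and "occ h C (flip m k (C a)) = 0"
  shows "column m h (C(a := flip m k (C a)))"
proof -
  have x: "C a \<in> letters m" by (rule column_letters[OF C a])
  have lt: "C i < flip m k (C a) \<longleftrightarrow> i < a" if "i \<in> {1..h}" "i \<noteq> a" for i
  proof -
    have "C i \<noteq> flip m k (C a)" using occ_cases[OF C, of "flip m k (C a)"] assms(5) that by auto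
    moreover have "C i \<noteq> C a"
    proof
      assume "C i = C a"
      then show False using column_le_iff[OF C that(1) a] column_le_iff[OF C a that(1)] that(2) by simp
    qed
    ultimately show ?thesis
      using flip_adjacent[OF x assms(3,4) column_letters[OF C that(1)]] column_less_iff[OF C that(1) a] by simp
  qed
  have ne: "C i \<noteq> flip m k (C a)" if "i \<in> {1..h}" for i
    using occ_cases[OF C, of "flip m k (C a)"] assms(5) that by auto
  have gt: "flip m k (C a) < C i \<longleftrightarrow> a < i" if "i \<in> {1..h}" "i \<noteq> a" for i
  proof -
    have "flip m k (C a) < C i \<longleftrightarrow> \<not> C i < flip m k (C a)" using ne[OF that(1)] by (metis not_less_iff_gr_or_eq)
    then show ?thesis using lt[OF that] that(2) by linarith
  qed
  show ?thesis unfolding column_def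
  proof (intro conjI ballI impI)
    show "(C(a := flip m k (C a))) i \<in> letters m" if "i \<in> {1..h}" for i
      using that column_letters[OF C that] flip_letters[OF assms(4) x] by simp
    fix i i' assume "i \<in> {1..h}" "i' \<in> {1..h}" "i < i'"
    then consider "i = a" "i' \<noteq> a" | "i' = a" "i \<noteq> a" | "i \<noteq> a" "i' \<noteq> a" by blast
    then show "(C(a := flip m k (C a))) i < (C(a := flip m k (C a))) i'"
    proof cases
      case 1
      then show ?thesis using gt[of i'] \<open>i' \<in> {1..h}\<close> \<open>i < i'\<close> by simp
    next
      case 2
      then show ?thesis using lt[of i] \<open>i \<in> {1..h}\<close> \<open>i < i'\<close> by simp
    next
      case 3
      then show ?thesis using column_less_iff[OF C, of i i'] \<open>i \<in> {1..h}\<close> \<open>i' \<in> {1..h}\<close> \<open>i < i'\<close> by simp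
    qed
  qed
qed

text \<open>The changes \<open>dl\<close> and \<open>dh\<close> of the two counts at the index \<open>k + 1\<close> when \<open>x\<close> is flipped. No other index below or at \<open>m\<close>
  is affected.\<close>

definition count_shift :: "nat \<Rightarrow> nat \<Rightarrow> letter \<Rightarrow> int \<Rightarrow> int \<Rightarrow> bool" where
  "count_shift m k x dl dh \<longleftrightarrow>
     x = Pos (Suc k) \<and> Suc k < m \<and> dl = - 1 \<and> dh = 0 \<or> x = Pos (Suc (Suc k)) \<and> Suc k < m \<and> dl = 1 \<and> dh = 0 \<or>
     x = Bar (Suc (Suc k)) \<and> Suc k < m \<and> dl = 0 \<and> dh = 1 \<or> x = Bar (Suc k) \<and> Suc k < m \<and> dl = 0 \<and> dh = - 1 \<or>
     x = Pos (Suc k) \<and> m = Suc k \<and> dl = - 1 \<and> dh = 1 \<or> x = Bar (Suc k) \<and> m = Suc k \<and> dl = 1 \<and> dh = - 1"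

lemma low_high_flip:
  assumes C: "column m h C" and a: "a \<in> {1..h}" and "eps k (C a) \<noteq> 0" "k < m"
  obtains dl dh :: int
  where "\<And>j. j \<le> m \<Longrightarrow> low h (C(a := flip m k (C a))) j = low h C j + dl * of_bool (j = Suc k)"
    "\<And>j. j \<le> m \<Longrightarrow> high h (C(a := flip m k (C a))) j = high h C j + dh * of_bool (j = Suc k)"
    "count_shift m k (C a) dl dh"
  using column_letters[OF C a] assms(3,4)
proof (rule flip_cases, goal_cases)
  case 1 then show ?case by (intro that[of "-1" 0]) (auto simp: low_upd[OF a] high_upd[OF a] count_shift_def)
next
  case 2 then show ?case by (intro that[of 1 0]) (auto simp: low_upd[OF a] high_upd[OF a] count_shift_def)
next
  case 3 then show ?case by (intro that[of 0 1]) (auto simp: low_upd[OF a] high_upd[OF a] count_shift_def)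
next
  case 4 then show ?case by (intro that[of 0 "-1"]) (auto simp: low_upd[OF a] high_upd[OF a] count_shift_def)
next
  case 5 then show ?case by (intro that[of "-1" 1]) (auto simp: low_upd[OF a] high_upd[OF a] count_shift_def)
next
  case 6 then show ?case by (intro that[of 1 "-1"]) (auto simp: low_upd[OF a] high_upd[OF a] count_shift_def)
qed

lemma pair_countsD:
  assumes "pair_counts m h C h' D" "i \<le> j" "j \<le> m"
  shows "low h' D j + high h' D j - int j \<le> low h C i + high h' D i - int i"
    "low h C j + high h C j - int j - (int h - int h') \<le> low h C i + high h' D i - int i"
  using assms unfolding pair_counts_def by blast+

lemma column_pivot_facts:
  assumes C: "column m h C" and "column_pivot k h C x" "Suc k = K"
  shows "x = Pos K \<Longrightarrow> occ h C (Pos (Suc K)) = 0"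
    "x = Pos (Suc K) \<Longrightarrow> occ h C (Pos K) = 0"
    "x = Bar (Suc K) \<Longrightarrow> occ h C (Bar K) = 0 \<and> occ h C (Pos K) \<le> occ h C (Pos (Suc K))"
    "x = Bar K \<Longrightarrow> occ h C (Bar (Suc K)) = 0"
    "x = Pos K \<Longrightarrow> occ h C (Bar K) \<le> occ h C (Bar (Suc K))"
    "x = Pos (Suc K) \<Longrightarrow> occ h C (Bar K) \<le> occ h C (Bar (Suc K))"
    "x = Bar K \<Longrightarrow> occ h C (Pos K) \<le> occ h C (Pos (Suc K))"
proof -
  have *: "signature_sum k h C (\<lambda>z. y \<le> z \<and> z < x) \<le> 0" "0 \<le> signature_sum k h C (\<lambda>z. x < z \<and> z \<le> y)" for y
    using assms(2) unfolding column_pivot_def by blast+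
  note * = *[unfolded signature_sum_eq[OF C] assms(3)]
  show "x = Pos K \<Longrightarrow> occ h C (Pos (Suc K)) = 0"
    using *(2)[of "Pos (Suc K)"] occ_0_1[OF C, of "Pos (Suc K)"] by simp
  show "x = Pos (Suc K) \<Longrightarrow> occ h C (Pos K) = 0"
    using *(1)[of "Pos K"] occ_0_1[OF C, of "Pos K"] by simp
  show "x = Bar (Suc K) \<Longrightarrow> occ h C (Bar K) = 0 \<and> occ h C (Pos K) \<le> occ h C (Pos (Suc K))"
    using *(2)[of "Bar K"] *(1)[of "Pos K"] occ_0_1[OF C, of "Bar K"] by simp
  show "x = Bar K \<Longrightarrow> occ h C (Bar (Suc K)) = 0"
    using *(1)[of "Bar (Suc K)"] occ_0_1[OF C, of "Bar (Suc K)"] by simp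
  show "x = Pos K \<Longrightarrow> occ h C (Bar K) \<le> occ h C (Bar (Suc K))"
    using *(2)[of "Pos (Suc K)"] *(2)[of "Bar K"] occ_0_1[OF C, of "Pos (Suc K)"] by simp
  show "x = Pos (Suc K) \<Longrightarrow> occ h C (Bar K) \<le> occ h C (Bar (Suc K))"
    using *(2)[of "Bar K"] by simp
  show "x = Bar K \<Longrightarrow> occ h C (Pos K) \<le> occ h C (Pos (Suc K))"
    using *(1)[of "Bar (Suc K)"] *(1)[of "Pos K"] occ_0_1[OF C, of "Bar (Suc K)"] by simp
qed

lemma occ_beyond: "column m h C \<Longrightarrow> occ h C (Pos (Suc m)) = 0 \<and> occ h C (Bar (Suc m)) = 0"
  by (auto intro!: occ_nonletter simp: letters_def)

text \<open>If the inequality at \<open>k + 1\<close> became false, equality there and the inequalities at \<open>k\<close> and \<open>k + 2\<close> would force a letter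
  of the column that precedes or follows the pivot with the same sign, against the pivot condition.\<close>

lemma column_counts_flip:
  assumes C: "column m h C" and a: "a \<in> {1..h}" and "eps k (C a) \<noteq> 0" "k < m"
    and pv: "column_pivot k h C (C a)"
    and adm: "\<forall>j\<le>m. low h C j + high h C j \<le> int j" and j: "j \<le> m"
  shows "low h (C(a := flip m k (C a))) j + high h (C(a := flip m k (C a))) j \<le> int j"
proof -
  obtain dl dh where lh:
    "\<And>j. j \<le> m \<Longrightarrow> low h (C(a := flip m k (C a))) j = low h C j + dl * of_bool (j = Suc k)"
    "\<And>j. j \<le> m \<Longrightarrow> high h (C(a := flip m k (C a))) j = high h C j + dh * of_bool (j = Suc k)"
    and x: "count_shift m k (C a) dl dh"
    by (rule low_high_flip[OF C a assms(3,4)]) blast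
  note pf = column_pivot_facts[OF C pv HOL.refl]
  have a1: "occ h C (C a) = 1" using occ_cases[OF C, of "C a"] a by blast
  have rec: "low h C (Suc k) = low h C k + occ h C (Pos (Suc k))"
    "low h C (Suc (Suc k)) = low h C (Suc k) + occ h C (Pos (Suc (Suc k)))"
    "high h C (Suc k) = high h C k + occ h C (Bar (Suc k))"
    "high h C (Suc (Suc k)) = high h C (Suc k) + occ h C (Bar (Suc (Suc k)))"
    by (rule low_Suc high_Suc)+
  have b: "occ h C x = 0 \<or> occ h C x = 1" for x by (rule occ_0_1[OF C])
  show ?thesis
  proof (cases "j = Suc k")
    case False
    then show ?thesis using lh[OF j] adm j by simp
  next
    case True
    have "low h C k + high h C k \<le> int k" using adm assms(4) by auto
    moreover have "low h C (Suc k) + high h C (Suc k) \<le> int (Suc k)" using adm[rule_format, of "Suc k"] assms(4) by simp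
    moreover have "low h C (Suc (Suc k)) + high h C (Suc (Suc k)) \<le> int (Suc (Suc k))" if "Suc k < m"
      using adm[rule_format, of "Suc (Suc k)"] that by simp
    ultimately show ?thesis
      using x[unfolded count_shift_def] lh[OF j] a1 rec pf b[of "Pos (Suc k)"] b[of "Pos (Suc (Suc k))"] b[of "Bar (Suc k)"] b[of "Bar (Suc (Suc k))"] True
      by (elim disjE) (auto)
  qed
qed

text \<open>With \<open>K = k + 1\<close>, a flip of the left column \<open>C\<close> affects the left side of the second inequality at \<open>j = K\<close> and the right sides at
  \<open>i = K\<close>. The facts \<open>s1\<close> to \<open>s4\<close> say that the inequalities put at risk are strict. Each proof compares them with
  those at \<open>K - 1\<close> and \<open>K + 1\<close>.\<close>

lemma pair_counts_flip_left:
  assumes C: "column m h C" and D: "column m h' D" and a: "a \<in> {1..h}" and "eps k (C a) \<noteq> 0" "k < m"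
    and pv: "column_pivot k h C (C a)" and pa: "pivot_after k h C (C a) h' D"
    and pc: "pair_counts m h C h' D"
  shows "pair_counts m h (C(a := flip m k (C a))) h' D"
proof -
  obtain dl dh where lh:
    "\<And>j. j \<le> m \<Longrightarrow> low h (C(a := flip m k (C a))) j = low h C j + dl * of_bool (j = Suc k)"
    "\<And>j. j \<le> m \<Longrightarrow> high h (C(a := flip m k (C a))) j = high h C j + dh * of_bool (j = Suc k)"
    and x: "count_shift m k (C a) dl dh"
    by (rule low_high_flip[OF C a assms(4,5)]) blast
  note pf = column_pivot_facts[OF C pv HOL.refl]
  have a1: "occ h C (C a) = 1" using occ_cases[OF C, of "C a"] a by blast
  define K where "K = Suc k"
  have after: "signature_sum k h' D (\<lambda>z. y \<le> z) + signature_sum k h C (\<lambda>z. z < C a) \<le> 0" for y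
    using pa unfolding pivot_after_def by blast
  note after = after[unfolded signature_sum_eq[OF C] signature_sum_eq[OF D], folded K_def]
  note pf = pf[folded K_def]
  note lh = lh[folded K_def] and x = x[unfolded count_shift_def, folded K_def]
  have rec: "low h'' E K = low h'' E k + occ h'' E (Pos K)" "low h'' E (Suc K) = low h'' E K + occ h'' E (Pos (Suc K))"
    "high h'' E K = high h'' E k + occ h'' E (Bar K)" "high h'' E (Suc K) = high h'' E K + occ h'' E (Bar (Suc K))" for h'' E
    unfolding K_def by (rule low_Suc high_Suc)+
  have b: "occ h C x = 0 \<or> occ h C x = 1" "occ h' D x = 0 \<or> occ h' D x = 1" for x
    by (rule occ_0_1[OF C] occ_0_1[OF D])+
  have none: "m = K \<Longrightarrow> occ h' D (Pos (Suc K)) = 0" "m = K \<Longrightarrow> occ h' D (Bar (Suc K)) = 0"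
    using occ_beyond[OF D] by auto
  have K: "K \<le> m" "k < K" "int K = int k + 1" using assms(5) by (auto simp: K_def)
  note I = pair_countsD[OF pc]
  have s1: "low h' D K < low h C K" if "C a = Pos K"
  proof -
    have c: "occ h C (Pos K) = 1" "occ h C (Pos (Suc K)) = 0" using a1 pf that by simp_all
    have "low h' D K \<le> low h C K" "low h' D k \<le> low h C k" using I(1)[of K K] I(1)[of k k] K by simp_all
    moreover have "low h' D K + high h' D K - int K \<le> low h C k + high h' D k - int k"
      using I(1)[of k K] K by simp
    moreover have "low h' D (Suc K) \<le> low h C (Suc K)" if "K \<noteq> m" using I(1)[of "Suc K" "Suc K"] that K by simp
    moreover have "occ h' D (Pos K) - occ h' D (Pos (Suc K)) + occ h' D (Bar (Suc K)) - occ h' D (Bar K) \<le> 0"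
      using after[of "Pos K"] \<open>C a = Pos K\<close> by simp
    ultimately show ?thesis
      using c rec(1,3)[of h' D] rec(2)[of h' D] rec(1,2)[of h C] K(3) b(2)[of "Pos K"] b(2)[of "Pos (Suc K)"]
        b(2)[of "Bar K"] b(2)[of "Bar (Suc K)"] none by smt
  qed
  have s2: "low h' D j + high h' D j - int j < low h C K + high h' D K - int K"
    "low h C j + high h C j - int j - (int h - int h') < low h C K + high h' D K - int K"
    if "C a = Pos K" "K < j" "j \<le> m" for j
  proof -
    have c: "occ h C (Pos K) = 1" "occ h C (Pos (Suc K)) = 0" using a1 pf that by simp_all
    have d: "occ h' D (Bar (Suc K)) \<le> occ h' D (Bar K)"
      using after[of "Bar (Suc K)"] \<open>C a = Pos K\<close> by simp
    have *: "low h C K + high h' D K - int K > X"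
      if "X \<le> low h C k + high h' D k - int k" "X \<le> low h C (Suc K) + high h' D (Suc K) - int (Suc K)" for X
      using that c d rec(1,2)[of h C] rec(3,4)[of h' D] K(3) b(2)[of "Bar K"] b(2)[of "Bar (Suc K)"] by auto
    show "low h' D j + high h' D j - int j < low h C K + high h' D K - int K"
      using I(1)[of k j] I(1)[of "Suc K" j] that K by (intro *) auto
    show "low h C j + high h C j - int j - (int h - int h') < low h C K + high h' D K - int K"
      using I(2)[of k j] I(2)[of "Suc K" j] that K by (intro *) auto
  qed
  have s3: "low h C K + high h C K - int K - (int h - int h') < low h C i + high h' D i - int i"
    if "C a = Pos (Suc K) \<or> C a = Bar (Suc K)" "i < K" "K < m" for i
  proof -
    have "low h C (Suc K) + high h C (Suc K) - int (Suc K) - (int h - int h') \<le> low h C i + high h' D i - int i"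
      "low h C k + high h C k - int k - (int h - int h') \<le> low h C i + high h' D i - int i"
      using I(2)[of i "Suc K"] I(2)[of i k] that K by (auto simp: K_def)
    then show ?thesis using that(1)
      using a1 pf rec[of h C] K(3) b(1)[of "Pos K"] b(1)[of "Pos (Suc K)"] b(1)[of "Bar K"] b(1)[of "Bar (Suc K)"] by auto
  qed
  have s4: "high h C K - (int h - int h') < high h' D K" if "C a = Bar (Suc K)" "K < m"
  proof -
    have c: "occ h C (Bar (Suc K)) = 1" "occ h C (Bar K) = 0" "occ h C (Pos K) \<le> occ h C (Pos (Suc K))"
      using a1 pf that by simp_all
    have "high h C K - (int h - int h') \<le> high h' D K" "high h C k - (int h - int h') \<le> high h' D k"
      "high h C (Suc K) - (int h - int h') \<le> high h' D (Suc K)"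
      using I(2)[of K K] I(2)[of k k] I(2)[of "Suc K" "Suc K"] K that by simp_all
    moreover have "low h C (Suc K) + high h C (Suc K) - int (Suc K) - (int h - int h') \<le> low h C K + high h' D K - int K"
      using I(2)[of K "Suc K"] K that by simp
    moreover have "occ h' D (Bar (Suc K)) - occ h' D (Bar K) + occ h C (Pos K) - occ h C (Pos (Suc K)) \<le> 0"
      using after[of "Bar (Suc K)"] that by simp
    ultimately show ?thesis
      using c rec[of h C] rec(3,4)[of h' D] b(1)[of "Pos K"] b(1)[of "Pos (Suc K)"] b(2)[of "Bar K"] b(2)[of "Bar (Suc K)"] by auto
  qed
  show ?thesis unfolding pair_counts_def
  proof (intro allI impI)
    fix i j :: nat assume ij: "i \<le> j" "j \<le> m"
    note L = lh[OF ij(2)] lh[OF order_trans[OF ij]]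
    consider "i \<noteq> K" "j \<noteq> K" | "i = K" "j = K" | "i = K" "K < j" "j \<noteq> K" | "j = K" "i < K" "i \<noteq> K" using ij by linarith
    then show "low h' D j + high h' D j - int j \<le> low h (C(a := flip m k (C a))) i + high h' D i - int i \<and>
     low h (C(a := flip m k (C a))) j + high h (C(a := flip m k (C a))) j - int j - (int h - int h')
       \<le> low h (C(a := flip m k (C a))) i + high h' D i - int i"
    proof cases
      case 1
      then show ?thesis unfolding L using I[OF ij] by simp
    next
      case 2
      have "C a = Pos K \<Longrightarrow> m = K \<Longrightarrow> high h C K - (int h - int h') < high h' D K"
        using s1 low_plus_high[OF C] low_plus_high[OF D] by simp
      then show ?thesis unfolding L using x I[OF ij] s1 s4 2 by auto
    next
      case 3
      then show ?thesis unfolding L using x I[OF ij] s2[of j] ij by auto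
    next
      case 4
      then show ?thesis unfolding L using x I[OF ij] s3[of i] by auto
    qed
  qed
qed

text \<open>The same for the right column, here \<open>C\<close>, with \<open>B\<close> to its left. Now the left side of the first inequality and the
  summand \<open>M\<^sub>C\<close> of the right sides are affected.\<close>

lemma pair_counts_flip_right:
  assumes B: "column m h' B" and C: "column m h C" and a: "a \<in> {1..h}" and "eps k (C a) \<noteq> 0" "k < m"
    and pv: "column_pivot k h C (C a)" and pb: "pivot_before k h C (C a) h' B"
    and pc: "pair_counts m h' B h C"
  shows "pair_counts m h' B h (C(a := flip m k (C a)))"
proof -
  obtain dl dh where lh:
    "\<And>j. j \<le> m \<Longrightarrow> low h (C(a := flip m k (C a))) j = low h C j + dl * of_bool (j = Suc k)"
    "\<And>j. j \<le> m \<Longrightarrow> high h (C(a := flip m k (C a))) j = high h C j + dh * of_bool (j = Suc k)"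
    and x: "count_shift m k (C a) dl dh"
    by (rule low_high_flip[OF C a assms(4,5)]) blast
  note pf = column_pivot_facts[OF C pv HOL.refl]
  have a1: "occ h C (C a) = 1" using occ_cases[OF C, of "C a"] a by blast
  define K where "K = Suc k"
  have before: "0 \<le> signature_sum k h C (\<lambda>z. C a < z) + signature_sum k h' B (\<lambda>z. z \<le> y)" for y
    using pb unfolding pivot_before_def by blast
  note before = before[unfolded signature_sum_eq[OF C] signature_sum_eq[OF B], folded K_def]
  note pf = pf[folded K_def]
  note lh = lh[folded K_def] and x = x[unfolded count_shift_def, folded K_def]
  have rec: "low h'' E K = low h'' E k + occ h'' E (Pos K)" "low h'' E (Suc K) = low h'' E K + occ h'' E (Pos (Suc K))"
    "high h'' E K = high h'' E k + occ h'' E (Bar K)" "high h'' E (Suc K) = high h'' E K + occ h'' E (Bar (Suc K))" for h'' E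
    unfolding K_def by (rule low_Suc high_Suc)+
  have b: "occ h C x = 0 \<or> occ h C x = 1" "occ h' B x = 0 \<or> occ h' B x = 1" for x
    by (rule occ_0_1[OF C] occ_0_1[OF B])+
  have K: "K \<le> m" "k < K" "int K = int k + 1" using assms(5) by (auto simp: K_def)
  note I = pair_countsD[OF pc]
  have r1: "low h C K < low h' B K" if "C a = Pos (Suc K)" "K < m"
  proof -
    have c: "occ h C (Pos (Suc K)) = 1" "occ h C (Pos K) = 0" "occ h C (Bar K) \<le> occ h C (Bar (Suc K))"
      using a1 pf that by simp_all
    have "low h C K \<le> low h' B K" "low h C k \<le> low h' B k" "low h C (Suc K) \<le> low h' B (Suc K)"
      using I(1)[of K K] I(1)[of k k] I(1)[of "Suc K" "Suc K"] K that by simp_all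
    moreover have "low h C (Suc K) + high h C (Suc K) - int (Suc K) \<le> low h' B K + high h C K - int K"
      using I(1)[of K "Suc K"] K that by simp
    moreover have "occ h' B (Pos K) - occ h' B (Pos (Suc K)) + occ h C (Bar (Suc K)) - occ h C (Bar K) \<ge> 0"
      using before[of "Pos (Suc K)"] that by simp
    ultimately show ?thesis
      using c rec[of h C] rec(1,2)[of h' B] b(1)[of "Bar K"] b(1)[of "Bar (Suc K)"] b(2)[of "Pos K"] b(2)[of "Pos (Suc K)"] by auto
  qed
  have r1': "low h C K < low h' B K" if "C a = Bar K" "m = K"
  proof -
    have none: "occ h C (Pos (Suc K)) = 0" "occ h' B (Pos (Suc K)) = 0" "occ h' B (Bar (Suc K)) = 0"
      using occ_beyond[OF C] occ_beyond[OF B] that(2) by auto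
    have c: "occ h C (Bar K) = 1" "occ h C (Pos K) = 0"
      using a1 pf that none b(1)[of "Pos K"] by auto
    have "low h C K \<le> low h' B K" "low h C k \<le> low h' B k" "high h' B k - (int h' - int h) \<le> high h C k"
      using I(1)[of K K] I(1)[of k k] I(2)[of k k] K by simp_all
    moreover have "occ h' B (Pos K) - occ h' B (Bar K) \<ge> 0"
      using before[of "Bar K"] none that(1) by simp
    moreover have "low h C K + high h C K = int h" "low h' B K + high h' B K = int h'"
      using low_plus_high[OF C] low_plus_high[OF B] that(2) by simp_all
    ultimately show ?thesis
      using c rec(1,3)[of h C] rec(1,3)[of h' B] b(2)[of "Pos K"] b(2)[of "Bar K"] by auto
  qed
  have r2: "low h C j + high h C j - int j < low h' B K + high h C K - int K"
    "low h' B j + high h' B j - int j - (int h' - int h) < low h' B K + high h C K - int K"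
    if "C a = Bar K" "K < j" "j \<le> m" for j
  proof -
    have c: "occ h C (Bar K) = 1" "occ h C (Bar (Suc K)) = 0" using a1 pf that by simp_all
    have d: "occ h' B (Pos (Suc K)) \<le> occ h' B (Pos K)"
      using before[of "Pos (Suc K)"] \<open>C a = Bar K\<close> by simp
    have *: "low h' B K + high h C K - int K > X"
      if "X \<le> low h' B k + high h C k - int k" "X \<le> low h' B (Suc K) + high h C (Suc K) - int (Suc K)" for X
      using that c d rec(3,4)[of h C] rec(1,2)[of h' B] K(3) b(2)[of "Pos K"] b(2)[of "Pos (Suc K)"] by auto
    show "low h C j + high h C j - int j < low h' B K + high h C K - int K"
      using I(1)[of k j] I(1)[of "Suc K" j] that K by (intro *) auto
    show "low h' B j + high h' B j - int j - (int h' - int h) < low h' B K + high h C K - int K"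
      using I(2)[of k j] I(2)[of "Suc K" j] that K by (intro *) auto
  qed
  have r3: "low h C K + high h C K - int K < low h' B i + high h C i - int i"
    if "C a = Pos (Suc K) \<or> C a = Bar (Suc K)" "i < K" "K < m" for i
  proof -
    have "low h C (Suc K) + high h C (Suc K) - int (Suc K) \<le> low h' B i + high h C i - int i"
      "low h C k + high h C k - int k \<le> low h' B i + high h C i - int i"
      using I(1)[of i "Suc K"] I(1)[of i k] that K by (auto simp: K_def)
    then show ?thesis using that(1)
      using a1 pf rec[of h C] K(3) b(1)[of "Pos K"] b(1)[of "Pos (Suc K)"] b(1)[of "Bar K"] b(1)[of "Bar (Suc K)"] by auto
  qed
  have r4: "high h' B K - (int h' - int h) < high h C K" if "C a = Bar K" "K < m"
  proof -
    have c: "occ h C (Bar K) = 1" "occ h C (Bar (Suc K)) = 0" using a1 pf that by simp_all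
    have "high h' B K - (int h' - int h) \<le> high h C K" "high h' B k - (int h' - int h) \<le> high h C k"
      "high h' B (Suc K) - (int h' - int h) \<le> high h C (Suc K)"
      using I(2)[of K K] I(2)[of k k] I(2)[of "Suc K" "Suc K"] K that by simp_all
    moreover have "low h' B K + high h' B K - int K - (int h' - int h) \<le> low h' B k + high h C k - int k"
      using I(2)[of k K] K by simp
    moreover have "occ h' B (Pos K) - occ h' B (Pos (Suc K)) + occ h' B (Bar (Suc K)) - occ h' B (Bar K) \<ge> 0"
      using before[of "Bar K"] that by simp
    ultimately show ?thesis
      using c rec(3,4)[of h C] rec[of h' B] K(3) b(2)[of "Pos K"] b(2)[of "Pos (Suc K)"] b(2)[of "Bar K"] b(2)[of "Bar (Suc K)"] by auto
  qed
  show ?thesis unfolding pair_counts_def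
  proof (intro allI impI)
    fix i j :: nat assume ij: "i \<le> j" "j \<le> m"
    note L = lh[OF ij(2)] lh[OF order_trans[OF ij]]
    consider "i \<noteq> K" "j \<noteq> K" | "i = K" "j = K" | "i = K" "K < j" "j \<noteq> K" | "j = K" "i < K" "i \<noteq> K" using ij by linarith
    then show "low h (C(a := flip m k (C a))) j + high h (C(a := flip m k (C a))) j - int j
       \<le> low h' B i + high h (C(a := flip m k (C a))) i - int i \<and>
     low h' B j + high h' B j - int j - (int h' - int h) \<le> low h' B i + high h (C(a := flip m k (C a))) i - int i"
    proof cases
      case 1
      then show ?thesis unfolding L using I[OF ij] by simp
    next
      case 2
      have "C a = Bar K \<Longrightarrow> m = K \<Longrightarrow> high h' B K - (int h' - int h) < high h C K"
        using r1' low_plus_high[OF C] low_plus_high[OF B] by simp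
      then show ?thesis unfolding L using x I[OF ij] r1 r1' r4 2 by auto
    next
      case 3
      then show ?thesis unfolding L using x I[OF ij] r2[of j] ij by auto
    next
      case 4
      then show ?thesis unfolding L using x I[OF ij] r3[of i] by auto
    qed
  qed
qed

section \<open>Tableaux and their reading words\<close>

lemma part_antimono:
  assumes "is_partition lam" "1 \<le> i" "i \<le> i'"
  shows "part lam i' \<le> part lam i"
  using assms unfolding is_partition_def part_def
  by (cases "i = i'") (auto intro: sorted_wrt_nth_less)

lemma diagram_iff:
  assumes "is_partition lam"
  shows "(i, c) \<in> diagram lam \<longleftrightarrow> 1 \<le> i \<and> i \<le> conj_part lam c"
proof -
  let ?S = "{i. (i, c) \<in> diagram lam}"
  have "finite ?S" by (rule finite_subset[of _ "{..length lam}"]) (auto simp: diagram_def)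
  have down: "i \<in> ?S" if "i' \<in> ?S" "1 \<le> i" "i \<le> i'" for i i'
    using that part_antimono[OF assms that(2,3)] by (auto simp: diagram_def)
  have "?S = {1..card ?S}"
  proof (cases "?S = {}")
    case False
    define M where "M = Max ?S"
    have "M \<in> ?S" using Max_in[OF \<open>finite ?S\<close> False] by (simp add: M_def)
    have "?S = {1..M}"
    proof (intro equalityI subsetI)
      fix i assume "i \<in> ?S"
      then show "i \<in> {1..M}" using Max_ge[OF \<open>finite ?S\<close>] by (auto simp: diagram_def M_def)
    qed (use down[OF \<open>M \<in> ?S\<close>] in auto)
    then show ?thesis by simp
  qed simp
  then have "i \<in> ?S \<longleftrightarrow> i \<in> {1..card ?S}" by simp
  then show ?thesis by (simp add: conj_part_def)
qed

lemma conj_part_antimono: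
  assumes "is_partition lam" "1 \<le> c" "c \<le> c'"
  shows "conj_part lam c' \<le> conj_part lam c"
  unfolding conj_part_def
proof (rule card_mono)
  show "finite {i. (i, c) \<in> diagram lam}" by (rule finite_subset[of _ "{..length lam}"]) (auto simp: diagram_def)
  show "{i. (i, c') \<in> diagram lam} \<subseteq> {i. (i, c) \<in> diagram lam}" using assms by (auto simp: diagram_def)
qed

lemma conj_part_le_length: "conj_part lam c \<le> length lam"
proof -
  have "{i. (i, c) \<in> diagram lam} \<subseteq> {1..length lam}" by (auto simp: diagram_def)
  from card_mono[OF _ this] show ?thesis by (simp add: conj_part_def)
qed

lemma diagram_row_le_first: "is_partition lam \<Longrightarrow> (i, c) \<in> diagram lam \<Longrightarrow> c \<le> part lam 1"
  using part_antimono[of lam 1 i] by (auto simp: diagram_def)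

lemma conj_part_0: "conj_part lam 0 = 0"
  by (simp add: conj_part_def diagram_def)

lemma conj_part_beyond: "is_partition lam \<Longrightarrow> part lam 1 < c \<Longrightarrow> conj_part lam c = 0"
  using diagram_row_le_first[of lam _ c] by (auto simp: conj_part_def card_eq_0_iff)

definition column_of :: "filling \<Rightarrow> nat \<Rightarrow> nat \<Rightarrow> letter" where
  "column_of T c i = T (i, c)"

lemma SP_iff_counts:
  assumes lam: "is_partition lam" and T: "T \<in> diagram lam \<rightarrow>\<^sub>E letters m"
  shows "T \<in> SP m lam \<longleftrightarrow>
    (\<forall>c. column m (conj_part lam c) (column_of T c)) \<and>
    (\<forall>c. \<forall>j\<le>m. low (conj_part lam c) (column_of T c) j + high (conj_part lam c) (column_of T c) j \<le> int j) \<and>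
    (\<forall>c\<ge>1. pair_counts m (conj_part lam c) (column_of T c) (conj_part lam (c + 1)) (column_of T (c + 1)))"
proof -
  let ?h = "conj_part lam"
  note diag = diagram_iff[OF lam]
  have let_T: "column_of T c i \<in> letters m" if "i \<in> {1..?h c}" for i c
    using T that diag unfolding column_of_def by (intro PiE_mem[OF T]) auto
  have semi: "semistandard lam T \<longleftrightarrow>
      (\<forall>c. column m (?h c) (column_of T c)) \<and> (\<forall>c\<ge>1. rows_increase (?h (c + 1)) (column_of T c) (column_of T (c + 1)))"
  proof
    assume s: "semistandard lam T"
    have "rows_increase (?h (c + 1)) (column_of T c) (column_of T (c + 1))" if "c \<ge> 1" for c
      unfolding rows_increase_def
    proof
      fix i assume "i \<in> {1..?h (c + 1)}"
      then have "(i, c) \<in> diagram lam" "(i, c + 1) \<in> diagram lam"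
        using conj_part_antimono[OF lam that, of "c + 1"] by (auto simp: diag)
      then show "column_of T c i \<le> column_of T (c + 1) i"
        using s unfolding semistandard_def column_of_def by (metis less_add_one)
    qed
    moreover have "column m (?h c) (column_of T c)" for c
      using s let_T unfolding column_def semistandard_def diag column_of_def by auto
    ultimately show "(\<forall>c. column m (?h c) (column_of T c)) \<and> (\<forall>c\<ge>1. rows_increase (?h (c + 1)) (column_of T c) (column_of T (c + 1)))"
      by blast
  next
    assume s: "(\<forall>c. column m (?h c) (column_of T c)) \<and> (\<forall>c\<ge>1. rows_increase (?h (c + 1)) (column_of T c) (column_of T (c + 1)))"
    have "T (i, c) \<le> T (i, c')" if "c < c'" "(i, c) \<in> diagram lam" "(i, c') \<in> diagram lam" for i c c'
      using less_imp_le[OF that(1)] that(3)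
    proof (induction c' rule: dec_induct)
      case (step n)
      have "1 \<le> c" using that by (auto simp: diagram_def)
      then have "(i, n) \<in> diagram lam" using step by (auto simp: diagram_def)
      moreover have "T (i, n) \<le> T (i, Suc n)"
        using s \<open>1 \<le> c\<close> step unfolding rows_increase_def column_of_def by (auto simp: diag)
      ultimately show ?case using step.IH by (auto intro: order_trans)
    qed simp
    moreover have "T (i, c) < T (i', c)" if "i < i'" "(i, c) \<in> diagram lam" "(i', c) \<in> diagram lam" for i i' c
      using s that unfolding column_def column_of_def by (auto simp: diag)
    ultimately show "semistandard lam T" unfolding semistandard_def by blast
  qed
  have colc: "column_condition lam T \<longleftrightarrow> (\<forall>c. admissible (?h c) (column_of T c))"
    unfolding column_condition_def admissible_def entry_at_def diag column_of_def by auto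
  have adj: "adjacent_condition m lam T \<longleftrightarrow>
      (\<forall>c\<ge>1. pair_admissible m (?h c) (column_of T c) (?h (c + 1)) (column_of T (c + 1)))"
  proof -
    have "adjacent_condition m lam T \<longleftrightarrow> (\<forall>c. pair_admissible m (?h c) (column_of T c) (?h (c + 1)) (column_of T (c + 1)))"
      unfolding adjacent_condition_def pair_admissible_def entry_at_def diag column_of_def atLeastAtMost_iff conj_assoc ..
    moreover have "pair_admissible m (?h 0) C h' D" for C h' D
      unfolding pair_admissible_def conj_part_0 by simp
    ultimately show ?thesis by (metis One_nat_def Suc_leI neq0_conv)
  qed
  show ?thesis
  proof (cases "\<forall>c. column m (?h c) (column_of T c)")
    case True
    have pc: "rows_increase (?h (c + 1)) (column_of T c) (column_of T (c + 1)) \<and>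
        pair_admissible m (?h c) (column_of T c) (?h (c + 1)) (column_of T (c + 1)) \<longleftrightarrow>
        pair_counts m (?h c) (column_of T c) (?h (c + 1)) (column_of T (c + 1))" if "c \<ge> 1" for c
      using conj_part_antimono[OF lam that, of "c + 1"] True by (intro pair_counts_iff) auto
    have "T \<in> SP m lam \<longleftrightarrow> semistandard lam T \<and> column_condition lam T \<and> adjacent_condition m lam T"
      using T by (simp add: SP_def)
    moreover have "(\<forall>c. admissible (?h c) (column_of T c)) \<longleftrightarrow>
        (\<forall>c. \<forall>j\<le>m. low (?h c) (column_of T c) j + high (?h c) (column_of T c) j \<le> int j)"
      using True by (intro all_cong1 admissible_iff) blast
    moreover have "(\<forall>c\<ge>1. rows_increase (?h (c + 1)) (column_of T c) (column_of T (c + 1))) \<and>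
        (\<forall>c\<ge>1. pair_admissible m (?h c) (column_of T c) (?h (c + 1)) (column_of T (c + 1))) \<longleftrightarrow>
        (\<forall>c\<ge>1. pair_counts m (?h c) (column_of T c) (?h (c + 1)) (column_of T (c + 1)))"
      using pc by blast
    ultimately show ?thesis using True unfolding semi colc adj by argo
  next
    case False
    moreover have "T \<in> SP m lam \<Longrightarrow> semistandard lam T" by (simp add: SP_def)
    ultimately show ?thesis using semi by blast
  qed
qed

definition boxes_of_column :: "nat list \<Rightarrow> nat \<Rightarrow> (nat \<times> nat) list" where
  "boxes_of_column lam c = map (\<lambda>i. (i, c)) [1..<conj_part lam c + 1]"

definition boxes :: "nat list \<Rightarrow> (nat \<times> nat) list" where
  "boxes lam = concat (map (boxes_of_column lam) (rev [1..<part lam 1 + 1]))"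

definition reading :: "nat list \<Rightarrow> filling \<Rightarrow> letter list" where
  "reading lam T = map T (boxes lam)"

lemma set_boxes:
  assumes "is_partition lam"
  shows "set (boxes lam) = diagram lam"
proof -
  have "(i, c) \<in> set (boxes lam) \<longleftrightarrow> (1 \<le> c \<and> c \<le> part lam 1) \<and> 1 \<le> i \<and> i \<le> conj_part lam c" for i c
  proof -
    have "set (boxes lam) = (\<Union>c\<in>{1..part lam 1}. (\<lambda>i. (i, c)) ` {1..conj_part lam c})"
      by (simp add: boxes_def boxes_of_column_def atLeastLessThanSuc_atLeastAtMost del: upt_Suc)
    then show ?thesis by force
  qed
  moreover have "1 \<le> c \<and> c \<le> part lam 1" if "(i, c) \<in> diagram lam" for i c
    using diagram_row_le_first[OF assms that] that by (auto simp: diagram_def)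
  ultimately have "b \<in> set (boxes lam) \<longleftrightarrow> b \<in> diagram lam" for b
    using diagram_iff[OF assms] by (cases b) blast
  then show ?thesis by blast
qed

lemma distinct_boxes: "distinct (boxes lam)"
  unfolding boxes_def
proof (rule distinct_concat)
  show "distinct (map (boxes_of_column lam) (rev [1..<part lam 1 + 1]))"
  proof -
    have "1 \<le> conj_part lam c" if "c \<in> {1..part lam 1}" for c
    proof -
      have "(1, c) \<in> diagram lam" using that by (auto simp: diagram_def part_def split: if_splits)
      moreover have "finite {i. (i, c) \<in> diagram lam}"
        by (rule finite_subset[of _ "{..length lam}"]) (auto simp: diagram_def)
      ultimately have "{i. (i, c) \<in> diagram lam} \<noteq> {}" "finite {i. (i, c) \<in> diagram lam}" by blast+
      then have "0 < card {i. (i, c) \<in> diagram lam}" unfolding card_gt_0_iff by blast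
      then show ?thesis by (simp add: conj_part_def)
    qed
    then have "(1, c) \<in> set (boxes_of_column lam c)" if "c \<in> {1..part lam 1}" for c
      using that by (force simp: boxes_of_column_def simp del: upt_Suc)
    moreover have "c' = c" if "(1, c) \<in> set (boxes_of_column lam c')" for c c'
      using that by (auto simp: boxes_of_column_def)
    ultimately have "inj_on (boxes_of_column lam) {1..part lam 1}"
      by (intro inj_onI) (simp only:)
    then show ?thesis by (simp add: distinct_map atLeastLessThanSuc_atLeastAtMost del: upt_Suc)
  qed
qed (auto simp: boxes_of_column_def distinct_map inj_on_def)

lemma distinct_split_unique:
  assumes "distinct xs" "xs = u @ b # v" "xs = u' @ b # v'"
  shows "u = u' \<and> v = v'"
proof -
  have "b \<notin> set u" "b \<notin> set v" using assms(1) unfolding assms(2) by simp_all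
  then show ?thesis using append_Cons_eq_iff[of b u v u' v'] assms(2,3) by simp
qed

lemma upt_split: "l \<le> a \<Longrightarrow> a < r \<Longrightarrow> [l..<r] = [l..<a] @ a # [a + 1..<r]"
  using upt_add_eq_append[of l a "r - a"] by (simp add: upt_conv_Cons)

text \<open>The columns to the right of column \<open>c\<close> that are not adjacent to it are collected in \<open>U\<close>. Missing neighbours are
  covered because columns beyond the first row, and column \<open>0\<close>, have length \<open>0\<close>.\<close>

lemma boxes_around:
  assumes lam: "is_partition lam" and "(a, c) \<in> diagram lam"
  obtains U V where "\<forall>b\<in>set U. c < snd b" "boxes lam = (U @ boxes_of_column lam (c + 1) @ map (\<lambda>i. (i, c)) [1..<a]) @ (a, c) #
      (map (\<lambda>i. (i, c)) [a + 1..<conj_part lam c + 1] @ boxes_of_column lam (c - 1) @ V)"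
proof -
  let ?n = "part lam 1"
  have c: "1 \<le> c" "c \<le> ?n" using assms diagram_row_le_first by (auto simp: diagram_def)
  have a: "1 \<le> a" "a \<le> conj_part lam c" using assms by (auto simp: diagram_iff)
  have split: "[1..<?n + 1] = [1..<c] @ c # [c + 1..<?n + 1]"
    using c by (intro upt_split) auto
  have column_of: "boxes_of_column lam c = map (\<lambda>i. (i, c)) [1..<a] @ (a, c) # map (\<lambda>i. (i, c)) [a + 1..<conj_part lam c + 1]"
  proof -
    have "[1..<conj_part lam c + 1] = [1..<a] @ a # [a + 1..<conj_part lam c + 1]"
      using a by (intro upt_split) auto
    then show ?thesis by (simp add: boxes_of_column_def)
  qed
  have "\<exists>U. concat (map (boxes_of_column lam) (rev [c + 1..<?n + 1])) = U @ boxes_of_column lam (c + 1)"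
  proof (cases "c = ?n")
    case True
    then show ?thesis using conj_part_beyond[OF lam, of "c + 1"] by (simp add: boxes_of_column_def)
  next
    case False
    then have "[c + 1..<?n + 1] = (c + 1) # [c + 2..<?n + 1]" using c by (simp add: upt_conv_Cons)
    then show ?thesis by simp
  qed
  then obtain U where U: "concat (map (boxes_of_column lam) (rev [c + 1..<?n + 1])) = U @ boxes_of_column lam (c + 1)" by blast
  have "\<exists>V. concat (map (boxes_of_column lam) (rev [1..<c])) = boxes_of_column lam (c - 1) @ V"
  proof (cases "c = 1")
    case True
    then show ?thesis by (simp add: boxes_of_column_def conj_part_0)
  next
    case False
    then have "[1..<c] = [1..<c - 1] @ [c - 1]" using c upt_split[of 1 "c - 1" c] by simp
    then show ?thesis by simp
  qed
  then obtain V where V: "concat (map (boxes_of_column lam) (rev [1..<c])) = boxes_of_column lam (c - 1) @ V" by blast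
  have "\<forall>b\<in>set (concat (map (boxes_of_column lam) (rev [c + 1..<?n + 1]))). c < snd b"
    by (auto simp: boxes_of_column_def)
  then have above: "\<forall>b\<in>set U. c < snd b" unfolding U by simp
  have "boxes lam = concat (map (boxes_of_column lam) (rev [c + 1..<?n + 1])) @ boxes_of_column lam c
      @ concat (map (boxes_of_column lam) (rev [1..<c]))"
    unfolding boxes_def split by simp
  then show thesis unfolding U V column_of using above by (intro that[of U V]) simp_all
qed

definition segment :: "(nat \<Rightarrow> letter) \<Rightarrow> nat \<Rightarrow> nat \<Rightarrow> letter list" where
  "segment C l r = map C [l..<r]"

lemma height_segment: "height k (segment C l r) = (\<Sum>i\<in>{l..<r}. eps k (C i))"
  unfolding height_def segment_def by (simp add: interv_sum_list_conv_sum_set_nat o_def)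

lemma segment_split: "l \<le> a \<Longrightarrow> a \<le> r \<Longrightarrow> segment C l r = segment C l a @ segment C a r"
  unfolding segment_def using upt_add_eq_append[of l a "r - a"] by simp

lemma signature_sum_segment:
  assumes "\<And>i. 1 \<le> i \<Longrightarrow> i \<le> h \<Longrightarrow> Q (C i) \<longleftrightarrow> l \<le> i \<and> i < r" "1 \<le> l" "r \<le> h + 1"
  shows "signature_sum k h C Q = height k (segment C l r)"
proof -
  have "{i. i \<in> {1..h} \<and> Q (C i)} = {l..<r}" using assms by auto
  then show ?thesis by (simp add: signature_sum_def height_segment)
qed

lemma upset_threshold:
  fixes h :: nat
  assumes "\<And>i i'. 1 \<le> i \<Longrightarrow> i \<le> i' \<Longrightarrow> i' \<le> h \<Longrightarrow> P i \<Longrightarrow> P i'"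
  obtains l where "1 \<le> l" "l \<le> h + 1" "\<And>i. 1 \<le> i \<Longrightarrow> i \<le> h \<Longrightarrow> P i \<longleftrightarrow> l \<le> i"
proof -
  define l where "l = (LEAST i. 1 \<le> i \<and> (i = h + 1 \<or> P i))"
  have ex: "1 \<le> h + 1 \<and> (h + 1 = h + 1 \<or> P (h + 1))" by simp
  have l: "1 \<le> l \<and> (l = h + 1 \<or> P l)" unfolding l_def by (rule LeastI[of "\<lambda>i. 1 \<le> i \<and> (i = h + 1 \<or> P i)", OF ex])
  have le: "l \<le> i" if "1 \<le> i" "P i" for i unfolding l_def by (rule Least_le) (use that in simp)
  have "l \<le> h + 1" unfolding l_def by (rule Least_le) simp
  moreover have "P i \<longleftrightarrow> l \<le> i" if "1 \<le> i" "i \<le> h" for i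
    using le[OF that(1)] l assms[of l i] that by auto
  ultimately show thesis using that[of l] l by blast
qed

text \<open>The rows singled out by a lower bound on the letters are the rows from some \<open>l\<close> on. This translates sums over
  letters into heights of factors of the word.\<close>

lemma column_threshold:
  assumes "column m h C"
  obtains l where "1 \<le> l" "l \<le> h + 1" "\<And>i. 1 \<le> i \<Longrightarrow> i \<le> h \<Longrightarrow> y \<le> C i \<longleftrightarrow> l \<le> i"
proof (rule upset_threshold[of h "\<lambda>i. y \<le> C i"])
  show "y \<le> C i'" if "1 \<le> i" "i \<le> i'" "i' \<le> h" "y \<le> C i" for i i'
    using column_le_iff[OF assms, of i i'] that by (auto intro: order_trans)
qed (use that in blast)

lemma column_threshold_less:
  assumes "column m h C"
  obtains l where "1 \<le> l" "l \<le> h + 1" "\<And>i. 1 \<le> i \<Longrightarrow> i \<le> h \<Longrightarrow> C i \<le> y \<longleftrightarrow> i < l"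
proof (rule upset_threshold[of h "\<lambda>i. y < C i"])
  show "y < C i'" if "1 \<le> i" "i \<le> i'" "i' \<le> h" "y < C i" for i i'
    using column_le_iff[OF assms, of i i'] that by (auto intro: order.strict_trans2)
next
  fix l assume "1 \<le> l" "l \<le> h + 1" "\<And>i. 1 \<le> i \<Longrightarrow> i \<le> h \<Longrightarrow> (y < C i) = (l \<le> i)"
  then show thesis by (intro that[of l]) (auto simp: not_less[symmetric])
qed

text \<open>The pivot condition of the whole word, restricted to factors inside three adjacent columns.\<close>

lemma pivot_columns:
  assumes C: "column m h C" and D: "column m h' D" and B: "column m h'' B" and a: "1 \<le> a" "a \<le> h"
    and pv: "pivot k (U @ segment D 1 (h' + 1) @ segment C 1 a) (segment C (a + 1) (h + 1) @ segment B 1 (h'' + 1) @ V)"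
  shows "column_pivot k h C (C a)" "pivot_after k h C (C a) h' D" "pivot_before k h C (C a) h'' B"
proof -
  have lt: "C i < C a \<longleftrightarrow> i < a" "C a < C i \<longleftrightarrow> a < i" "C i \<le> C a \<longleftrightarrow> i \<le> a" "C a \<le> C i \<longleftrightarrow> a \<le> i"
    if "1 \<le> i" "i \<le> h" for i
    using column_less_iff[OF C, of i a] column_less_iff[OF C, of a i] column_le_iff[OF C, of i a]
      column_le_iff[OF C, of a i] that a by auto
  show "column_pivot k h C (C a)" unfolding column_pivot_def
  proof (intro allI conjI)
    fix y
    obtain l where l: "1 \<le> l" "l \<le> h + 1" "\<And>i. 1 \<le> i \<Longrightarrow> i \<le> h \<Longrightarrow> y \<le> C i \<longleftrightarrow> l \<le> i"
      using column_threshold[OF C, of y] by blast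
    have "signature_sum k h C (\<lambda>z. y \<le> z \<and> z < C a) = height k (segment C l a)"
      using l lt a by (intro signature_sum_segment) auto
    also have "\<dots> \<le> 0"
    proof (cases "l \<le> a")
      case True
      then show ?thesis
        using pivotD1[of k "U @ segment D 1 (h' + 1) @ segment C 1 l" "segment C l a"] pv segment_split[OF l(1) True, of C]
        by simp
    qed (simp add: height_segment)
    finally show "signature_sum k h C (\<lambda>z. y \<le> z \<and> z < C a) \<le> 0" .
    obtain l where l: "1 \<le> l" "l \<le> h + 1" "\<And>i. 1 \<le> i \<Longrightarrow> i \<le> h \<Longrightarrow> C i \<le> y \<longleftrightarrow> i < l"
      using column_threshold_less[OF C, of y] by blast
    have "signature_sum k h C (\<lambda>z. C a < z \<and> z \<le> y) = height k (segment C (a + 1) l)"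
      using l lt a by (intro signature_sum_segment) auto
    also have "0 \<le> \<dots>"
    proof (cases "a + 1 \<le> l")
      case True
      then show ?thesis
        using pivotD2[of k _ "segment C (a + 1) l" "segment C l (h + 1) @ segment B 1 (h'' + 1) @ V"] pv
          segment_split[OF True l(2), of C] by simp
    qed (simp add: height_segment)
    finally show "0 \<le> signature_sum k h C (\<lambda>z. C a < z \<and> z \<le> y)" .
  qed
  show "pivot_after k h C (C a) h' D" unfolding pivot_after_def
  proof
    fix y
    obtain l where l: "1 \<le> l" "l \<le> h' + 1" "\<And>i. 1 \<le> i \<Longrightarrow> i \<le> h' \<Longrightarrow> y \<le> D i \<longleftrightarrow> l \<le> i"
      using column_threshold[OF D, of y] by blast
    have "signature_sum k h' D (\<lambda>z. y \<le> z) = height k (segment D l (h' + 1))"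
      using l by (intro signature_sum_segment) auto
    moreover have "signature_sum k h C (\<lambda>z. z < C a) = height k (segment C 1 a)"
      using lt a by (intro signature_sum_segment) auto
    moreover have "height k (segment D l (h' + 1) @ segment C 1 a) \<le> 0"
      using pivotD1[of k "U @ segment D 1 l" "segment D l (h' + 1) @ segment C 1 a"] pv
        segment_split[OF l(1,2), of D] by simp
    ultimately show "signature_sum k h' D (\<lambda>z. y \<le> z) + signature_sum k h C (\<lambda>z. z < C a) \<le> 0" by simp
  qed
  show "pivot_before k h C (C a) h'' B" unfolding pivot_before_def
  proof
    fix y
    obtain l where l: "1 \<le> l" "l \<le> h'' + 1" "\<And>i. 1 \<le> i \<Longrightarrow> i \<le> h'' \<Longrightarrow> B i \<le> y \<longleftrightarrow> i < l"
      using column_threshold_less[OF B, of y] by blast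
    have "signature_sum k h'' B (\<lambda>z. z \<le> y) = height k (segment B 1 l)"
      using l by (intro signature_sum_segment) auto
    moreover have "signature_sum k h C (\<lambda>z. C a < z) = height k (segment C (a + 1) (h + 1))"
      using lt a by (intro signature_sum_segment) auto
    moreover have "0 \<le> height k (segment C (a + 1) (h + 1) @ segment B 1 l)"
      using pivotD2[of k _ "segment C (a + 1) (h + 1) @ segment B 1 l" "segment B l (h'' + 1) @ V"] pv
        segment_split[OF l(1,2), of B] by simp
    ultimately show "0 \<le> signature_sum k h C (\<lambda>z. C a < z) + signature_sum k h'' B (\<lambda>z. z \<le> y)" by simp
  qed
qed

lemma SP_flip:
  assumes lam: "is_partition lam" and TSP: "T \<in> SP m lam" and k: "k < m"
    and b: "boxes lam = b1 @ b # b2" and pv: "pivot k (map T b1) (map T b2)" and e: "eps k (T b) \<noteq> 0"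
  shows "T(b := flip m k (T b)) \<in> SP m lam"
proof -
  let ?h = "conj_part lam"
  obtain a c where ac: "b = (a, c)" by (cases b)
  have "b \<in> set (boxes lam)" by (simp add: b)
  then have bd: "(a, c) \<in> diagram lam" using set_boxes[OF lam] ac by simp
  then have a: "1 \<le> a" "a \<le> ?h c" using diagram_iff[OF lam] by auto
  have c: "1 \<le> c" using bd by (auto simp: diagram_def)
  obtain U V where UV: "boxes lam = (U @ boxes_of_column lam (c + 1) @ map (\<lambda>i. (i, c)) [1..<a]) @ (a, c) #
      (map (\<lambda>i. (i, c)) [a + 1..<?h c + 1] @ boxes_of_column lam (c - 1) @ V)"
    by (rule boxes_around[OF lam bd])
  have "b1 = U @ boxes_of_column lam (c + 1) @ map (\<lambda>i. (i, c)) [1..<a] \<and>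
    b2 = map (\<lambda>i. (i, c)) [a + 1..<?h c + 1] @ boxes_of_column lam (c - 1) @ V"
    by (rule distinct_split_unique[OF distinct_boxes b[unfolded ac] UV])
  moreover have "map T (map (\<lambda>i. (i, c')) [l..<r]) = segment (column_of T c') l r" for c' l r
    by (simp add: segment_def column_of_def o_def del: upt_Suc)
  ultimately have pv': "pivot k (map T U @ segment (column_of T (c + 1)) 1 (?h (c + 1) + 1) @ segment (column_of T c) 1 a)
      (segment (column_of T c) (a + 1) (?h c + 1) @ segment (column_of T (c - 1)) 1 (?h (c - 1) + 1) @ map T V)"
    using pv by (simp add: boxes_of_column_def del: upt_Suc)
  have TP: "T \<in> diagram lam \<rightarrow>\<^sub>E letters m" using TSP by (simp add: SP_def)
  from TSP have columns: "\<And>c. column m (?h c) (column_of T c)"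
    and adm: "\<And>c. \<forall>j\<le>m. low (?h c) (column_of T c) j + high (?h c) (column_of T c) j \<le> int j"
    and pairs: "\<And>c. c \<ge> 1 \<Longrightarrow> pair_counts m (?h c) (column_of T c) (?h (c + 1)) (column_of T (c + 1))"
    unfolding SP_iff_counts[OF lam TP] by blast+
  note local_pivot = pivot_columns[OF columns columns columns a pv']
  have Tb: "T b = column_of T c a" by (simp add: ac column_of_def)
  let ?T' = "T(b := flip m k (T b))"
  have aset: "a \<in> {1..?h c}" using a by simp
  have e': "eps k (column_of T c a) \<noteq> 0" using e Tb by simp
  have x: "column_of T c a \<in> letters m" by (rule column_letters[OF columns aset])
  have upd: "column_of ?T' c = (column_of T c)(a := flip m k (column_of T c a))"
    by (auto simp: column_of_def ac)
  have same: "column_of ?T' c' = column_of T c'" if "c' \<noteq> c" for c'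
    using that by (auto simp: column_of_def ac)
  have "column m (?h c) (column_of ?T' c)"
    unfolding upd by (rule flip_column[OF columns aset e' k occ_flip[OF columns x e' k local_pivot(1)]])
  then have 1: "column m (?h c') (column_of ?T' c')" for c'
    using same columns by (cases "c' = c") auto
  have "low (?h c) (column_of ?T' c) j + high (?h c) (column_of ?T' c) j \<le> int j" if "j \<le> m" for j
    unfolding upd by (rule column_counts_flip[OF columns aset e' k local_pivot(1) adm that])
  then have 2: "\<forall>j\<le>m. low (?h c') (column_of ?T' c') j + high (?h c') (column_of ?T' c') j \<le> int j" for c'
    using same adm by (cases "c' = c") auto
  have 3: "pair_counts m (?h c') (column_of ?T' c') (?h (c' + 1)) (column_of ?T' (c' + 1))" if "c' \<ge> 1" for c'
  proof -
    consider "c' = c" | "c' + 1 = c" | "c' \<noteq> c" "c' + 1 \<noteq> c" by blast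
    then show ?thesis
    proof cases
      case 1
      then show ?thesis
        using pair_counts_flip_left[OF columns columns aset e' k local_pivot(1,2) pairs[OF c]] same[of "c + 1"] upd by simp
    next
      case 2
      then have "c' = c - 1" by simp
      then show ?thesis
        using pair_counts_flip_right[OF columns columns aset e' k local_pivot(1,3)] pairs[OF that] same[of c'] upd 2 by simp
    next
      case 3
      then show ?thesis using pairs[OF that] same by simp
    qed
  qed
  have "flip m k (T b) \<in> letters m" using flip_letters[OF k x] Tb by simp
  then have T': "?T' \<in> diagram lam \<rightarrow>\<^sub>E letters m"
    using TP bd ac by (auto simp: PiE_iff extensional_def)
  show ?thesis unfolding SP_iff_counts[OF lam T'] using 1 2 3 by blast
qed

lemma reading_inj: "is_partition lam \<Longrightarrow> inj_on (reading lam) (SP m lam)"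
proof (rule inj_onI)
  fix T T' assume lam: "is_partition lam" and TT: "T \<in> SP m lam" "T' \<in> SP m lam" "reading lam T = reading lam T'"
  then have "T \<in> diagram lam \<rightarrow>\<^sub>E letters m" "T' \<in> diagram lam \<rightarrow>\<^sub>E letters m" by (simp_all add: SP_def)
  moreover have "T b = T' b" if "b \<in> diagram lam" for b
    using TT(3) that by (simp add: reading_def set_boxes[OF lam, symmetric])
  ultimately show "T = T'" by (rule PiE_ext)
qed

lemma reading_letters: "is_partition lam \<Longrightarrow> T \<in> SP m lam \<Longrightarrow> set (reading lam T) \<subseteq> letters m"
  unfolding reading_def SP_def by (auto simp: set_boxes)

lemma flip_closed_readings:
  assumes lam: "is_partition lam" and k: "k < m"
  shows "flip_closed m k (reading lam ` SP m lam)"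
  unfolding flip_closed_def
proof (intro allI impI)
  fix u x v assume "u @ x # v \<in> reading lam ` SP m lam" and pv: "pivot k u v" and e: "eps k x \<noteq> 0"
  then obtain T where T: "T \<in> SP m lam" "map T (boxes lam) = u @ x # v" by (auto simp: reading_def)
  then obtain b1 b b2 where b: "boxes lam = b1 @ b # b2" "u = map T b1" "x = T b" "v = map T b2"
    by (auto simp: map_eq_append_conv map_eq_Cons_conv)
  have "b \<notin> set b1" "b \<notin> set b2" using distinct_boxes[of lam] by (auto simp: b(1))
  then have "reading lam (T(b := flip m k (T b))) = u @ flip m k x # v"
    by (simp add: reading_def b(1)) (simp add: b)
  moreover have "T(b := flip m k (T b)) \<in> SP m lam"
    using SP_flip[OF lam T(1) k b(1)] pv e b by simp
  ultimately show "u @ flip m k x # v \<in> reading lam ` SP m lam" by (metis imageI)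
qed

section \<open>The highest weight tableau\<close>

definition row_filling :: "nat list \<Rightarrow> filling" where
  "row_filling lam = restrict (\<lambda>(i, c). Pos i) (diagram lam)"

lemma row_filling_SP:
  assumes lam: "is_partition lam" and "length lam \<le> m"
  shows "row_filling lam \<in> SP m lam"
proof -
  have row: "row_filling lam (i, c) = Pos i" if "(i, c) \<in> diagram lam" for i c
    using that by (simp add: row_filling_def)
  have "row_filling lam \<in> diagram lam \<rightarrow>\<^sub>E letters m"
    using assms(2) by (auto simp: row_filling_def letters_def diagram_def)
  moreover have no_bar: "\<not> entry_at lam (row_filling lam) i j (Bar l)" for i j l
    using row[of i j] by (auto simp: entry_at_def)
  moreover have "semistandard lam (row_filling lam)"
    unfolding semistandard_def using row by simp
  moreover have "column_condition lam (row_filling lam)" "adjacent_condition m lam (row_filling lam)"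
    unfolding column_condition_def adjacent_condition_def using no_bar by blast+
  ultimately show ?thesis by (simp add: SP_def)
qed

lemma highest_append: 
  assumes "highest m u" "highest m v"
  shows "highest m (u @ v)"
  unfolding highest_def
proof (intro allI impI)
  fix a b k assume "u @ v = a @ b" "k < m"
  then consider s where "u = a @ s" | s where "a = u @ s" "v = s @ b" by (auto simp: append_eq_append_conv2)
  then show "0 \<le> height k a"
  proof cases
    case 1
    then show ?thesis using assms(1) \<open>k < m\<close> unfolding highest_def by blast
  next
    case 2
    then have "0 \<le> height k s" using assms(2) \<open>k < m\<close> unfolding highest_def by blast
    moreover have "0 \<le> height k u" using assms(1) \<open>k < m\<close> unfolding highest_def by blast
    ultimately show ?thesis using 2 by simp
  qed
qed

lemma highest_initial_column: "highest m (map Pos [1..<n])"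
  unfolding highest_def
proof (intro allI impI)
  fix u v k assume eq: "map Pos [1..<n] = u @ v"
  have len: "length u \<le> n - 1" using arg_cong[OF eq, of length] by simp
  have "u = map Pos (take (length u) [1..<n])" using arg_cong[OF eq, of "take (length u)"] by (simp add: take_map)
  also have "take (length u) [1..<n] = [1..<1 + length u]"
  proof (cases "n = 0")
    case False
    then show ?thesis using len by (intro take_upt) auto
  qed (use len in simp)
  finally obtain j where u: "u = map Pos [1..<j]" by blast
  have "height k (map Pos [1..<j]) = (if Suc k < j then 1 else 0) - (if Suc (Suc k) < j then 1 else 0)"
    by (induction j) (auto simp: eps_eq)
  then show "0 \<le> height k u" using u by simp
qed

lemma highest_row_filling:
  assumes lam: "is_partition lam"
  shows "highest m (reading lam (row_filling lam))"
proof -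
  have "reading lam (row_filling lam) = concat (map (\<lambda>c. map Pos [1..<conj_part lam c + 1]) (rev [1..<part lam 1 + 1]))"
    unfolding reading_def boxes_def map_concat map_map
    by (intro arg_cong[of _ _ concat] map_cong) (auto simp: boxes_of_column_def row_filling_def diagram_iff[OF lam] simp del: upt_Suc)
  also have "highest m \<dots>"
  proof -
    have "highest m (concat (map (\<lambda>c. map Pos [1..<conj_part lam c + 1]) cs))" for cs :: "nat list"
    proof (induction cs)
      case (Cons c cs)
      show ?case unfolding list.map concat.simps by (intro highest_append highest_initial_column Cons.IH)
    qed (simp add: highest_def)
    then show ?thesis by blast
  qed
  finally show ?thesis .
qed

text \<open>By induction along the reading order, when all boxes read before \<open>(a, c)\<close> carry their row number. If there is a
  box to the right, row and column monotonicity leave only \<open>a\<close>. Otherwise all boxes read before lie in rows above \<open>a\<close>, so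
  a letter beyond \<open>a\<close>, or a barred letter at or beyond \<open>a\<close>, makes a height negative; a barred letter \<open>i < a\<close> meets \<open>i\<close> in row \<open>i\<close> of
  its column, against the column condition.\<close>

lemma highest_unique:
  assumes lam: "is_partition lam" and T: "T \<in> SP m lam" and hi: "highest m (reading lam T)"
  shows "T = row_filling lam"
proof -
  have TP: "T \<in> diagram lam \<rightarrow>\<^sub>E letters m" using T by (simp add: SP_def)
  have semi: "semistandard lam T" and colc: "column_condition lam T" using T by (simp_all add: SP_def)
  have step: "T b = Pos (fst b)"
    if b: "boxes lam = b1 @ b # b2" and before: "\<forall>b'\<in>set b1. T b' = Pos (fst b')" for b1 b b2
  proof -
    obtain a c where ac: "b = (a, c)" by (cases b)
    have "b \<in> set (boxes lam)" by (simp add: b)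
    then have bd: "(a, c) \<in> diagram lam" using set_boxes[OF lam] ac by simp
    then have a: "1 \<le> a" "a \<le> conj_part lam c" using diagram_iff[OF lam] by auto
    obtain U V where U: "\<forall>b\<in>set U. c < snd b"
      and UV: "boxes lam = (U @ boxes_of_column lam (c + 1) @ map (\<lambda>i. (i, c)) [1..<a]) @ (a, c) #
        (map (\<lambda>i. (i, c)) [a + 1..<conj_part lam c + 1] @ boxes_of_column lam (c - 1) @ V)"
      by (rule boxes_around[OF lam bd])
    have b1: "b1 = U @ boxes_of_column lam (c + 1) @ map (\<lambda>i. (i, c)) [1..<a]"
      using distinct_split_unique[OF distinct_boxes b[unfolded ac] UV] by blast
    have above: "T (i, c) = Pos i" if "1 \<le> i" "i < a" for i
      using before that by (auto simp: b1)
    have x: "T (a, c) \<in> letters m" using TP bd by auto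
    have ge: "Pos a \<le> T (a, c)"
    proof (cases "a = 1")
      case True
      then show ?thesis using x by (cases "T (a, c)") (auto simp: letters_def)
    next
      case False
      then have "(a - 1, c) \<in> diagram lam" using a by (auto simp: diagram_iff[OF lam])
      then have "T (a - 1, c) < T (a, c)" using semi bd False a unfolding semistandard_def by auto
      then show ?thesis using above[of "a - 1"] False a by (cases "T (a, c)") auto
    qed
    show ?thesis
    proof (cases "(a, c + 1) \<in> diagram lam")
      case True
      then have "(a, c + 1) \<in> set b1" using a by (auto simp: b1 boxes_of_column_def diagram_iff[OF lam] simp del: upt_Suc)
      then have "T (a, c + 1) = Pos a" using before by auto
      moreover have "T (a, c) \<le> T (a, c + 1)" using semi bd True unfolding semistandard_def by auto
      ultimately show ?thesis using ge ac by simp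
    next
      case False
      have rows: "fst b' < a" if "b' \<in> set b1" for b'
      proof (rule ccontr)
        assume "\<not> fst b' < a"
        have "snd b' > c" using that U \<open>\<not> fst b' < a\<close> unfolding b1
          by (auto simp: boxes_of_column_def)
        then have "conj_part lam (snd b') \<le> conj_part lam (c + 1)" by (intro conj_part_antimono[OF lam]) auto
        moreover have "b' \<in> diagram lam" using that b unfolding set_boxes[OF lam, symmetric] by simp
        then have "fst b' \<le> conj_part lam (snd b')" using diagram_iff[OF lam, of "fst b'" "snd b'"] by simp
        ultimately show False using False \<open>\<not> fst b' < a\<close> a by (auto simp: diagram_iff[OF lam])
      qed
      have none: "height k (map T b1) = 0" if "a \<le> Suc k" for k
      proof -
        have "height k (map T bs) = 0" if "\<forall>b'\<in>set bs. T b' = Pos (fst b') \<and> fst b' < a \<and> fst b' \<noteq> 0" for bs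
          using that \<open>a \<le> Suc k\<close> by (induction bs) (auto simp: eps_eq)
        moreover have "fst b' \<noteq> 0" if "b' \<in> set b1" for b'
        proof -
          have "b' \<in> set (boxes lam)" using that b by simp
          then show ?thesis unfolding set_boxes[OF lam] by (auto simp: diagram_def)
        qed
        ultimately show ?thesis using before rows by blast
      qed
      have ok: "0 \<le> height k (map T b1) + eps k (T b)" if "k < m" for k
      proof -
        have "reading lam T = map T (b1 @ [b]) @ map T b2" by (simp add: reading_def b)
        then have "0 \<le> height k (map T (b1 @ [b]))" using hi that unfolding highest_def by blast
        then show ?thesis by simp
      qed
      show ?thesis
      proof (cases "T (a, c)")
        case (Pos i)
        then have i: "a \<le> i" "i \<le> m" using ge x by (auto simp: letters_def)
        have "\<not> a < i"
        proof
          assume "a < i"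
          then have k: "i = Suc (Suc (i - 2))" "a \<le> Suc (i - 2)" using a by auto
          define k where "k = i - 2"
          note k = k[folded k_def]
          have "0 \<le> eps k (T b)" using ok[of k] none[of k] k i by simp
          then show False using k Pos ac by (simp add: eps_eq)
        qed
        then show ?thesis using i Pos ac by simp
      next
        case (Bar i)
        then have i: "1 \<le> i" "i \<le> m" using x by (auto simp: letters_def)
        show ?thesis
        proof (cases "i < a")
          case True
          then have "entry_at lam T i c (Pos i)" using above[of i] i a by (auto simp: entry_at_def diagram_iff[OF lam])
          moreover have "entry_at lam T a c (Bar i)" using Bar bd by (simp add: entry_at_def)
          ultimately have "i + (conj_part lam c + 1 - a) \<le> i" using colc unfolding column_condition_def by blast
          then show ?thesis using a by simp
        next
          case False
          then have k: "i = Suc (i - 1)" "a \<le> Suc (i - 1)" using i by auto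
          define k where "k = i - 1"
          note k = k[folded k_def]
          have "0 \<le> eps k (T b)" using ok[of k] none[of k] k i by simp
          then show ?thesis using k Bar ac by (simp add: eps_eq)
        qed
      qed
    qed
  qed
  have "\<forall>b\<in>set bs. T b = Pos (fst b)" if "boxes lam = bs @ bs'" for bs bs'
    using that
  proof (induction bs arbitrary: bs' rule: rev_induct)
    case (snoc b bs)
    then have "\<forall>b\<in>set bs. T b = Pos (fst b)" by simp
    moreover have "T b = Pos (fst b)" using step[of bs b bs'] snoc calculation by simp
    ultimately show ?case by simp
  qed simp
  then have "T b = Pos (fst b)" if "b \<in> diagram lam" for b
    using that set_boxes[OF lam] by (metis append_Nil2)
  then show ?thesis
    using TP by (auto simp: row_filling_def PiE_iff extensional_def fun_eq_iff)
qed

section \<open>The hook-content product\<close>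

definition qnum :: "'a::field \<Rightarrow> nat \<Rightarrow> 'a" where
  "qnum q n = 1 - q ^ n"

lemma q_bracket_of_nat: "q_bracket q (int n) = qnum q n"
  by (simp add: q_bracket_def qnum_def)

definition dist_nat :: "nat \<Rightarrow> nat \<Rightarrow> nat" where
  "dist_nat a b = (a - b) + (b - a)"

text \<open>The Weyl numerator of \<open>\<rho> + \<lambda>\<close>, up to sign and a power of \<open>q\<close>, as a function of the set of the numbers \<open>\<lambda>\<^sub>i + m + 1 - i\<close>.\<close>

definition weyl_product :: "'a::field \<Rightarrow> nat set \<Rightarrow> 'a" where
  "weyl_product q A = (\<Prod>a\<in>A. qnum q a * (\<Prod>b | b \<in> A \<and> b < a. qnum q (a - b) * qnum q (a + b)))"

lemma dist_nat_simps: "b < a \<Longrightarrow> dist_nat a b = a - b" "a < b \<Longrightarrow> dist_nat a b = b - a"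
  by (simp_all add: dist_nat_def)

lemma weyl_product_insert:
  assumes "finite R" "a \<notin> R"
  shows "weyl_product q (insert a R) = weyl_product q R * (qnum q a * (\<Prod>b\<in>R. qnum q (dist_nat a b) * qnum q (a + b)))"
proof -
  let ?g = "\<lambda>a b. qnum q (a - b) * qnum q (a + b)"
  let ?Y = "\<Prod>x\<in>R. if a < x then ?g x a else 1" and ?Z = "\<Prod>x\<in>R. if x < a then ?g a x else 1"
  have Y: "(\<Prod>x\<in>R. qnum q x * (\<Prod>b | b \<in> insert a R \<and> b < x. ?g x b)) = weyl_product q R * ?Y"
    unfolding weyl_product_def prod.distrib[symmetric]
  proof (rule prod.cong[OF HOL.refl])
    fix x assume "x \<in> R"
    have "{b. b \<in> insert a R \<and> b < x} = (if a < x then insert a {b. b \<in> R \<and> b < x} else {b. b \<in> R \<and> b < x})"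
      by auto
    then show "qnum q x * (\<Prod>b | b \<in> insert a R \<and> b < x. ?g x b)
        = qnum q x * (\<Prod>b | b \<in> R \<and> b < x. ?g x b) * (if a < x then ?g x a else 1)"
      using assms by (simp add: mult_ac)
  qed
  have "{b. b \<in> insert a R \<and> b < a} = {b. b \<in> R \<and> b < a}" by auto
  then have Z: "(\<Prod>b | b \<in> insert a R \<and> b < a. ?g a b) = ?Z"
    using assms(1) by (simp only: prod.inter_filter)
  have YZ: "?Z * ?Y = (\<Prod>b\<in>R. qnum q (dist_nat a b) * qnum q (a + b))"
    unfolding prod.distrib[symmetric]
    using assms(2) by (intro prod.cong) (auto simp: dist_nat_def add.commute)
  have "weyl_product q (insert a R) = (qnum q a * ?Z) * (weyl_product q R * ?Y)"
    unfolding Y[symmetric] Z[symmetric] weyl_product_def[of q "insert a R"] by (rule prod.insert[OF assms])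
  also have "\<dots> = weyl_product q R * (qnum q a * (?Z * ?Y))" by (simp only: mult_ac)
  finally show ?thesis unfolding YZ .
qed

lemma weyl_product_nonzero:
  assumes "finite A" "0 \<notin> A" "\<And>n. n > 0 \<Longrightarrow> qnum q n \<noteq> 0"
  shows "weyl_product q A \<noteq> 0"
proof -
  have "a > 0" if "a \<in> A" for a using assms(2) that by (cases a) auto
  then show ?thesis unfolding weyl_product_def using assms(1,3) by (auto simp: prod_zero_iff)
qed

lemma prod_qnum_window:
  assumes "n < a"
  shows "qnum q a * (\<Prod>b = 1..n. qnum q (a - b) * qnum q (a + b)) = (\<Prod>x = a - n..a + n. qnum q x)"
  using assms
proof (induction n)
  case (Suc n)
  have eq: "{a - Suc n..a + Suc n} = insert (a - Suc n) (insert (a + Suc n) {a - n..a + n})" using Suc.prems by auto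
  have notin: "a - Suc n \<notin> insert (a + Suc n) {a - n..a + n}" "a + Suc n \<notin> {a - n..a + n}" using Suc.prems by auto
  have outer: "(\<Prod>x = a - Suc n..a + Suc n. qnum q x) = qnum q (a - Suc n) * (qnum q (a + Suc n) * (\<Prod>x = a - n..a + n. qnum q x))"
    unfolding eq by (subst prod.insert[OF _ notin(1)], simp, subst prod.insert[OF _ notin(2)], simp, rule HOL.refl)
  have inner: "(\<Prod>b = 1..Suc n. qnum q (a - b) * qnum q (a + b))
      = (\<Prod>b = 1..n. qnum q (a - b) * qnum q (a + b)) * (qnum q (a - Suc n) * qnum q (a + Suc n))"
    by simp
  have IH: "qnum q a * (\<Prod>b = 1..n. qnum q (a - b) * qnum q (a + b)) = (\<Prod>x = a - n..a + n. qnum q x)"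
    using Suc by simp
  show ?case unfolding inner outer IH[symmetric] by (simp only: mult_ac)
qed simp

lemma prod_nat_split: "l \<le> Suc a \<Longrightarrow> a \<le> r \<Longrightarrow> (\<Prod>x = l..a. f x) * (\<Prod>x = Suc a..r. f x) = (\<Prod>x = l..r. f x :: 'a::comm_monoid_mult)"
  by (subst prod.union_disjoint[symmetric]) (auto intro: prod.cong)

text \<open>Partitions are functions on positive indices here: removing the first row and column may create parts equal to zero, and the number \<open>m\<close>
  of parts stays fixed.\<close>

definition cells :: "(nat \<Rightarrow> nat) \<Rightarrow> (nat \<times> nat) set" where
  "cells p = {(i, j). 1 \<le> i \<and> 1 \<le> j \<and> j \<le> p i}"

definition conj_fun :: "(nat \<Rightarrow> nat) \<Rightarrow> nat \<Rightarrow> nat" where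
  "conj_fun p j = card {i. (i, j) \<in> cells p}"

definition hook_fun :: "(nat \<Rightarrow> nat) \<Rightarrow> nat \<Rightarrow> nat \<Rightarrow> int" where
  "hook_fun p i j = int (p i) + int (conj_fun p j) - int i - int j + 1"

definition r_fun :: "(nat \<Rightarrow> nat) \<Rightarrow> nat \<Rightarrow> nat \<Rightarrow> int" where
  "r_fun p i j = (if i > j then int (p i) + int (p j) - int i - int j + 2
      else int i + int j - int (conj_fun p i) - int (conj_fun p j))"

definition partition_fun :: "nat \<Rightarrow> (nat \<Rightarrow> nat) \<Rightarrow> bool" where
  "partition_fun m p \<longleftrightarrow> (\<forall>i i'. 1 \<le> i \<longrightarrow> i \<le> i' \<longrightarrow> p i' \<le> p i) \<and> (\<forall>i>m. p i = 0)"

lemma cells_column: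
  assumes "partition_fun m p" "1 \<le> j"
  shows "{i. (i, j) \<in> cells p} = {1..conj_fun p j}" "conj_fun p j \<le> m"
proof -
  let ?S = "{i. (i, j) \<in> cells p}"
  have sub: "?S \<subseteq> {1..m}" using assms by (force simp: cells_def partition_fun_def not_le[symmetric])
  then have fin: "finite ?S" by (rule finite_subset) simp
  show "conj_fun p j \<le> m" using card_mono[OF _ sub] by (simp add: conj_fun_def)
  show "?S = {1..conj_fun p j}"
  proof (cases "?S = {}")
    case False
    define M where "M = Max ?S"
    have "M \<in> ?S" using Max_in[OF fin False] by (simp only: M_def)
    then have jM: "j \<le> p M" by (simp add: cells_def)
    have "?S = {1..M}"
    proof (intro equalityI subsetI)
      fix i assume i: "i \<in> ?S"
      then have "i \<le> M" using Max_ge[OF fin] by (simp only: M_def)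
      then show "i \<in> {1..M}" using i by (simp add: cells_def)
    next
      fix i assume i: "i \<in> {1..M}"
      then have "p M \<le> p i" using assms(1) unfolding partition_fun_def by auto
      then show "i \<in> ?S" using i assms(2) jM by (simp add: cells_def)
    qed
    then show ?thesis by (simp add: conj_fun_def)
  qed (simp add: conj_fun_def)
qed

lemma le_part_iff:
  assumes "partition_fun m p" "1 \<le> j" "1 \<le> i"
  shows "j \<le> p i \<longleftrightarrow> i \<le> conj_fun p j"
  using cells_column(1)[OF assms(1,2)] assms(2,3) by (auto simp: cells_def set_eq_iff)

text \<open>The partition without its first row and first column.\<close>

definition peel :: "(nat \<Rightarrow> nat) \<Rightarrow> nat \<Rightarrow> nat" where
  "peel p i = p (i + 1) - 1"

lemma partition_fun_peel: "partition_fun m p \<Longrightarrow> partition_fun m (peel p)"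
  unfolding partition_fun_def peel_def by (auto intro!: diff_le_mono)

lemma conj_fun_peel:
  assumes p: "partition_fun m p" and "1 \<le> j" "j + 1 \<le> p 1"
  shows "int (conj_fun (peel p) j) = int (conj_fun p (j + 1)) - 1"
proof -
  note p' = partition_fun_peel[OF p]
  have one: "1 \<le> conj_fun p (j + 1)" using le_part_iff[OF p, of "j + 1" 1] assms by simp
  have iff: "i \<le> conj_fun (peel p) j \<longleftrightarrow> i \<le> conj_fun p (j + 1) - 1" if "1 \<le> i" for i
    using le_part_iff[OF p' assms(2) that] le_part_iff[OF p, of "j + 1" "i + 1"] assms(2) one
    by (auto simp: peel_def)
  have "{1..conj_fun (peel p) j} = {1..conj_fun p (j + 1) - 1}" 
  proof (rule Set.set_eqI)
    show "i \<in> {1..conj_fun (peel p) j} \<longleftrightarrow> i \<in> {1..conj_fun p (j + 1) - 1}" for i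
      using iff[of i] unfolding atLeastAtMost_iff by blast
  qed
  then have "card {1..conj_fun (peel p) j} = card {1..conj_fun p (j + 1) - 1}" by (rule arg_cong)
  then show ?thesis using one by simp
qed

definition hook_factor :: "'a::field \<Rightarrow> nat \<Rightarrow> (nat \<Rightarrow> nat) \<Rightarrow> nat \<times> nat \<Rightarrow> 'a" where
  "hook_factor q m p = (\<lambda>(i, j). q_bracket q (2 * int m + r_fun p i j) / q_bracket q (hook_fun p i j))"

lemma finite_cells:
  assumes "partition_fun m p"
  shows "finite (cells p)"
proof (rule finite_subset)
  show "cells p \<subseteq> {1..m} \<times> {1..p 1}"
  proof
    fix b assume "b \<in> cells p"
    then obtain i j where b: "b = (i, j)" "1 \<le> i" "1 \<le> j" "j \<le> p i" by (auto simp: cells_def)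
    then have "p i \<le> p 1" "i \<le> m" using assms unfolding partition_fun_def by (auto simp: not_le[symmetric])
    then show "b \<in> {1..m} \<times> {1..p 1}" using b by simp
  qed
qed simp

lemma prod_inner_cells:
  assumes p: "partition_fun m p"
  shows "(\<Prod>b | b \<in> cells p \<and> 2 \<le> fst b \<and> 2 \<le> snd b. hook_factor q m p b) = (\<Prod>b\<in>cells (peel p). hook_factor q m (peel p) b)"
proof (rule prod.reindex_bij_witness[of _ "\<lambda>(i, j). (i + 1, j + 1)" "\<lambda>(i, j). (i - 1, j - 1)"]; clarsimp)
  fix i j assume ij: "(i, j) \<in> cells p" "2 \<le> i" "2 \<le> j"
  show "(i - Suc 0, j - Suc 0) \<in> cells (peel p)" using ij by (auto simp: cells_def peel_def)
  have j: "j \<le> p i" using ij by (simp add: cells_def)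
  have le: "p i' \<le> p i''" if "1 \<le> i''" "i'' \<le> i'" for i' i'' using p that by (simp add: partition_fun_def)
  have "p i \<le> p 1" using le[of 1 i] ij by simp
  then have "hook_fun (peel p) (i - 1) (j - 1) = hook_fun p i j"
    using conj_fun_peel[OF p, of "j - 1"] ij j by (simp add: hook_fun_def peel_def of_nat_diff)
  moreover have "r_fun (peel p) (i - 1) (j - 1) = r_fun p i j"
  proof (cases "j < i")
    case True
    then have "p i \<le> p j" using le[of j i] ij by simp
    moreover have "j - 1 < i - 1" using True ij by linarith
    ultimately show ?thesis using True ij j by (simp add: r_fun_def peel_def of_nat_diff)
  next
    case False
    then have "\<not> j - 1 < i - 1" by linarith
    then show ?thesis using False conj_fun_peel[OF p, of "j - 1"] conj_fun_peel[OF p, of "i - 1"] ij j \<open>p i \<le> p 1\<close>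
      by (simp add: r_fun_def of_nat_diff)
  qed
  ultimately show "hook_factor q m (peel p) (i - Suc 0, j - Suc 0) = hook_factor q m p (i, j)"
    by (simp add: hook_factor_def)
next
  fix i j assume "(i, j) \<in> cells (peel p)"
  then show "(Suc i, Suc j) \<in> cells p \<and> Suc 0 \<le> i \<and> Suc 0 \<le> j" by (auto simp: cells_def peel_def)
qed

lemma prod_cells_split:
  assumes p: "partition_fun m p" and "1 \<le> p 1"
  shows "(\<Prod>b\<in>cells p. hook_factor q m p b) = (\<Prod>b\<in>cells (peel p). hook_factor q m (peel p) b) *
    ((\<Prod>i = 2..conj_fun p 1. hook_factor q m p (i, 1)) * (\<Prod>j = 1..p 1. hook_factor q m p (1, j)))"
proof -
  let ?in = "{b. b \<in> cells p \<and> 2 \<le> fst b \<and> 2 \<le> snd b}"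
  let ?column_of = "(\<lambda>i. (i, 1 :: nat)) ` {2..conj_fun p 1}" and ?row = "(\<lambda>j. (1 :: nat, j)) ` {1..p 1}"
  have "(i, 1) \<in> cells p \<longleftrightarrow> i \<le> conj_fun p 1" if "1 \<le> i" for i
    using cells_column(1)[OF p, of 1] that by (auto simp: set_eq_iff)
  then have column_of: "(i, j) \<in> ?column_of \<longleftrightarrow> (i, j) \<in> cells p \<and> 2 \<le> i \<and> j = 1" for i j by auto
  have row: "(i, j) \<in> ?row \<longleftrightarrow> (i, j) \<in> cells p \<and> i = 1" for i j by (auto simp: cells_def)
  have "b \<in> cells p \<longleftrightarrow> b \<in> ?in \<union> (?column_of \<union> ?row)" for b
  proof (cases b)
    case (Pair i j)
    have "(i, j) \<in> cells p \<Longrightarrow> 1 \<le> i \<and> 1 \<le> j" by (simp add: cells_def)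
    then show ?thesis unfolding Pair Un_iff column_of row by auto
  qed
  then have "cells p = ?in \<union> (?column_of \<union> ?row)" by blast
  then have "(\<Prod>b\<in>cells p. hook_factor q m p b) = (\<Prod>b\<in>?in \<union> (?column_of \<union> ?row). hook_factor q m p b)" by simp
  also have "\<dots> = (\<Prod>b\<in>?in. hook_factor q m p b) * (\<Prod>b\<in>?column_of \<union> ?row. hook_factor q m p b)"
    by (rule prod.union_disjoint) (use finite_cells[OF p] in auto)
  also have "(\<Prod>b\<in>?column_of \<union> ?row. hook_factor q m p b) = (\<Prod>b\<in>?column_of. hook_factor q m p b) * (\<Prod>b\<in>?row. hook_factor q m p b)"
    by (rule prod.union_disjoint) auto
  also have "(\<Prod>b\<in>?column_of. hook_factor q m p b) = (\<Prod>i = 2..conj_fun p 1. hook_factor q m p (i, 1))"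
    by (subst prod.reindex) (auto simp: inj_on_def)
  also have "(\<Prod>b\<in>?row. hook_factor q m p b) = (\<Prod>j = 1..p 1. hook_factor q m p (1, j))"
    by (subst prod.reindex) (auto simp: inj_on_def)
  finally show ?thesis unfolding prod_inner_cells[OF p] .
qed

definition shifted :: "nat \<Rightarrow> (nat \<Rightarrow> nat) \<Rightarrow> nat \<Rightarrow> nat" where
  "shifted m p i = p i + (m + 1 - i)"

lemma shifted_less:
  assumes "partition_fun m p" "1 \<le> i" "i < i'" "i' \<le> m"
  shows "shifted m p i' < shifted m p i"
proof -
  have "p i' \<le> p i" using assms by (simp add: partition_fun_def)
  then show ?thesis using assms by (simp add: shifted_def)
qed

lemma shifted_inj: "partition_fun m p \<Longrightarrow> inj_on (shifted m p) {1..m}"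
  using shifted_less[of m p] by (intro linorder_inj_onI) force+

text \<open>The numbers \<open>m + j - \<lambda>\<^sup>t\<^sub>j\<close> of the columns fill the gaps between the numbers \<open>\<lambda>\<^sub>i + m + 1 - i\<close> of the rows \<open>i > 1\<close>, as
  the steps of the boundary path of the diagram are either horizontal or vertical.\<close>

lemma column_gaps:
  assumes p: "partition_fun m p" and "1 \<le> p 1"
  defines "k \<equiv> conj_fun p 1"
  defines "d \<equiv> \<lambda>j. m + j - conj_fun p j"
  shows "inj_on d {1..p 1}" "d ` {1..p 1} \<inter> shifted m p ` {2..k} = {}"
    "d ` {1..p 1} \<union> shifted m p ` {2..k} = {m + 1 - k..<p 1 + m}"
proof -
  have k: "1 \<le> k" "k \<le> m" using le_part_iff[OF p, of 1 1] assms(2) cells_column(2)[OF p, of 1] by (auto simp: k_def)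
  have cm: "conj_fun p j \<le> m" "conj_fun p j' \<le> conj_fun p j" if "1 \<le> j" "j \<le> j'" for j j'
  proof -
    show "conj_fun p j \<le> m" using cells_column(2)[OF p that(1)] .
    show "conj_fun p j' \<le> conj_fun p j"
    proof (cases "conj_fun p j' = 0")
      case False
      then have "j' \<le> p (conj_fun p j')" using le_part_iff[OF p, of j' "conj_fun p j'"] that by simp
      then show ?thesis using le_part_iff[OF p that(1), of "conj_fun p j'"] that False by simp
    qed simp
  qed
  have dless: "d j < d j'" if "1 \<le> j" "j < j'" for j j'
    using cm[OF that(1), of j'] that by (simp add: d_def)
  then show inj: "inj_on d {1..p 1}" by (intro linorder_inj_onI) force+
  have ne: "d j \<noteq> shifted m p i" if "1 \<le> j" "1 \<le> i" "i \<le> k" for i j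
    using le_part_iff[OF p that(1,2)] cm(1)[OF that(1) order_refl] that k
    by (cases "j \<le> p i") (auto simp: d_def shifted_def)
  then show disj: "d ` {1..p 1} \<inter> shifted m p ` {2..k} = {}" by force
  have "d ` {1..p 1} \<subseteq> {m + 1 - k..<p 1 + m}"
  proof
    fix x assume "x \<in> d ` {1..p 1}"
    then obtain j where j: "x = d j" "1 \<le> j" "j \<le> p 1" by auto
    have "1 \<le> conj_fun p j" using le_part_iff[OF p j(2), of 1] j by simp
    then show "x \<in> {m + 1 - k..<p 1 + m}" using cm[of 1 j] cm(1)[of j j] j k by (auto simp: d_def k_def)
  qed
  moreover have "shifted m p ` {2..k} \<subseteq> {m + 1 - k..<p 1 + m}"
  proof
    fix x assume "x \<in> shifted m p ` {2..k}"
    then obtain i where i: "x = shifted m p i" "2 \<le> i" "i \<le> k" by auto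
    have "p i \<le> p 1" using p i by (simp add: partition_fun_def)
    moreover have "1 \<le> p i" using le_part_iff[OF p, of 1 i] i by (simp add: k_def)
    ultimately show "x \<in> {m + 1 - k..<p 1 + m}" using i k by (auto simp: shifted_def)
  qed
  moreover have "card (d ` {1..p 1} \<union> shifted m p ` {2..k}) = card {m + 1 - k..<p 1 + m}"
  proof -
    have "inj_on (shifted m p) {2..k}" using k by (intro inj_on_subset[OF shifted_inj[OF p]]) auto
    then have "card (d ` {1..p 1} \<union> shifted m p ` {2..k}) = p 1 + (k - 1)"
      using inj disj by (subst card_Un_disjoint) (auto simp: card_image)
    then show ?thesis using k by simp
  qed
  ultimately show "d ` {1..p 1} \<union> shifted m p ` {2..k} = {m + 1 - k..<p 1 + m}"
    by (intro card_subset_eq) auto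
qed

text \<open>Only the element \<open>\<lambda>\<^sub>1 + m\<close> is exchanged, for \<open>m + 1 - \<ell>(\<lambda>)\<close>.\<close>

lemma shifted_peel:
  assumes p: "partition_fun m p" and "1 \<le> p 1"
  defines "k \<equiv> conj_fun p 1"
  shows "shifted m p ` {1..m} = insert (p 1 + m) (shifted m p ` {2..k} \<union> {1..<m + 1 - k})"
    "shifted m (peel p) ` {1..m} = insert (m + 1 - k) (shifted m p ` {2..k} \<union> {1..<m + 1 - k})"
proof -
  have k: "1 \<le> k" "k \<le> m" using le_part_iff[OF p, of 1 1] assms(2) cells_column(2)[OF p, of 1] by (auto simp: k_def)
  have zero: "p i = 0" if "k < i" for i using le_part_iff[OF p, of 1 i] that k by (auto simp: k_def)
  have pos: "1 \<le> p i" if "1 \<le> i" "i \<le> k" for i using le_part_iff[OF p, of 1 i] that by (auto simp: k_def)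
  have tail: "f ` {k + 1..m} = {1..<m + 1 - k}" if "\<And>i. k < i \<Longrightarrow> f i = m + 1 - i" for f :: "nat \<Rightarrow> nat"
  proof (intro equalityI subsetI)
    fix x assume "x \<in> {1..<m + 1 - k}"
    then show "x \<in> f ` {k + 1..m}" using that[of "m + 1 - x"] k by (intro image_eqI[of _ _ "m + 1 - x"]) auto
  qed (use that in auto)
  have "{1..m} = insert 1 ({2..k} \<union> {k + 1..m})" using k by auto
  then have "shifted m p ` {1..m} = insert (shifted m p 1) (shifted m p ` {2..k} \<union> shifted m p ` {k + 1..m})"
    by (simp only: image_insert image_Un)
  moreover have "shifted m p ` {k + 1..m} = {1..<m + 1 - k}" by (rule tail) (simp add: shifted_def zero)
  ultimately show "shifted m p ` {1..m} = insert (p 1 + m) (shifted m p ` {2..k} \<union> {1..<m + 1 - k})"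
    by (simp add: shifted_def)
  have "{1..m} = insert k ({1..k - 1} \<union> {k + 1..m})" using k by auto
  then have "shifted m (peel p) ` {1..m}
      = insert (shifted m (peel p) k) (shifted m (peel p) ` {1..k - 1} \<union> shifted m (peel p) ` {k + 1..m})"
    by (simp only: image_insert image_Un)
  moreover have "shifted m (peel p) ` {k + 1..m} = {1..<m + 1 - k}"
    by (rule tail) (simp add: shifted_def zero peel_def)
  moreover have "shifted m (peel p) ` {1..k - 1} = shifted m p ` {2..k}"
  proof -
    have "shifted m (peel p) i = shifted m p (i + 1)" if "i \<in> {1..k - 1}" for i
      using pos[of "i + 1"] that k by (auto simp: shifted_def peel_def)
    then have "shifted m (peel p) ` {1..k - 1} = (\<lambda>i. shifted m p (i + 1)) ` {1..k - 1}" by (rule image_cong[OF HOL.refl])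
    also have "\<dots> = shifted m p ` ((\<lambda>i. i + 1) ` {1..k - 1})" by (simp only: image_image)
    also have "(\<lambda>i. i + 1) ` {1..k - 1} = {2..k}" using k by (auto simp: image_iff intro!: bexI[of _ "_ - 1"])
    finally show ?thesis .
  qed
  moreover have "shifted m (peel p) k = m + 1 - k" by (simp add: shifted_def peel_def zero)
  ultimately show "shifted m (peel p) ` {1..m} = insert (m + 1 - k) (shifted m p ` {2..k} \<union> {1..<m + 1 - k})"
    by simp
qed

lemma prod_qnum_reflect: "c \<le> a \<Longrightarrow> (\<Prod>x\<in>{c..<a}. qnum q (a - x)) = (\<Prod>x = 1..a - c. qnum q x)"
  by (rule prod.reindex_bij_witness[of _ "\<lambda>x. a - x" "\<lambda>x. a - x"]) auto

lemma prod_qnum_shift: "1 \<le> a \<Longrightarrow> (\<Prod>x\<in>{c..<a}. qnum q (x + c)) = (\<Prod>x = 2 * c..a + c - 1. qnum q x)"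
  by (rule prod.reindex_bij_witness[of _ "\<lambda>x. x - c" "\<lambda>x. x + c"]) auto

text \<open>The factor of the first hook is the quotient of the two Weyl products: \<open>a = \<lambda>\<^sub>1 + m\<close> is the number removed, \<open>c = m + 1 - \<ell>(\<lambda>)\<close>
  the number put in its place, \<open>l\<close> lists the numbers of the rows \<open>i > 1\<close> and \<open>d\<close> those of the columns. As these fill an
  interval, clearing denominators turns both sides into \<open>[1] \<dots> [a + c - 1]\<close>, up to common factors.\<close>

lemma first_hook_identity:
  fixes q :: "'a::field"
  assumes nz: "\<And>n. n > 0 \<Longrightarrow> qnum q n \<noteq> 0"
    and fin: "finite J" "finite I" and inj: "inj_on d J" "inj_on l I"
    and disj: "d ` J \<inter> l ` I = {}" and un: "d ` J \<union> l ` I = {c..<a}"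
    and c: "1 \<le> c" "c < a" and cl: "c \<notin> l ` I"
  shows "qnum q a * (\<Prod>b\<in>l ` I \<union> {1..<c}. qnum q (dist_nat a b) * qnum q (a + b)) =
    ((\<Prod>i\<in>I. qnum q (l i + a) / qnum q (l i - c)) * (\<Prod>j\<in>J. qnum q (d j + c) / qnum q (a - d j))) *
    (qnum q c * (\<Prod>b\<in>l ` I \<union> {1..<c}. qnum q (dist_nat c b) * qnum q (c + b)))"
proof -
  have lI: "c < l i \<and> l i < a" if "i \<in> I" for i
  proof -
    have "l i \<in> {c..<a}" using that unfolding un[symmetric] by blast
    moreover have "l i \<noteq> c" using cl that by blast
    ultimately show ?thesis by auto
  qed
  have dJ: "d j < a" if "j \<in> J" for j
  proof -
    have "d j \<in> {c..<a}" using that unfolding un[symmetric] by blast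
    then show ?thesis by simp
  qed
  have split: "(\<Prod>b\<in>l ` I \<union> {1..<c}. f b) = (\<Prod>i\<in>I. f (l i)) * (\<Prod>b = 1..c - 1. f b)" for f :: "nat \<Rightarrow> 'a"
  proof -
    have "(\<Prod>b\<in>l ` I \<union> {1..<c}. f b) = (\<Prod>b\<in>l ` I. f b) * (\<Prod>b\<in>{1..<c}. f b)"
      by (rule prod.union_disjoint) (use fin lI in fastforce)+
    moreover have "{1..<c} = {1..c - 1}" using c by auto
    ultimately show ?thesis using inj by (simp add: prod.reindex)
  qed
  have both: "(\<Prod>j\<in>J. f (d j)) * (\<Prod>i\<in>I. f (l i)) = (\<Prod>x\<in>{c..<a}. f x)" for f :: "nat \<Rightarrow> 'a"
    unfolding un[symmetric] using fin inj disj by (subst prod.union_disjoint) (auto simp: prod.reindex)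
  define A1 where "A1 = (\<Prod>i\<in>I. qnum q (l i + a))"
  define A2 where "A2 = (\<Prod>i\<in>I. qnum q (l i - c))"
  define A3 where "A3 = (\<Prod>j\<in>J. qnum q (d j + c))"
  define A4 where "A4 = (\<Prod>j\<in>J. qnum q (a - d j))"
  define A5 where "A5 = (\<Prod>i\<in>I. qnum q (a - l i))"
  define A6 where "A6 = (\<Prod>i\<in>I. qnum q (l i + c))"
  have A24: "A2 \<noteq> 0" "A4 \<noteq> 0"
    unfolding A2_def A4_def using fin nz lI dJ by (auto simp: prod_zero_iff)
  have wa: "qnum q a * (\<Prod>b = 1..c - 1. qnum q (dist_nat a b) * qnum q (a + b)) = (\<Prod>x = a - (c - 1)..a + (c - 1). qnum q x)"
  proof -
    have "(\<Prod>b = 1..c - 1. qnum q (dist_nat a b) * qnum q (a + b)) = (\<Prod>b = 1..c - 1. qnum q (a - b) * qnum q (a + b))"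
      using c by (intro prod.cong) (auto simp: dist_nat_simps)
    then show ?thesis using prod_qnum_window[of "c - 1" a q] c by simp
  qed
  have wc: "qnum q c * (\<Prod>b = 1..c - 1. qnum q (dist_nat c b) * qnum q (c + b)) = (\<Prod>x = 1..2 * c - 1. qnum q x)"
  proof -
    have "(\<Prod>b = 1..c - 1. qnum q (dist_nat c b) * qnum q (c + b)) = (\<Prod>b = 1..c - 1. qnum q (c - b) * qnum q (c + b))"
      using c by (intro prod.cong) (auto simp: dist_nat_simps)
    moreover have "c - (c - 1) = 1" "c + (c - 1) = 2 * c - 1" using c by auto
    ultimately show ?thesis using prod_qnum_window[of "c - 1" c q] c by simp
  qed
  have "A4 * A5 = (\<Prod>x = 1..a - c. qnum q x)"
    using both[of "\<lambda>x. qnum q (a - x)"] prod_qnum_reflect[of c a q] c by (simp add: A4_def A5_def)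
  moreover have "(\<Prod>x = 1..a - c. qnum q x) * (\<Prod>x = a - (c - 1)..a + (c - 1). qnum q x) = (\<Prod>x = 1..a + c - 1. qnum q x)"
    using prod_nat_split[of 1 "a - c" "a + c - 1" "qnum q"] c by (simp add: Suc_diff_le)
  moreover have "A3 * A6 = (\<Prod>x = 2 * c..a + c - 1. qnum q x)"
    using both[of "\<lambda>x. qnum q (x + c)"] prod_qnum_shift[of a q c] c by (simp add: A3_def A6_def)
  moreover have "(\<Prod>x = 1..2 * c - 1. qnum q x) * (\<Prod>x = 2 * c..a + c - 1. qnum q x) = (\<Prod>x = 1..a + c - 1. qnum q x)"
    using prod_nat_split[of 1 "2 * c - 1" "a + c - 1" "qnum q"] c by simp
  ultimately have key: "A4 * A5 * (\<Prod>x = a - (c - 1)..a + (c - 1). qnum q x) = A3 * A6 * (\<Prod>x = 1..2 * c - 1. qnum q x)"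
    by (simp add: mult.commute)
  have la: "(\<Prod>i\<in>I. qnum q (dist_nat a (l i)) * qnum q (a + l i)) = A5 * A1"
    unfolding A5_def A1_def prod.distrib[symmetric] using lI by (intro prod.cong) (auto simp: dist_nat_simps add.commute)
  have lc: "(\<Prod>i\<in>I. qnum q (dist_nat c (l i)) * qnum q (c + l i)) = A2 * A6"
    unfolding A2_def A6_def prod.distrib[symmetric] using lI by (intro prod.cong) (auto simp: dist_nat_simps add.commute)
  have "A4 * (qnum q a * (\<Prod>b\<in>l ` I \<union> {1..<c}. qnum q (dist_nat a b) * qnum q (a + b)))
      = A1 * (A4 * A5 * (\<Prod>x = a - (c - 1)..a + (c - 1). qnum q x))"
    unfolding split la wa[symmetric] by (simp only: mult_ac)
  also have "\<dots> = A1 * A3 * (A6 * (\<Prod>x = 1..2 * c - 1. qnum q x))" unfolding key by (simp only: mult_ac)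
  also have "\<dots> = A4 * (((A1 / A2) * (A3 / A4)) * (A2 * A6 * (\<Prod>x = 1..2 * c - 1. qnum q x)))"
    using A24 by simp
  finally have "qnum q a * (\<Prod>b\<in>l ` I \<union> {1..<c}. qnum q (dist_nat a b) * qnum q (a + b))
      = ((A1 / A2) * (A3 / A4)) * (A2 * A6 * (\<Prod>x = 1..2 * c - 1. qnum q x))"
    using A24(2) unfolding mult_cancel_left by blast
  also have "A2 * A6 * (\<Prod>x = 1..2 * c - 1. qnum q x)
      = qnum q c * (\<Prod>b\<in>l ` I \<union> {1..<c}. qnum q (dist_nat c b) * qnum q (c + b))"
    unfolding split lc wc[symmetric] by (simp only: mult_ac)
  finally show ?thesis unfolding A1_def A2_def A3_def A4_def prod_dividef .
qed

text \<open>Induction over the diagonal hooks, the first one being removed in each step.\<close>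

lemma hook_product:
  fixes q :: "'a::field"
  assumes nz: "\<And>n. n > 0 \<Longrightarrow> qnum q n \<noteq> 0"
  shows "partition_fun m p \<Longrightarrow>
    (\<Prod>b\<in>cells p. hook_factor q m p b) * weyl_product q {1..m} = weyl_product q (shifted m p ` {1..m})"
proof (induction "p 1" arbitrary: p rule: less_induct)
  case less
  note p = less.prems
  show ?case
  proof (cases "p 1 = 0")
    case True
    then have z: "p i = 0" if "1 \<le> i" for i using p that unfolding partition_fun_def by (metis le_zero_eq order_refl)
    then have "cells p = {}" by (auto simp: cells_def)
    moreover have "shifted m p ` {1..m} = {1..m}"
    proof (intro equalityI subsetI)
      fix x assume "x \<in> {1..m}"
      then show "x \<in> shifted m p ` {1..m}" using z by (intro image_eqI[of _ _ "m + 1 - x"]) (auto simp: shifted_def)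
    qed (use z in \<open>auto simp: shifted_def\<close>)
    ultimately show ?thesis by simp
  next
    case False
    then have p1: "1 \<le> p 1" by simp
    define k where "k = conj_fun p 1"
    have k: "1 \<le> k" "k \<le> m" using le_part_iff[OF p, of 1 1] p1 cells_column(2)[OF p, of 1] by (auto simp: k_def)
    have kk: "conj_fun p (Suc 0) = k" by (simp add: k_def)
    define a c where "a = p 1 + m" and "c = m + 1 - k"
    define d where "d j = m + j - conj_fun p j" for j
    define R where "R = shifted m p ` {2..k} \<union> {1..<c}"
    have "p 2 \<le> p 1" using p by (simp add: partition_fun_def)
    then have "peel p 1 < p 1" using p1 by (simp add: peel_def numeral_2_eq_2)
    note IH = less.hyps[OF this partition_fun_peel[OF p]]
    note gaps = column_gaps[OF p p1, folded k_def, folded d_def a_def c_def]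
    note sh = shifted_peel[OF p p1, folded k_def, folded a_def c_def, folded R_def]
    have "d 1 = c" using k by (simp add: d_def c_def k_def)
    then have cd: "c \<in> d ` {1..p 1}" using p1 by force
    then have cl: "c \<notin> shifted m p ` {2..k}" using gaps(2) by blast
    have c: "1 \<le> c" "c < a" using k p1 by (auto simp: a_def c_def)
    have "shifted m p ` {2..k} \<subseteq> {c..<a}" using gaps(3) by blast
    then have aR: "a \<notin> R" and cR: "c \<notin> R" using cl c by (auto simp: R_def)
    have "finite R" by (simp add: R_def)
    have column_of: "hook_factor q m p (i, 1) = qnum q (shifted m p i + a) / qnum q (shifted m p i - c)" if "i \<in> {2..k}" for i
    proof -
      have "2 * int m + r_fun p i 1 = int (shifted m p i + a)" using that k by (simp add: r_fun_def shifted_def a_def)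
      moreover have "hook_fun p i 1 = int (shifted m p i - c)" using that k by (simp add: hook_fun_def shifted_def c_def kk)
      ultimately show ?thesis unfolding hook_factor_def split by (simp only: q_bracket_of_nat)
    qed
    have row: "hook_factor q m p (1, j) = qnum q (d j + c) / qnum q (a - d j)" if "j \<in> {1..p 1}" for j
    proof -
      have "d j < a" using gaps(3) that by (metis UnCI atLeastLessThan_iff imageI)
      moreover have "conj_fun p j \<le> m" using cells_column(2)[OF p, of j] that by simp
      ultimately have "2 * int m + r_fun p 1 j = int (d j + c)" "hook_fun p 1 j = int (a - d j)"
        using that k by (simp_all add: r_fun_def hook_fun_def d_def a_def c_def kk)
      then show ?thesis unfolding hook_factor_def split by (simp only: q_bracket_of_nat)
    qed
    have "inj_on (shifted m p) {2..k}" using k by (intro inj_on_subset[OF shifted_inj[OF p]]) auto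
    note fh = first_hook_identity[OF nz _ _ gaps(1) this gaps(2,3) c cl, folded R_def, simplified]
    have "(\<Prod>b\<in>cells p. hook_factor q m p b) * weyl_product q {1..m}
      = ((\<Prod>i = 2..k. hook_factor q m p (i, 1)) * (\<Prod>j = 1..p 1. hook_factor q m p (1, j))) * weyl_product q (insert c R)"
      unfolding prod_cells_split[OF p p1] sh(2)[symmetric] IH[symmetric] k_def[symmetric] by (simp only: mult_ac)
    also have "\<dots> = weyl_product q R * (((\<Prod>i = 2..k. qnum q (shifted m p i + a) / qnum q (shifted m p i - c)) *
        (\<Prod>j = 1..p 1. qnum q (d j + c) / qnum q (a - d j))) *
        (qnum q c * (\<Prod>b\<in>R. qnum q (dist_nat c b) * qnum q (c + b))))"
      unfolding weyl_product_insert[OF \<open>finite R\<close> cR] using column_of row by (simp add: mult_ac)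
    also have "\<dots> = weyl_product q R * (qnum q a * (\<Prod>b\<in>R. qnum q (dist_nat a b) * qnum q (a + b)))"
      using fh by simp
    also have "\<dots> = weyl_product q (shifted m p ` {1..m})"
      unfolding sh(1) weyl_product_insert[OF \<open>finite R\<close> aR] ..
    finally show ?thesis .
  qed
qed

section \<open>The principal specialization\<close>

lemma wt_reading:
  assumes "is_partition lam"
  shows "wt (reading lam T) j = (\<Sum>b\<in>diagram lam. letter_wt (T b) j)"
  unfolding wt_def reading_def map_map comp_def set_boxes[OF assms, symmetric]
  by (rule sum_list_distinct_conv_sum_set[OF distinct_boxes])

lemma wt_row_filling:
  assumes "is_partition lam"
  shows "wt (reading lam (row_filling lam)) j = int (part lam (Suc j))"
proof -
  have "wt (reading lam (row_filling lam)) j = (\<Sum>b\<in>diagram lam. of_bool (fst b = Suc j))"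
    unfolding wt_reading[OF assms] by (intro sum.cong) (auto simp: row_filling_def letter_wt_def)
  also have "\<dots> = int (card {b \<in> diagram lam. fst b = Suc j})"
    by (simp add: of_bool_def sum.If_cases finite_diagram Int_def)
  also have "{b \<in> diagram lam. fst b = Suc j} = (\<lambda>c. (Suc j, c)) ` {1..part lam (Suc j)}"
    by (auto simp: diagram_def part_def)
  also have "card \<dots> = part lam (Suc j)" by (subst card_image) (auto simp: inj_on_def)
  finally show ?thesis .
qed

definition letter_power :: "nat \<Rightarrow> letter \<Rightarrow> nat" where
  "letter_power m x = (case x of Pos i \<Rightarrow> i - 1 | Bar i \<Rightarrow> 2 * m - i)"

lemma pwr_eq_sum:
  assumes "T \<in> SP m lam"
  shows "pwr m lam T = (\<Sum>b\<in>diagram lam. letter_power m (T b))"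
proof -
  have occ: "c * num_entries lam T x = (\<Sum>b\<in>diagram lam. if T b = x then c else 0)" for c x
    unfolding num_entries_def by (simp add: sum.If_cases finite_diagram Int_def mult.commute)
  have "pwr m lam T = (\<Sum>b\<in>diagram lam. \<Sum>i = 1..m.
      (if T b = Pos i then i - 1 else 0) + (if T b = Bar i then 2 * m - i else 0))"
    unfolding pwr_def occ sum.distrib[symmetric] by (rule sum.swap)
  also have "\<dots> = (\<Sum>b\<in>diagram lam. letter_power m (T b))"
  proof (rule sum.cong[OF HOL.refl])
    fix b assume "b \<in> diagram lam"
    then have "T b \<in> letters m" using assms by (auto simp: SP_def)
    then consider i where "T b = Pos i" "i \<in> {1..m}" | i where "T b = Bar i" "i \<in> {1..m}"
      by (auto simp: letters_def)
    then show "(\<Sum>i = 1..m. (if T b = Pos i then i - 1 else 0) + (if T b = Bar i then 2 * m - i else 0)) = letter_power m (T b)"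
      by cases (simp_all add: letter_power_def sum.delta)
  qed
  finally show ?thesis .
qed

text \<open>In the order of the alphabet the letters have powers \<open>0, 1, \<dots>, 2m - 1\<close>, which are symmetric about \<open>m - 1/2\<close>.\<close>

lemma two_letter_power:
  assumes "x \<in> letters m"
  shows "2 * int (letter_power m x) = (2 * int m - 1) - (\<Sum>j<m. int (2 * (m - 1 - j) + 1) * letter_wt x j)"
proof -
  have *: "(\<Sum>j<m. int (2 * (m - 1 - j) + 1) * of_bool (i = Suc j)) = 2 * int m - 2 * int i + 1" if "1 \<le> i" "i \<le> m" for i
  proof -
    have "(\<Sum>j<m. int (2 * (m - 1 - j) + 1) * of_bool (i = Suc j)) = (\<Sum>j<m. if j = i - 1 then int (2 * (m - 1 - j) + 1) else 0)"
      by (rule sum.cong) (use that in auto)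
    also have "\<dots> = int (2 * (m - 1 - (i - 1)) + 1)" using that by (subst sum.delta) auto
    also have "\<dots> = 2 * int m - 2 * int i + 1" using that by (simp add: of_nat_diff)
    finally show ?thesis .
  qed
  show ?thesis
  proof (cases x)
    case (Pos i)
    then have "1 \<le> i" "i \<le> m" using assms by (auto simp: letters_def)
    note *[OF this] this
    then show ?thesis using Pos by (simp add: letter_power_def letter_wt_def of_nat_diff)
  next
    case (Bar i)
    then have "1 \<le> i" "i \<le> m" using assms by (auto simp: letters_def)
    note *[OF this] this
    then show ?thesis using Bar by (simp add: letter_power_def letter_wt_def of_nat_diff sum_negf)
  qed
qed

lemma two_pwr:
  assumes lam: "is_partition lam" and T: "T \<in> SP m lam"
  shows "2 * int (pwr m lam T) = (2 * int m - 1) * int (card (diagram lam))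
    - (\<Sum>j<m. int (2 * (m - 1 - j) + 1) * wt (reading lam T) j)"
proof -
  have "2 * int (pwr m lam T) = (\<Sum>b\<in>diagram lam. 2 * int (letter_power m (T b)))"
    by (simp add: pwr_eq_sum[OF T] sum_distrib_left)
  also have "\<dots> = (\<Sum>b\<in>diagram lam. (2 * int m - 1) - (\<Sum>j<m. int (2 * (m - 1 - j) + 1) * letter_wt (T b) j))"
  proof (rule sum.cong[OF HOL.refl])
    fix b assume "b \<in> diagram lam"
    then have "T b \<in> letters m" using T by (auto simp: SP_def)
    then show "2 * int (letter_power m (T b)) = (2 * int m - 1) - (\<Sum>j<m. int (2 * (m - 1 - j) + 1) * letter_wt (T b) j)"
      by (rule two_letter_power)
  qed
  also have "\<dots> = (2 * int m - 1) * int (card (diagram lam))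
      - (\<Sum>j<m. \<Sum>b\<in>diagram lam. int (2 * (m - 1 - j) + 1) * letter_wt (T b) j)"
    unfolding sum_subtractf by (subst sum.swap) (simp add: algebra_simps)
  finally show ?thesis unfolding wt_reading[OF lam] sum_distrib_left .
qed

lemma power_int_sum:
  fixes t :: "'a::field"
  assumes "t \<noteq> 0" "finite A"
  shows "t powi (\<Sum>i\<in>A. f i) = (\<Prod>i\<in>A. t powi (f i))"
  using assms(2) by (induction A rule: finite_induct) (simp_all add: power_int_add assms(1))

text \<open>The exponents of the principal specialization are those of the alternant in reverse order and with opposite sign, a signed
  permutation.\<close>

lemma sum_pwr_alternant:
  fixes t :: "'a::field_char_0"
  assumes lam: "is_partition lam" and len: "length lam \<le> m" and t: "t \<noteq> 0"
  shows "alternant t m (rho m) * (\<Sum>T\<in>SP m lam. (t ^ 2) ^ pwr m lam T)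
    = t powi ((2 * int m - 1) * int (card (diagram lam))) * alternant t m (\<lambda>j. rho m j + int (part lam (Suc j)))"
proof -
  let ?L = "reading lam ` SP m lam" and ?n = "t powi ((2 * int m - 1) * int (card (diagram lam)))"
  have L: "finite ?L" "\<forall>w\<in>?L. set w \<subseteq> letters m" "\<forall>k<m. flip_closed m k ?L"
    using finite_SP reading_letters[OF lam] flip_closed_readings[OF lam] by auto
  \<comment> \<open>the reversal of the components, to be combined with a change of all signs\<close>
  define p where "p i = (if i < m then m - 1 - i else i)" for i
  have "bij_betw p {0..<m} {0..<m}"
    by (rule bij_betw_byWitness[of _ p]) (auto simp: p_def)
  then have perm: "p permutes {0..<m}" by (rule bij_imp_permutes) (simp add: p_def)
  let ?g = "\<lambda>\<mu>. \<Prod>i<m. t powi (int (2 * i + 1) * \<mu> i)"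
  have "(\<Sum>T\<in>SP m lam. (t ^ 2) ^ pwr m lam T) = ?n * (\<Sum>T\<in>SP m lam. ?g (\<lambda>i. - wt (reading lam T) (m - 1 - i)))"
    unfolding sum_distrib_left
  proof (rule sum.cong[OF HOL.refl])
    fix T assume T: "T \<in> SP m lam"
    have "(t ^ 2) ^ pwr m lam T = t powi (2 * int (pwr m lam T))"
      by (metis power_int_of_nat of_nat_mult of_nat_numeral power_mult)
    also have "\<dots> = ?n * t powi (- (\<Sum>j<m. int (2 * (m - 1 - j) + 1) * wt (reading lam T) j))"
      unfolding two_pwr[OF lam T] diff_conv_add_uminus by (rule power_int_add) (simp add: t)
    also have "- (\<Sum>j<m. int (2 * (m - 1 - j) + 1) * wt (reading lam T) j) = (\<Sum>i<m. int (2 * i + 1) * - wt (reading lam T) (m - 1 - i))"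
      unfolding sum_negf[symmetric]
      by (rule sum.reindex_bij_witness[of _ "\<lambda>i. m - 1 - i" "\<lambda>i. m - 1 - i"]) auto
    finally show "(t ^ 2) ^ pwr m lam T = ?n * ?g (\<lambda>i. - wt (reading lam T) (m - 1 - i))"
      unfolding power_int_sum[OF t finite_lessThan] .
  qed
  also have "(\<Sum>T\<in>SP m lam. ?g (\<lambda>i. - wt (reading lam T) (m - 1 - i))) = (\<Sum>w\<in>?L. ?g (wt w))"
  proof -
    have "(\<Sum>T\<in>SP m lam. ?g (\<lambda>i. - wt (reading lam T) (m - 1 - i)))
        = (\<Sum>w\<in>?L. ?g (\<lambda>i. if i \<in> {..<m} then - wt w (p i) else wt w (p i)))"
      unfolding sum.reindex[OF reading_inj[OF lam]] comp_def
      by (intro sum.cong prod.cong) (auto simp: p_def)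
    also have "\<dots> = (\<Sum>\<mu>\<in>#image_mset (\<lambda>\<mu> i. if i \<in> {..<m} then - \<mu> (p i) else \<mu> (p i)) (weights ?L). ?g \<mu>)"
      unfolding sum_weights[of "\<lambda>\<mu>. ?g (\<lambda>i. if i \<in> {..<m} then - \<mu> (p i) else \<mu> (p i))"]
        image_mset.compositionality comp_def ..
    also have "\<dots> = (\<Sum>\<mu>\<in>#weights ?L. ?g \<mu>)"
      unfolding weights_signed_permutation[OF L perm order_refl] ..
    also have "\<dots> = (\<Sum>w\<in>?L. ?g (wt w))" by (rule sum_weights[symmetric])
    finally show ?thesis .
  qed
  finally have "alternant t m (rho m) * (\<Sum>T\<in>SP m lam. (t ^ 2) ^ pwr m lam T)
      = ?n * (alternant t m (rho m) * (\<Sum>w\<in>?L. ?g (wt w)))" by (simp only: mult_ac)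
  also have "alternant t m (rho m) * (\<Sum>w\<in>?L. ?g (wt w)) = (\<Sum>w | w \<in> ?L \<and> highest m w. alternant t m (\<lambda>j. rho m j + wt w j))"
    by (rule alternant_times_sum_highest[OF L t])
  also have "{w. w \<in> ?L \<and> highest m w} = {reading lam (row_filling lam)}"
  proof (intro equalityI subsetI)
    fix w assume "w \<in> {w. w \<in> ?L \<and> highest m w}"
    then obtain T where "T \<in> SP m lam" "w = reading lam T" "highest m (reading lam T)" by blast
    then show "w \<in> {reading lam (row_filling lam)}" using highest_unique[OF lam] by blast
  next
    fix w assume "w \<in> {reading lam (row_filling lam)}"
    then have "w = reading lam (row_filling lam)" by simp
    then show "w \<in> {w. w \<in> ?L \<and> highest m w}"
      using highest_row_filling[OF lam] row_filling_SP[OF lam len] by blast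
  qed
  finally show ?thesis by (simp add: wt_row_filling[OF lam])
qed

text \<open>The power of \<open>t\<close> that separates the alternant from a polynomial in \<open>q = t\<^sup>2\<close>.\<close>

definition t_exponent :: "nat \<Rightarrow> (nat \<Rightarrow> nat) \<Rightarrow> int" where
  "t_exponent m l = (\<Sum>j<m. int (2 * (m - 1 - j) + 1) * int (l j))"

lemma t_exponent_Suc: "t_exponent (Suc m) l = t_exponent m l + 2 * (\<Sum>j<m. int (l j)) + int (l m)"
proof -
  have "(\<Sum>j<m. int (2 * (Suc m - 1 - j) + 1) * int (l j)) = (\<Sum>j<m. int (2 * (m - 1 - j) + 1) * int (l j) + 2 * int (l j))"
    by (rule sum.cong) (auto simp: of_nat_diff algebra_simps)
  then show ?thesis by (simp add: t_exponent_def sum.distrib sum_distrib_left)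
qed

lemma alternant_eq_weyl_product:
  fixes t :: "'a::field"
  assumes t: "t \<noteq> 0"
  shows "(\<And>i j. i < j \<Longrightarrow> j < m \<Longrightarrow> l j < l i) \<Longrightarrow>
    alternant t m (\<lambda>j. int (l j)) = (\<Prod>j<m. (- 1) ^ Suc j) * t powi (- t_exponent m l) * weyl_product (t ^ 2) (l ` {..<m})"
proof (induction m)
  case 0
  show ?case by (simp add: alternant_product[OF t] t_exponent_def weyl_product_def)
next
  case (Suc m)
  let ?q = "t ^ 2"
  let ?z = "\<lambda>j. t powi (2 * int (l j)) + t powi (- 2 * int (l j))"
  have dec: "l j < l i" if "i < j" "j < Suc m" for i j using Suc.prems that by blast
  have qp: "?q ^ n = t powi (2 * int n)" for n
    unfolding power_int_mult power_int_of_nat by simp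
  note add = power_int_add[OF disjI1[OF t], symmetric]
  have single: "t powi int (l m) - t powi (- int (l m)) = - (t powi (- int (l m)) * qnum ?q (l m))"
  proof -
    have "t powi (- int (l m)) * ?q ^ l m = t powi (- int (l m) + 2 * int (l m))"
      unfolding qp add ..
    then show ?thesis by (simp add: qnum_def right_diff_distrib)
  qed
  have pair: "?z m - ?z i = - (t powi (- 2 * int (l i)) * (qnum ?q (dist_nat (l m) (l i)) * qnum ?q (l m + l i)))" if "i < m" for i
  proof -
    have lt: "l m < l i" using dec[of i m] that by simp
    have "qnum ?q (dist_nat (l m) (l i)) * qnum ?q (l m + l i)
        = 1 - t powi (2 * int (l i - l m)) - t powi (2 * int (l m + l i)) + t powi (2 * int (l i - l m)) * t powi (2 * int (l m + l i))"
      using lt unfolding dist_nat_simps(2)[OF lt] qnum_def qp by (simp only: left_diff_distrib right_diff_distrib mult_1_left mult_1_right) simp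
    then have "t powi (- 2 * int (l i)) * (qnum ?q (dist_nat (l m) (l i)) * qnum ?q (l m + l i))
        = t powi (- 2 * int (l i)) - t powi (- 2 * int (l i)) * t powi (2 * int (l i - l m))
          - t powi (- 2 * int (l i)) * t powi (2 * int (l m + l i))
          + t powi (- 2 * int (l i)) * (t powi (2 * int (l i - l m)) * t powi (2 * int (l m + l i)))"
      by (simp only: right_diff_distrib distrib_left mult_1_right)
    also have "\<dots> = t powi (- 2 * int (l i)) - t powi (- 2 * int (l m)) - t powi (2 * int (l m)) + t powi (2 * int (l i))"
    proof -
      have "- 2 * int (l i) + 2 * int (l i - l m) = - 2 * int (l m)" "- 2 * int (l i) + 2 * int (l m + l i) = 2 * int (l m)"
        "- 2 * int (l i) + (2 * int (l i - l m) + 2 * int (l m + l i)) = 2 * int (l i)"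
        using lt by (simp_all add: of_nat_diff)
      then show ?thesis unfolding add by simp
    qed
    finally show ?thesis by simp
  qed
  have "alternant t (Suc m) (\<lambda>j. int (l j)) = alternant t m (\<lambda>j. int (l j)) *
      ((t powi int (l m) - t powi (- int (l m))) * (\<Prod>i<m. ?z m - ?z i))"
    unfolding alternant_product[OF t] by (simp add: mult_ac)
  also have "(\<Prod>i<m. ?z m - ?z i)
      = (\<Prod>i<m. - 1 * (t powi (- 2 * int (l i)) * (qnum ?q (dist_nat (l m) (l i)) * qnum ?q (l m + l i))))"
    by (rule prod.cong) (use pair in auto)
  also have "\<dots> = (- 1) ^ m * (t powi (- 2 * (\<Sum>i<m. int (l i))) * (\<Prod>b\<in>l ` {..<m}. qnum ?q (dist_nat (l m) b) * qnum ?q (l m + b)))"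
  proof -
    have "inj_on l {..<m}" using dec by (intro linorder_inj_onI) force+
    then have "(\<Prod>b\<in>l ` {..<m}. qnum ?q (dist_nat (l m) b) * qnum ?q (l m + b)) = (\<Prod>i<m. qnum ?q (dist_nat (l m) (l i)) * qnum ?q (l m + l i))"
      by (simp add: prod.reindex)
    moreover have "t powi (- 2 * (\<Sum>i<m. int (l i))) = (\<Prod>i<m. t powi (- 2 * int (l i)))"
      unfolding sum_distrib_left by (rule power_int_sum[OF t]) simp
    ultimately show ?thesis by (simp only: prod.distrib prod_constant card_lessThan)
  qed
  finally have "alternant t (Suc m) (\<lambda>j. int (l j)) = alternant t m (\<lambda>j. int (l j)) *
      (- (t powi (- int (l m)) * qnum ?q (l m)) * ((- 1) ^ m * (t powi (- 2 * (\<Sum>i<m. int (l i))) * (\<Prod>b\<in>l ` {..<m}. qnum ?q (dist_nat (l m) b) * qnum ?q (l m + b)))))"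
    unfolding single .
  moreover have "alternant t m (\<lambda>j. int (l j)) = (\<Prod>j<m. (- 1) ^ Suc j) * t powi (- t_exponent m l) * weyl_product ?q (l ` {..<m})"
    using Suc.IH dec by simp
  moreover have "t powi (- t_exponent (Suc m) l) = t powi (- t_exponent m l) * (t powi (- int (l m)) * t powi (- 2 * (\<Sum>i<m. int (l i))))"
  proof -
    have "- t_exponent (Suc m) l = - t_exponent m l + (- int (l m) + - 2 * (\<Sum>i<m. int (l i)))"
      by (simp add: t_exponent_Suc)
    then show ?thesis by (simp only: add)
  qed
  moreover have "weyl_product ?q (l ` {..<Suc m}) = weyl_product ?q (l ` {..<m}) *
      (qnum ?q (l m) * (\<Prod>b\<in>l ` {..<m}. qnum ?q (dist_nat (l m) b) * qnum ?q (l m + b)))"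
  proof -
    have "l m \<notin> l ` {..<m}" using dec[of _ m] by force
    then show ?thesis by (simp add: lessThan_Suc weyl_product_insert)
  qed
  ultimately show ?case by (simp only: prod.lessThan_Suc power_Suc mult_ac mult_minus_left mult_minus_right mult_1_left)
qed

lemma diagram_eq_cells: "diagram lam = cells (part lam)"
  by (auto simp: diagram_def cells_def part_def split: if_splits)

lemma conj_part_eq_conj_fun: "conj_part lam j = conj_fun (part lam) j"
  by (simp add: conj_part_def conj_fun_def diagram_eq_cells)

lemma partition_fun_part: "is_partition lam \<Longrightarrow> length lam \<le> m \<Longrightarrow> partition_fun m (part lam)"
  unfolding partition_fun_def using part_antimono[of lam] by (auto simp: part_def)

lemma f_sp_eq_hook_factors: "f_sp q m lam = (\<Prod>b\<in>cells (part lam). hook_factor q m (part lam) b)"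
  unfolding f_sp_def hook_factor_def hook_def hook_fun_def r_sp_def r_fun_def conj_part_eq_conj_fun diagram_eq_cells ..

lemma shifted_parts: "shifted m (part lam) ` {1..m} = (\<lambda>j. m - j + part lam (Suc j)) ` {..<m}"
proof -
  have "{1..m} = Suc ` {..<m}" by (simp add: image_Suc_lessThan)
  then show ?thesis by (auto simp: image_image shifted_def add.commute intro!: image_cong)
qed

lemma sum_parts:
  assumes "length lam \<le> m"
  shows "card (diagram lam) = (\<Sum>j<m. part lam (Suc j))" "kappa lam = (\<Sum>j<m. j * part lam (Suc j))"
proof -
  have "diagram lam = (SIGMA i:{1..m}. {1..part lam i})"
    using assms by (auto simp: diagram_def part_def split: if_splits)
  also have "{1..m} = Suc ` {..<m}" by (simp add: image_Suc_lessThan)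
  finally have "card (diagram lam) = (\<Sum>i\<in>Suc ` {..<m}. part lam i)" by simp
  then show "card (diagram lam) = (\<Sum>j<m. part lam (Suc j))" by (simp add: sum.reindex)
  have "kappa lam = (\<Sum>i\<in>{1..m}. (i - 1) * part lam i)"
    unfolding kappa_def by (rule sum.mono_neutral_left) (use assms in \<open>auto simp: part_def\<close>)
  also have "{1..m} = Suc ` {..<m}" by (simp add: image_Suc_lessThan)
  finally show "kappa lam = (\<Sum>j<m. j * part lam (Suc j))" by (simp add: sum.reindex)
qed

text \<open>The powers of \<open>t\<close> left over from the specialization and from the two alternants combine to \<open>q\<^bsup>\<kappa>(\<lambda>)\<^esup>\<close>.\<close>

lemma principal_specialization_square:
  fixes t :: "'a::field_char_0"
  assumes lam: "is_partition lam" and len: "length lam \<le> m" and t: "t \<noteq> 0"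
    and nz: "\<And>n. n > 0 \<Longrightarrow> (t ^ 2) ^ n \<noteq> 1"
  shows "(\<Sum>T\<in>SP m lam. (t ^ 2) ^ pwr m lam T) = (t ^ 2) ^ kappa lam * f_sp (t ^ 2) m lam"
proof -
  let ?q = "t ^ 2"
  have qnum: "qnum ?q n \<noteq> 0" if "n > 0" for n using nz[OF that] by (simp add: qnum_def)
  define l where "l j = m - j + part lam (Suc j)" for j
  have le: "part lam (Suc j) \<le> part lam (Suc i)" if "i \<le> j" for i j using part_antimono[OF lam] that by simp
  have ldec: "l j < l i" if "i < j" "j < m" for i j using le[of i j] that by (simp add: l_def)
  let ?s = "\<Prod>j<m. (- 1 :: 'a) ^ Suc j"
  have cong: "alternant t m \<mu> = alternant t m \<nu>" if "\<And>j. j < m \<Longrightarrow> \<mu> j = \<nu> j" for \<mu> \<nu>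
    unfolding alternant_product[OF t] using that by (intro arg_cong2[of _ _ _ _ "(*)"] prod.cong) auto
  have top: "alternant t m (\<lambda>j. rho m j + int (part lam (Suc j))) = ?s * t powi (- t_exponent m l) * weyl_product ?q (l ` {..<m})"
  proof -
    have "alternant t m (\<lambda>j. rho m j + int (part lam (Suc j))) = alternant t m (\<lambda>j. int (l j))"
      by (rule cong) (simp add: rho_def l_def of_nat_diff)
    also have "\<dots> = ?s * t powi (- t_exponent m l) * weyl_product ?q (l ` {..<m})"
      by (rule alternant_eq_weyl_product[OF t ldec])
    finally show ?thesis .
  qed
  have bot: "alternant t m (rho m) = ?s * t powi (- t_exponent m (\<lambda>j. m - j)) * weyl_product ?q ((\<lambda>j. m - j) ` {..<m})"
  proof -
    have "alternant t m (rho m) = alternant t m (\<lambda>j. int (m - j))" by (rule cong) (simp add: rho_def of_nat_diff)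
    also have "\<dots> = ?s * t powi (- t_exponent m (\<lambda>j. m - j)) * weyl_product ?q ((\<lambda>j. m - j) ` {..<m})"
      by (rule alternant_eq_weyl_product[OF t]) auto
    finally show ?thesis .
  qed
  have img: "(\<lambda>j. m - j) ` {..<m} = {1..m}"
  proof (intro equalityI subsetI)
    fix x assume "x \<in> {1..m}"
    then show "x \<in> (\<lambda>j. m - j) ` {..<m}" by (intro image_eqI[of _ _ "m - x"]) auto
  qed auto
  have "?s \<noteq> 0" by (simp add: prod_zero_iff)
  have b0: "weyl_product ?q {1..m} \<noteq> 0" by (rule weyl_product_nonzero) (use qnum in auto)
  have hook: "f_sp ?q m lam * weyl_product ?q {1..m} = weyl_product ?q (l ` {..<m})"
    unfolding f_sp_eq_hook_factors l_def shifted_parts[symmetric]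
    by (rule hook_product[OF qnum partition_fun_part[OF lam len]])
  have expo: "(2 * int m - 1) * int (card (diagram lam)) + - t_exponent m l = - t_exponent m (\<lambda>j. m - j) + 2 * int (kappa lam)"
  proof -
    have "(2 * int m - 1) * int (part lam (Suc j)) - int (2 * (m - 1 - j) + 1) * int (l j)
        = - (int (2 * (m - 1 - j) + 1) * int (m - j)) + 2 * int (j * part lam (Suc j))" if "j < m" for j
      using that by (simp add: l_def of_nat_diff algebra_simps)
    then have "(\<Sum>j<m. (2 * int m - 1) * int (part lam (Suc j)) - int (2 * (m - 1 - j) + 1) * int (l j))
        = (\<Sum>j<m. - (int (2 * (m - 1 - j) + 1) * int (m - j)) + 2 * int (j * part lam (Suc j)))"
      by (intro sum.cong) auto
    then show ?thesis
      unfolding sum_parts[OF len] t_exponent_def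
      by (simp only: sum_subtractf sum.distrib sum_negf of_nat_sum sum_distrib_left[symmetric] diff_conv_add_uminus)
  qed
  have "?s * t powi (- t_exponent m (\<lambda>j. m - j)) * weyl_product ?q {1..m} * (\<Sum>T\<in>SP m lam. ?q ^ pwr m lam T)
      = t powi ((2 * int m - 1) * int (card (diagram lam))) * (?s * t powi (- t_exponent m l) * weyl_product ?q (l ` {..<m}))"
    using sum_pwr_alternant[OF lam len t] unfolding top bot img .
  also have "\<dots> = ?s * (t powi ((2 * int m - 1) * int (card (diagram lam))) * t powi (- t_exponent m l)) * (f_sp ?q m lam * weyl_product ?q {1..m})"
    unfolding hook by (simp only: mult_ac)
  also have "t powi ((2 * int m - 1) * int (card (diagram lam))) * t powi (- t_exponent m l)
      = t powi (- t_exponent m (\<lambda>j. m - j)) * t powi (2 * int (kappa lam))"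
    unfolding power_int_add[OF disjI1[OF t], symmetric] expo ..
  also have "t powi (2 * int (kappa lam)) = ?q ^ kappa lam"
    unfolding power_int_mult power_int_of_nat by simp
  finally have "(?s * t powi (- t_exponent m (\<lambda>j. m - j)) * weyl_product ?q {1..m}) * (\<Sum>T\<in>SP m lam. ?q ^ pwr m lam T)
      = (?s * t powi (- t_exponent m (\<lambda>j. m - j)) * weyl_product ?q {1..m}) * (?q ^ kappa lam * f_sp ?q m lam)"
    by (simp only: mult_ac)
  moreover have "?s * t powi (- t_exponent m (\<lambda>j. m - j)) * weyl_product ?q {1..m} \<noteq> 0"
    using \<open>?s \<noteq> 0\<close> b0 t by simp
  ultimately show ?thesis unfolding mult_cancel_left by blast
qed

lemma q_bracket_nonneg: "0 \<le> k \<Longrightarrow> q_bracket q k = 1 - q ^ nat k"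
  unfolding q_bracket_def by (metis int_nat_eq power_int_of_nat)

lemma f_sp_powers:
  fixes q :: "'a::field"
  assumes lam: "is_partition lam" and len: "length lam \<le> m"
  shows "f_sp q m lam = (\<Prod>(i, j)\<in>diagram lam. 1 - q ^ nat (2 * int m + r_sp lam i j))
    / (\<Prod>(i, j)\<in>diagram lam. 1 - q ^ nat (hook lam i j))" "\<And>i j. (i, j) \<in> diagram lam \<Longrightarrow> 0 < hook lam i j"
proof -
  show h: "0 < hook lam i j" if "(i, j) \<in> diagram lam" for i j
    using that diagram_iff[OF lam, of i j] by (auto simp: hook_def diagram_def)
  have r: "0 \<le> 2 * int m + r_sp lam i j" if "(i, j) \<in> diagram lam" for i j
    using that len conj_part_le_length[of lam i] conj_part_le_length[of lam j] by (auto simp: r_sp_def diagram_def)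
  show "f_sp q m lam = (\<Prod>(i, j)\<in>diagram lam. 1 - q ^ nat (2 * int m + r_sp lam i j))
    / (\<Prod>(i, j)\<in>diagram lam. 1 - q ^ nat (hook lam i j))"
    unfolding f_sp_def prod_dividef[symmetric]
    by (rule prod.cong[OF HOL.refl]) (use h r in \<open>auto simp: q_bracket_nonneg less_imp_le\<close>)
qed

lemma to_fract_hom:
  "to_fract (p ^ n) = to_fract p ^ n" "to_fract (\<Prod>i\<in>A. f i) = (\<Prod>i\<in>A. to_fract (f i))"
  "to_fract (\<Sum>i\<in>A. f i) = (\<Sum>i\<in>A. to_fract (f i))"
proof -
  show "to_fract (p ^ n) = to_fract p ^ n" by (induction n) simp_all
  show "to_fract (\<Prod>i\<in>A. f i) = (\<Prod>i\<in>A. to_fract (f i))" by (induction A rule: infinite_finite_induct) simp_all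
  show "to_fract (\<Sum>i\<in>A. f i) = (\<Sum>i\<in>A. to_fract (f i))" by (induction A rule: infinite_finite_induct) simp_all
qed

text \<open>There are infinitely many squares of rational numbers above \<open>1\<close>.\<close>

lemma poly_eqI_squares:
  fixes p p' :: "rat poly"
  assumes "\<And>t :: rat. t > 1 \<Longrightarrow> poly p (t ^ 2) = poly p' (t ^ 2)"
  shows "p = p'"
proof (rule ccontr)
  assume "p \<noteq> p'"
  then have "finite {x. poly (p - p') x = 0}" by (intro poly_roots_finite) simp
  moreover have "range (\<lambda>n::nat. (of_nat n + 2 :: rat) ^ 2) \<subseteq> {x. poly (p - p') x = 0}"
    using assms[of "of_nat _ + 2"] by auto
  ultimately have "finite (range (\<lambda>n::nat. (of_nat n + 2 :: rat) ^ 2))" by (rule finite_subset[rotated])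
  moreover have "inj (\<lambda>n::nat. (of_nat n + 2 :: rat) ^ 2)"
    by (intro injI) (simp add: power2_eq_iff_nonneg)
  ultimately show False using finite_imageD infinite_UNIV_nat by blast
qed

theorem theorem4p1:
  fixes m :: nat and lam :: "nat list"
  assumes "m \<ge> 1"
    and "is_partition lam"
    and "length lam \<le> m"
  shows "f_sp qvar m lam = qvar powi (- int (kappa lam)) * (\<Sum>T\<in>SP m lam. qvar ^ pwr m lam T)"
proof -
  note lam = assms(2) and len = assms(3)
  define X where "X = ([:0, 1:] :: rat poly)"
  have pX: "poly X r = r" for r by (simp add: X_def)
  let ?N = "\<Prod>(i, j)\<in>diagram lam. 1 - X ^ nat (2 * int m + r_sp lam i j)"
  let ?H = "\<Prod>(i, j)\<in>diagram lam. 1 - X ^ nat (hook lam i j)"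
  let ?S = "\<Sum>T\<in>SP m lam. X ^ pwr m lam T"
  have "?H * ?S = X ^ kappa lam * ?N"
  proof (rule poly_eqI_squares)
    fix t :: rat assume t: "t > 1"
    have one: "(t ^ 2) ^ n \<noteq> 1" if "n > 0" for n
      by (rule less_imp_neq[symmetric]) (intro one_less_power t that zero_less_numeral)
    have "(\<Prod>(i, j)\<in>diagram lam. 1 - (t ^ 2) ^ nat (hook lam i j)) \<noteq> 0"
      using f_sp_powers(2)[OF lam len] one finite_diagram by (auto simp: prod_zero_iff)
    then show "poly (?H * ?S) (t ^ 2) = poly (X ^ kappa lam * ?N) (t ^ 2)"
      using principal_specialization_square[OF lam len _ one] t
      by (simp add: f_sp_powers(1)[OF lam len] poly_prod poly_sum case_prod_unfold pX field_simps)
  qed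
  then have eq: "to_fract ?H * to_fract ?S = to_fract X ^ kappa lam * to_fract ?N"
    unfolding to_fract_hom(1)[symmetric] to_fract_mult[symmetric] by (rule arg_cong)
  have X: "to_fract X = qvar" by (simp add: to_fract_def qvar_def X_def)
  have H: "to_fract ?H = (\<Prod>(i, j)\<in>diagram lam. 1 - qvar ^ nat (hook lam i j))"
    by (simp add: to_fract_hom X case_prod_unfold)
  have N: "to_fract ?N = (\<Prod>(i, j)\<in>diagram lam. 1 - qvar ^ nat (2 * int m + r_sp lam i j))"
    by (simp add: to_fract_hom X case_prod_unfold)
  have S: "to_fract ?S = (\<Sum>T\<in>SP m lam. qvar ^ pwr m lam T)"
    by (simp add: to_fract_hom X)
  have "poly ?H 2 \<noteq> 0"
  proof -
    have "(2 :: rat) ^ nat (hook lam i j) \<noteq> 1" if "(i, j) \<in> diagram lam" for i j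
      by (rule less_imp_neq[symmetric], rule one_less_power) (use f_sp_powers(2)[OF lam len that] in auto)
    then show ?thesis using finite_diagram by (auto simp: poly_prod prod_zero_iff case_prod_unfold pX)
  qed
  then have "?H \<noteq> 0" by auto
  then have "to_fract ?H \<noteq> 0" by simp
  moreover have "qvar \<noteq> 0" unfolding X[symmetric] by (simp add: X_def)
  ultimately show ?thesis
    using eq unfolding f_sp_powers(1)[OF lam len] X H N S
    by (simp add: power_int_minus field_simps)
qed

end
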